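(* Let $r,n_1,\ldots,n_r$ be positive integers, let $I\subseteq\{i : n_i=1\}$ be any subset, and let $E=\{(i,0) : i\in I\}$ be the associated set of exceptional index pairs. Let $F$ be a multihomogeneous polynomial over $\overline{\mathbb Q}$ of multidegrees $d_1,\ldots,d_r$ in the groups of variables $\mathbf x_i=(x_{i0},\ldots,x_{in_i})$, $1\le i\le r$, such that (i) all coefficients of $F$ are totally real algebraic integers, and (ii) the coefficients of the regular monomials of $F$ (with respect to $E$) are rational integers. Let $C_F=C_F(E)$ and $\delta$ be the quantities attached to $F$ and $I$ as defined in the context. If $\mathbf x=(\mathbf x_1,\ldots,\mathbf x_r)\in\mathbb P^{n_1}(\overline{\mathbb Q})\times\cdots\times\mathbb P^{n_r}(\overline{\mathbb Q})$ satisfies $F(\mathbf x)=0$, $\prod_{i,j}x_{ij}\neq 0$ and $F(\mathbf x^{-1})\neq 0$, then $$\sum_{i=1}^{r}(n_i+1)\log H(\mathbf x_i)\ \ge\ \log\rho,$$ where $\rho$ is the unique real root larger than $1$ of $x^{-2}+C_F^{-1}x^{-\delta}=1$.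
   Context: Height: for a number field $K$ of degree $D=[K:\mathbb Q]$ and a place $v$ of $K$ above the place $p$ of $\mathbb Q$, let $D_v=[K_v:\mathbb Q_p]$, let $\|\cdot\|_v$ be the unique absolute value on $K_v$ extending the usual ($p$-adic or Archimedean) absolute value on $\mathbb Q_p$, and $|\cdot|_v=\|\cdot\|_v^{D_v/D}$. For $\mathbf y=(y_0,\ldots,y_n)\in\mathbb P^n(K)$, $\log H(\mathbf y)=\sum_v\log\max_i|y_i|_v$, the sum being over all places $v$ of $K$; this is independent of the choice of homogeneous coordinates and of $K$, and so defines $H$ on $\mathbb P^n(\overline{\mathbb Q})$. Notation: points of $\mathbb P^{n_1}\times\cdots\times\mathbb P^{n_r}$ are written $\mathbf x=(\mathbf x_1,\ldots,\mathbf x_r)$ with $\mathbf x_i=(x_{i0},\ldots,x_{in_i})$. If all $x_{ij}\ne0$, $\mathbf x^{-1}$ is the point obtained by replacing each $x_{ij}$ by $x_{ij}^{-1}$. "Multihomogeneous of multidegrees $d_1,\ldots,d_r$" means homogeneous of degree $d_i$ in the variables $x_{i0},\ldots,x_{in_i}$ for each $i$. Index pairs $(i,j)$ ($1\le i\le r$, $0\le j\le n_i$) in $E$ are exceptional; those not in $E$ are regular. A monomial of $F$ is regular if some variable $x_{ij}$ with $(i,j)$ a regular index pair appears in it; otherwise it is exceptional. Let $d_{ij}$ be the degree of $F$ in the variable $x_{ij}$ and $\tilde d_i=-d_i+\sum_{j}d_{ij}$. Then $$\delta=\max\left\{\max_{i\in I}\frac{\tilde d_i+d_{i1}}{n_i+1},\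 \max_{i\notin I}\frac{\tilde d_i}{n_i+1}\right\}.$$ For an Archimedean place $v$ of a number field containing the coefficients of $F$, let $c(F,v,i,j)$ be the sum of the absolute values $\|\cdot\|_v$ of the coefficients of $\partial F/\partial x_{ij}$. For $(i,j)\notin E$ this involves only coefficients of regular monomials, which are rational integers by (ii), so it does not depend on $v$; put $$C_F=C_F(E)=\max_{(i,j)\notin E}c(F,v,i,j).$$ *)

theory Defs
  imports
    "HOL-Analysis.Infinite_Sum"
    "HOL-Library.Poly_Mapping"
    "HOL-Algebra.QuotRing"
    "HOL-Algebra.Embedded_Algebras"
    "HOL-Algebra.Generated_Fields"
    "HOL-Algebra.Algebraic_Closure_Type"
begin

section \<open>Places, local degrees and heights\<close>

text \<open>Number fields are subfields of the complex numbers, seen as a HOL-Algebra ring;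
  the algebraic closure of the rationals is the set of \<open>z :: complex\<close> with \<open>algebraic z\<close>.\<close>

abbreviation complex_ring :: "complex ring" where
  "complex_ring \<equiv> ring_of_type_algebra"

definition padic_abs :: "nat \<Rightarrow> rat \<Rightarrow> real" where
  "padic_abs p q = (if q = 0 then 0 else
     real p powi (int (multiplicity (int p) (snd (quotient_of q)))
                  - int (multiplicity (int p) (fst (quotient_of q)))))"

definition absolute_value_on :: "complex set \<Rightarrow> (complex \<Rightarrow> real) \<Rightarrow> bool" where
  "absolute_value_on K v \<longleftrightarrow>
     (\<forall>x\<in>K. 0 \<le> v x \<and> (v x = 0 \<longleftrightarrow> x = 0)) \<and>
     (\<forall>x\<in>K. \<forall>y\<in>K. v (x * y) = v x * v y \<and> v (x + y) \<le> v x + v y)"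

text \<open>A place is represented by the unique absolute value in its class that extends the usual
  absolute value of a place of the rationals, i.e. by \<open>\<parallel>\<cdot>\<parallel>\<^sub>v\<close> restricted to \<open>K\<close>. Extensionality makes
  distinct functions represent distinct places.\<close>

definition places :: "complex set \<Rightarrow> (complex \<Rightarrow> real) set" where
  "places K = {v \<in> extensional K. absolute_value_on K v \<and>
     ((\<exists>p. Factorial_Ring.prime p \<and> (\<forall>q. v (of_rat q) = padic_abs p q)) \<or>
      (\<forall>q. v (of_rat q) = real_of_rat \<bar>q\<bar>))}"

text \<open>The completion \<open>K\<^sub>v\<close> is the ring of Cauchy sequences in \<open>K\<close> modulo the null sequences.\<close>

definition cauchy_seqs :: "complex set \<Rightarrow> (complex \<Rightarrow> real) \<Rightarrow> (nat \<Rightarrow> complex) set" where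
  "cauchy_seqs K v = {s. (\<forall>k. s k \<in> K) \<and>
     (\<forall>e>0. \<exists>N. \<forall>k\<ge>N. \<forall>l\<ge>N. v (s k - s l) < e)}"

definition cauchy_ring :: "complex set \<Rightarrow> (complex \<Rightarrow> real) \<Rightarrow> (nat \<Rightarrow> complex) ring" where
  "cauchy_ring K v =
     \<lparr>carrier = cauchy_seqs K v, monoid.mult = (\<lambda>s t k. s k * t k), one = (\<lambda>_. 1),
      ring.zero = (\<lambda>_. 0), add = (\<lambda>s t k. s k + t k)\<rparr>"

definition null_seqs :: "complex set \<Rightarrow> (complex \<Rightarrow> real) \<Rightarrow> (nat \<Rightarrow> complex) set" where
  "null_seqs K v = {s \<in> cauchy_seqs K v. (\<lambda>k. v (s k)) \<longlonglongrightarrow> 0}"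

definition completion :: "complex set \<Rightarrow> (complex \<Rightarrow> real) \<Rightarrow> (nat \<Rightarrow> complex) set ring" where
  "completion K v = cauchy_ring K v Quot null_seqs K v"

text \<open>The copy of \<open>\<rat>\<^sub>p\<close> (or of the reals, for \<open>v\<close> Archimedean) inside \<open>K\<^sub>v\<close>: the classes of
  \<open>v\<close>-Cauchy sequences of rationals.\<close>

definition completed_rationals :: "complex set \<Rightarrow> (complex \<Rightarrow> real) \<Rightarrow> (nat \<Rightarrow> complex) set set" where
  "completed_rationals K v =
     (\<lambda>s. null_seqs K v +>\<^bsub>cauchy_ring K v\<^esub> s) ` cauchy_seqs \<rat> v"

definition local_degree :: "complex set \<Rightarrow> (complex \<Rightarrow> real) \<Rightarrow> nat" where
  "local_degree K v =
     ring.dim (completion K v) (completed_rationals K v) (carrier (completion K v))"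

definition field_degree :: "complex set \<Rightarrow> nat" where
  "field_degree K = ring.dim complex_ring \<rat> K"

definition normalized_abs :: "complex set \<Rightarrow> (complex \<Rightarrow> real) \<Rightarrow> complex \<Rightarrow> real" where
  "normalized_abs K v z = v z powr (real (local_degree K v) / real (field_degree K))"

text \<open>The point \<open>(y\<^sub>0 : \<dots> : y\<^sub>n)\<close> is given by homogeneous coordinates \<open>y 0, \<dots>, y n\<close>.
  All but finitely many terms of the sum vanish.\<close>

definition log_height_over :: "complex set \<Rightarrow> nat \<Rightarrow> (nat \<Rightarrow> complex) \<Rightarrow> real" where
  "log_height_over K n y =
     (\<Sum>\<^sub>\<infinity>v\<in>places K. ln (Max ((\<lambda>j. normalized_abs K v (y j)) ` {0..n})))"

text \<open>The value does not depend on the number field containing the coordinates; we use the one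
  they generate.\<close>

definition log_height :: "nat \<Rightarrow> (nat \<Rightarrow> complex) \<Rightarrow> real" where
  "log_height n y = log_height_over (generate_field complex_ring (y ` {0..n})) n y"


section \<open>Multihomogeneous polynomials\<close>

text \<open>A polynomial in the variables \<open>x\<^sub>i\<^sub>j\<close> maps monomials (finitely supported exponent functions on
  index pairs) to their coefficients.\<close>

type_synonym monomial = "nat \<times> nat \<Rightarrow>\<^sub>0 nat"
type_synonym mpolynomial = "monomial \<Rightarrow>\<^sub>0 complex"

definition mpoly_eval :: "mpolynomial \<Rightarrow> (nat \<times> nat \<Rightarrow> complex) \<Rightarrow> complex" where
  "mpoly_eval F x =
     (\<Sum>m\<in>Poly_Mapping.keys F. Poly_Mapping.lookup F m * (\<Prod>w\<in>Poly_Mapping.keys m. x w ^ Poly_Mapping.lookup m w))"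

definition partial_derivative :: "nat \<times> nat \<Rightarrow> mpolynomial \<Rightarrow> mpolynomial" where
  "partial_derivative w F =
     (\<Sum>m\<in>Poly_Mapping.keys F.
        Poly_Mapping.single (m - Poly_Mapping.single w 1) (of_nat (Poly_Mapping.lookup m w) * Poly_Mapping.lookup F m))"

definition degree_in :: "mpolynomial \<Rightarrow> nat \<times> nat \<Rightarrow> nat" where
  "degree_in F w = Max (insert 0 ((\<lambda>m. Poly_Mapping.lookup m w) ` Poly_Mapping.keys F))"

definition index_pairs :: "nat \<Rightarrow> (nat \<Rightarrow> nat) \<Rightarrow> (nat \<times> nat) set" where
  "index_pairs r n = (SIGMA i:{1..r}. {0..n i})"

definition multihomogeneous :: "nat \<Rightarrow> (nat \<Rightarrow> nat) \<Rightarrow> (nat \<Rightarrow> nat) \<Rightarrow> mpolynomial \<Rightarrow> bool" where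
  "multihomogeneous r n d F \<longleftrightarrow>
     (\<forall>m\<in>Poly_Mapping.keys F. Poly_Mapping.keys m \<subseteq> index_pairs r n \<and>
        (\<forall>i\<in>{1..r}. (\<Sum>j=0..n i. Poly_Mapping.lookup m (i, j)) = d i))"

definition exceptional_pairs :: "nat set \<Rightarrow> (nat \<times> nat) set" where
  "exceptional_pairs I = {(i, 0) | i. i \<in> I}"

definition regular_monomial :: "(nat \<times> nat) set \<Rightarrow> monomial \<Rightarrow> bool" where
  "regular_monomial E m \<longleftrightarrow> (\<exists>w\<in>Poly_Mapping.keys m. w \<notin> E)"

text \<open>Totally real: all conjugates, i.e. all roots of the irreducible polynomial over the
  rationals, are real.\<close>

definition totally_real :: "complex \<Rightarrow> bool" where
  "totally_real a \<longleftrightarrow>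
     (\<exists>p::rat poly. Factorial_Ring.irreducible p \<and> poly (map_poly of_rat p) a = 0 \<and>
        (\<forall>z::complex. poly (map_poly of_rat p) z = 0 \<longrightarrow> z \<in> \<real>))"

definition coeff_sum :: "mpolynomial \<Rightarrow> (complex \<Rightarrow> real) \<Rightarrow> nat \<times> nat \<Rightarrow> real" where
  "coeff_sum F v w =
     (\<Sum>m\<in>Poly_Mapping.keys (partial_derivative w F). v (Poly_Mapping.lookup (partial_derivative w F) m))"

text \<open>For regular \<open>w\<close> the value \<open>coeff_sum F v w\<close> is the same for all Archimedean \<open>v\<close>; the one
  used here, \<open>cmod\<close>, comes from the inclusion in the complex numbers.\<close>

definition C_const :: "nat \<Rightarrow> (nat \<Rightarrow> nat) \<Rightarrow> (nat \<times> nat) set \<Rightarrow> mpolynomial \<Rightarrow> real" where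
  "C_const r n E F = Max (coeff_sum F cmod ` (index_pairs r n - E))"

definition d_tilde :: "(nat \<Rightarrow> nat) \<Rightarrow> (nat \<Rightarrow> nat) \<Rightarrow> mpolynomial \<Rightarrow> nat \<Rightarrow> real" where
  "d_tilde n d F i = - real (d i) + (\<Sum>j=0..n i. real (degree_in F (i, j)))"

text \<open>One maximum over a union, since \<open>I\<close> or its complement may be empty.\<close>

definition delta :: "nat \<Rightarrow> (nat \<Rightarrow> nat) \<Rightarrow> (nat \<Rightarrow> nat) \<Rightarrow> nat set \<Rightarrow> mpolynomial \<Rightarrow> real" where
  "delta r n d I F = Max
     ((\<lambda>i. (d_tilde n d F i + real (degree_in F (i, 1))) / (real (n i) + 1)) ` I \<union>
      (\<lambda>i. d_tilde n d F i / (real (n i) + 1)) ` ({1..r} - I))"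

end

theory Submission
  imports Defs "Jordan_Normal_Form.Char_Poly" "HOL-Analysis.Convex"
begin

text \<open>Let \<open>\<theta>\<close> generate a number field containing everything in sight and fix, for \<open>p = \<infinity>\<close> and every
  prime \<open>p\<close>, one extension \<open>u\<^sub>p\<close> of the absolute value to all algebraic numbers. The places over \<open>p\<close>
  are then the functions \<open>a \<mapsto> u\<^sub>p (\<sigma> a)\<close>, \<open>\<sigma>\<close> an embedding of the field into the complex numbers, and
  the local degree counts the embeddings that give the same place. So heights become sums over
  pairs \<open>(\<sigma>, p)\<close>, and the product formula follows from the one for rational numbers, applied to norms.

  Let \<open>g = F(x\<^sup>-\<^sup>1) \<Prod> x\<^sub>i\<^sub>j ^ d\<^sub>i\<^sub>j\<close>. At the primes \<open>\<bar>g\<bar>\<close> is bounded by the ultrametric inequality.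
  At an Archimedean place the conjugate coefficients are real, so \<open>F\<close> vanishes at the complex conjugate
  of \<open>x\<close> as well; if, after scaling, all coordinates of \<open>x\<close> are close to the unit circle then \<open>x\<^sup>-\<^sup>1\<close> is close to that zero
  and \<open>\<bar>g\<bar>\<close> is small, and otherwise the height of \<open>x\<close> is large. The product formula for the \<open>x\<^sub>i\<^sub>j\<close> and \<open>g\<close>
  adds up these local inequalities, and the best exponent for \<open>g\<close> turns the bound into \<open>ln \<rho>\<close>.\<close>

section \<open>Conjugates and primitive elements\<close>

text \<open>One chosen extension of each absolute value replaces prime ideals and ramification by
  finite sums over the roots of one minimal polynomial. The price is a local degree defined through
  Cauchy sequences: it is the number of embeddings inducing the place only once the powers of
  \<theta> below that number are known to be a basis of the completion, which rests on weak
  approximation and on the rationality of characteristic polynomials.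

  An embedding may change the coefficients of exceptional monomials, while the constant in the
  Archimedean estimate must be the same for all embeddings. So in an exceptional group
  \<open>x (i, 0)\<close> is scaled to 1, which takes the exceptional variables out of the
  comparison with the conjugate point.

  That comparison costs a factor C (1 - P^2), where P = exp(-S) and S measures the distance of the
  normalised coordinates from the unit circle. The equation for \<rho> says that C (1 - P^2) =
  P^\<delta> at P = 1 / \<rho>. There the combined lower bound equals ln \<rho> for every exponent
  of g; the exponent is chosen so that this point is the minimum over S.\<close>

interpretation of_rat_poly_hom: map_poly_comm_ring_hom "of_rat :: rat \<Rightarrow> complex" ..

definition rat_eval :: "rat poly \<Rightarrow> complex \<Rightarrow> complex" where
  "rat_eval q z = poly (map_poly of_rat q) z"

lemma rat_eval_0 [simp]: "rat_eval 0 z = 0"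
  and rat_eval_1 [simp]: "rat_eval 1 z = 1"
  and rat_eval_add [simp]: "rat_eval (p + q) z = rat_eval p z + rat_eval q z"
  and rat_eval_diff [simp]: "rat_eval (p - q) z = rat_eval p z - rat_eval q z"
  and rat_eval_mult [simp]: "rat_eval (p * q) z = rat_eval p z * rat_eval q z"
  and rat_eval_power [simp]: "rat_eval (p ^ n) z = rat_eval p z ^ n"
  and rat_eval_monom [simp]: "rat_eval (monom c n) z = of_rat c * z ^ n"
  and rat_eval_smult [simp]: "rat_eval (smult c p) z = of_rat c * rat_eval p z"
  and rat_eval_pCons [simp]: "rat_eval (pCons c p) z = of_rat c + z * rat_eval p z"
  by (simp_all add: rat_eval_def hom_distribs poly_monom)

lemma rat_eval_altdef: "degree q < n \<Longrightarrow> rat_eval q z = (\<Sum>i<n. of_rat (coeff q i) * z ^ i)"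
  unfolding rat_eval_def by (subst poly_as_sum_of_monoms'[symmetric, of _ "n - 1"])
    (auto simp: poly_sum poly_monom degree_map_poly lessThan_Suc_atMost[symmetric] intro!: sum.cong)

lemma rat_eval_dvd: "p dvd q \<Longrightarrow> rat_eval p z = 0 \<Longrightarrow> rat_eval q z = 0"
  by (auto elim!: dvdE)

text \<open>The monic generator of the ideal of rational polynomials vanishing at \<open>z\<close>.
  Irreducibility is a consequence of this description, in the form of
  \<open>is_minpoly_coprime\<close>.\<close>

definition is_minpoly :: "rat poly \<Rightarrow> complex \<Rightarrow> bool" where
  "is_minpoly f z \<longleftrightarrow> lead_coeff f = 1 \<and> (\<forall>q. rat_eval q z = 0 \<longleftrightarrow> f dvd q)"

lemma is_minpoly_monic: "is_minpoly f z \<Longrightarrow> lead_coeff f = 1"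
  and is_minpoly_iff: "is_minpoly f z \<Longrightarrow> rat_eval q z = 0 \<longleftrightarrow> f dvd q"
  and is_minpoly_root: "is_minpoly f z \<Longrightarrow> rat_eval f z = 0"
  by (auto simp: is_minpoly_def)

lemma is_minpoly_nonzero: "is_minpoly f z \<Longrightarrow> f \<noteq> 0"
  by (auto simp: is_minpoly_def)

lemma is_minpoly_degree_pos: assumes "is_minpoly f z" shows "degree f > 0"
proof (rule ccontr)
  assume "\<not> ?thesis"
  hence "f = 1" using is_minpoly_monic[OF assms] monic_degree_0 by blast
  thus False using is_minpoly_root[OF assms] by simp
qed

lemma exists_minpoly:
  assumes "algebraic z" obtains f where "is_minpoly f z"
proof -
  from assms obtain p :: "complex poly" where p: "\<And>i. coeff p i \<in> \<int>" "p \<noteq> 0" "poly p z = 0"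
    by (auto simp: algebraic_def)
  \<comment> \<open>\<open>algebraic\<close> provides integer coefficients of complex type;
    inverting \<open>of_int\<close> reads them as rationals.\<close>
  define q :: "rat poly" where "q = map_poly (\<lambda>c. of_int (the_inv of_int c)) p"
  have inv: "of_int (the_inv of_int c) = c" if "c \<in> \<int>" for c :: complex
    using that by (auto simp: Ints_def the_inv_f_f inj_on_def)
  have [simp]: "the_inv of_int (0::complex) = 0" using the_inv_f_f[of "of_int :: int \<Rightarrow> complex" 0] by (auto simp: inj_on_def)
  have q: "map_poly of_rat q = p"
    by (rule poly_eqI) (simp add: q_def coeff_map_poly inv p(1))
  have ex: "\<exists>q. q \<noteq> 0 \<and> rat_eval q z = 0"
    using q p by (intro exI[of _ q]) (auto simp: rat_eval_def)
  define P where "P = (\<lambda>q. q \<noteq> 0 \<and> rat_eval q z = 0)"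
  define g where "g = arg_min degree P"
  have Pg: "P g" and min: "\<And>q. P q \<Longrightarrow> degree g \<le> degree q"
    using ex arg_min_natI[of P _ degree] arg_min_nat_le[of P _ degree] unfolding g_def P_def by auto
  define f where "f = smult (inverse (lead_coeff g)) g"
  have "lead_coeff f = 1" "rat_eval f z = 0" "degree f = degree g" "f \<noteq> 0"
    using Pg by (auto simp: f_def P_def)
  moreover have "f dvd q" if "rat_eval q z = 0" for q
  proof -
    have "rat_eval (q mod f) z = 0"
      using that \<open>rat_eval f z = 0\<close> by (simp add: minus_mult_div_eq_mod[symmetric])
    moreover have "q mod f = 0 \<or> degree (q mod f) < degree f" using \<open>f \<noteq> 0\<close> by (rule degree_mod_less)
    ultimately have "q mod f = 0" using min[of "q mod f"] \<open>degree f = _\<close> using \<open>rat_eval (q mod f) z = 0\<close> unfolding P_def by linarith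
    thus ?thesis by auto
  qed
  ultimately have "is_minpoly f z" by (auto simp: is_minpoly_def intro: rat_eval_dvd)
  thus ?thesis by (rule that)
qed

lemma rat_eval_coprime:
  assumes "coprime p q" shows "\<not> (rat_eval p z = 0 \<and> rat_eval q z = 0)"
proof
  assume *: "rat_eval p z = 0 \<and> rat_eval q z = 0"
  obtain a b where "a * p + b * q = 1"
    using assms by (metis bezout_coefficients_fst_snd coprime_iff_gcd_eq_1)
  hence "rat_eval (a * p + b * q) z = 1" by simp
  thus False using * by simp
qed

text \<open>Write f = d e with d = gcd f q. If d vanished at \<open>z\<close>, f would divide d and
  hence q; so e vanishes there, f divides e, and d is a unit.\<close>

lemma is_minpoly_coprime:
  assumes "is_minpoly f z" "\<not> f dvd q" shows "coprime f q"
proof -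
  define d where "d = gcd f q"
  obtain e where e: "f = d * e" unfolding d_def by (meson gcd_dvd1 dvdE)
  have "rat_eval d z \<noteq> 0"
    using assms is_minpoly_iff[OF assms(1)] unfolding d_def by (meson dvd_trans gcd_dvd2)
  hence "rat_eval e z = 0" using is_minpoly_root[OF assms(1)] e by auto
  hence "f dvd e" using is_minpoly_iff[OF assms(1)] by auto
  hence "is_unit d" using e is_minpoly_nonzero[OF assms(1)]
    by (metis dvd_mult_cancel_right mult_1 mult_eq_0_iff)
  thus ?thesis unfolding d_def using is_unit_gcd by blast
qed

text \<open>A polynomial vanishing at \<open>w\<close> and not divisible by \<open>f\<close> would
  be coprime to \<open>f\<close> and still share the root \<open>w\<close>. This is what makes the
  embeddings injective later on.\<close>

lemma is_minpoly_conj: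
  assumes f: "is_minpoly f z" and w: "rat_eval f w = 0" shows "is_minpoly f w"
  unfolding is_minpoly_def
proof (intro conjI allI iffI)
  fix q assume "rat_eval q w = 0"
  thus "f dvd q" using is_minpoly_coprime[OF f, of q] rat_eval_coprime[of f q w] w by auto
qed (use assms in \<open>auto simp: is_minpoly_def intro: rat_eval_dvd\<close>)

definition roots_of :: "rat poly \<Rightarrow> complex set" where "roots_of f = {z. rat_eval f z = 0}"

lemma roots_of_iff: "z \<in> roots_of f \<longleftrightarrow> rat_eval f z = 0" by (simp add: roots_of_def)

lemma finite_roots_of: "f \<noteq> 0 \<Longrightarrow> finite (roots_of f)"
  unfolding roots_of_def rat_eval_def by (rule poly_roots_finite) simp

lemma rat_eval_pderiv: "poly (pderiv (map_poly of_rat q)) z = rat_eval (pderiv q) z"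
  by (simp add: rat_eval_def of_rat_hom.map_poly_pderiv)

text \<open>\<open>f\<close> is the minimal polynomial of each of its roots, so a double root would
  force it to divide its derivative, which is nonzero of smaller degree.\<close>

lemma is_minpoly_rsquarefree:
  assumes f: "is_minpoly f z" shows "rsquarefree (map_poly of_rat f :: complex poly)"
  unfolding rsquarefree_roots
proof safe
  fix a :: complex assume a: "poly (map_poly of_rat f) a = 0" "poly (pderiv (map_poly of_rat f)) a = 0"
  have m: "is_minpoly f a" using is_minpoly_conj[OF f] a(1) by (simp add: rat_eval_def)
  have "f dvd pderiv f" using a(2) is_minpoly_iff[OF m] by (simp add: rat_eval_pderiv)
  moreover have "pderiv f \<noteq> 0" "degree (pderiv f) < degree f"
    using is_minpoly_degree_pos[OF f] by (auto simp: pderiv_eq_0_iff degree_pderiv)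
  ultimately show False using dvd_imp_degree_le by fastforce
qed

lemma minpoly_factorization:
  assumes f: "is_minpoly f z"
  shows "(map_poly of_rat f :: complex poly) = (\<Prod>w\<in>roots_of f. [:- w, 1:])"
  using complex_poly_decompose_rsquarefree[OF is_minpoly_rsquarefree[OF f]] is_minpoly_monic[OF f]
  by (simp add: roots_of_def rat_eval_def)

lemma card_roots_of:
  assumes f: "is_minpoly f z" shows "card (roots_of f) = degree f"
proof -
  have "degree f = degree (map_poly of_rat f :: complex poly)" by simp
  also have "\<dots> = card (roots_of f)" unfolding minpoly_factorization[OF f]
    by (subst degree_prod_eq_sum_degree) auto
  finally show ?thesis by simp
qed

definition rat_adjoin :: "complex \<Rightarrow> complex set" where
  "rat_adjoin \<theta> = range (\<lambda>q. rat_eval q \<theta>)"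

text \<open>Meaningful only for \<open>a\<close> in \<open>rat_adjoin \<theta>\<close> and \<open>z\<close> a conjugate of \<open>\<theta>\<close>: then every choice of \<open>q\<close> gives the same value.\<close>

definition conj_map :: "complex \<Rightarrow> complex \<Rightarrow> complex \<Rightarrow> complex" where
  "conj_map \<theta> z a = rat_eval (SOME q. rat_eval q \<theta> = a) z"

lemma conj_map_rat_eval:
  assumes f: "is_minpoly f \<theta>" and z: "z \<in> roots_of f"
  shows "conj_map \<theta> z (rat_eval q \<theta>) = rat_eval q z"
proof -
  define q' where "q' = (SOME q'. rat_eval q' \<theta> = rat_eval q \<theta>)"
  have "rat_eval q' \<theta> = rat_eval q \<theta>" unfolding q'_def by (rule someI[of _ q]) simp
  hence "f dvd q' - q" using is_minpoly_iff[OF f, of "q' - q"] by simp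
  hence "rat_eval (q' - q) z = 0" using z rat_eval_dvd unfolding roots_of_iff by blast
  thus ?thesis by (simp add: conj_map_def q'_def)
qed

lemma rat_adjoin_iff: "a \<in> rat_adjoin \<theta> \<longleftrightarrow> (\<exists>q. a = rat_eval q \<theta>)"
  by (auto simp: rat_adjoin_def)

section \<open>Subfields of the complex numbers as plain sets\<close>

definition complex_subfield :: "complex set \<Rightarrow> bool" where
  "complex_subfield K \<longleftrightarrow> 1 \<in> K \<and> (\<forall>x\<in>K. \<forall>y\<in>K. x - y \<in> K \<and> x * y \<in> K) \<and> (\<forall>x\<in>K. inverse x \<in> K)"

lemma complex_subfield_rat_adjoin:
  assumes "is_minpoly f \<theta>" shows "complex_subfield (rat_adjoin \<theta>)"
  unfolding complex_subfield_def
proof (intro conjI ballI)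
  show "1 \<in> rat_adjoin \<theta>" unfolding rat_adjoin_iff by (rule exI[of _ 1]) simp
  fix x assume x: "x \<in> rat_adjoin \<theta>"
  then obtain p where p: "x = rat_eval p \<theta>" by (auto simp: rat_adjoin_iff)
  show "inverse x \<in> rat_adjoin \<theta>"
  proof (cases "x = 0")
    case True thus ?thesis using x by simp
  next
    case False
    hence "\<not> f dvd p" using is_minpoly_iff[OF assms] p by auto
    hence "coprime f p" by (rule is_minpoly_coprime[OF assms])
    then obtain a b where "a * f + b * p = 1"
      by (metis bezout_coefficients_fst_snd coprime_iff_gcd_eq_1)
    hence "rat_eval (a * f + b * p) \<theta> = 1" by simp
    hence "rat_eval b \<theta> * x = 1" using is_minpoly_root[OF assms] p by simp
    hence "inverse x = rat_eval b \<theta>" using False by (simp add: field_simps)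
    thus ?thesis by (auto simp: rat_adjoin_iff)
  qed
  fix y assume "y \<in> rat_adjoin \<theta>"
  then obtain q where q: "y = rat_eval q \<theta>" by (auto simp: rat_adjoin_iff)
  show "x - y \<in> rat_adjoin \<theta>" "x * y \<in> rat_adjoin \<theta>"
    unfolding p q rat_adjoin_iff by (metis rat_eval_diff, metis rat_eval_mult)
qed

context
  fixes K assumes K: "complex_subfield K"
begin

lemma csf_1: "1 \<in> K" and csf_diff: "x \<in> K \<Longrightarrow> y \<in> K \<Longrightarrow> x - y \<in> K"
  and csf_mult: "x \<in> K \<Longrightarrow> y \<in> K \<Longrightarrow> x * y \<in> K" and csf_inverse: "x \<in> K \<Longrightarrow> inverse x \<in> K"
  using K by (auto simp: complex_subfield_def)

lemma csf_0: "0 \<in> K" using csf_diff[OF csf_1 csf_1] by simp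
lemma csf_minus: "x \<in> K \<Longrightarrow> - x \<in> K" using csf_diff[OF csf_0, of x] by simp
lemma csf_add: "x \<in> K \<Longrightarrow> y \<in> K \<Longrightarrow> x + y \<in> K" using csf_diff[of x "- y"] csf_minus by simp
lemma csf_divide: "x \<in> K \<Longrightarrow> y \<in> K \<Longrightarrow> x / y \<in> K" by (simp add: divide_inverse csf_mult csf_inverse)
lemma csf_power: "x \<in> K \<Longrightarrow> x ^ n \<in> K" by (induction n) (auto simp: csf_1 csf_mult)
lemma csf_sum: "(\<And>i. i \<in> A \<Longrightarrow> g i \<in> K) \<Longrightarrow> sum g A \<in> K"
  by (induction A rule: infinite_finite_induct) (auto simp: csf_0 csf_add)
lemma csf_prod: "(\<And>i. i \<in> A \<Longrightarrow> g i \<in> K) \<Longrightarrow> prod g A \<in> K"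
  by (induction A rule: infinite_finite_induct) (auto simp: csf_1 csf_mult)
lemma csf_of_nat: "of_nat n \<in> K" by (induction n) (auto simp: csf_0 csf_1 csf_add)
lemma csf_of_int: "of_int n \<in> K" by (cases n rule: int_cases2) (auto simp: csf_of_nat csf_minus)
lemma csf_of_rat: "of_rat q \<in> K"
  by (cases q) (auto simp: of_rat_rat csf_divide csf_of_int)
lemma csf_rat_eval: "x \<in> K \<Longrightarrow> rat_eval q x \<in> K"
  by (induction q) (auto simp: csf_0 csf_add csf_mult csf_of_rat)

lemma csf_rat_adjoin: "x \<in> K \<Longrightarrow> rat_adjoin x \<subseteq> K"
  by (auto simp: rat_adjoin_iff csf_rat_eval)

end

lemma in_rat_adjoin_self: "\<theta> \<in> rat_adjoin \<theta>"
  unfolding rat_adjoin_iff by (rule exI[of _ "[:0, 1:]"]) simp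

lemma complex_ring_simps [simp]:
  "carrier complex_ring = UNIV" "mult complex_ring = (*)" "one complex_ring = 1"
  "zero complex_ring = 0" "add complex_ring = (+)"
  by (simp_all add: ring_of_type_algebra_def fun_eq_iff)

lemma complex_ring_field: "field complex_ring" by (rule field_from_type_algebra)

lemma complex_ring_ring: "ring complex_ring" by (rule ring_from_type_algebra)

lemma complex_ring_cring: "cring complex_ring" by (rule cring_from_type_algebra)

lemma complex_ring_inv: "x \<noteq> 0 \<Longrightarrow> inv\<^bsub>complex_ring\<^esub> x = inverse x"
  using comm_monoid.comm_inv_char[OF cring.axioms(2)[OF complex_ring_cring], of x "inverse x"] by simp

lemma complex_ring_minus: "\<ominus>\<^bsub>complex_ring\<^esub> x = - x"
  using abelian_group.minus_equality[OF ring.is_abelian_group[OF complex_ring_ring], of "- x" x] by simp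

lemma subfield_iff_complex_subfield: "subfield K complex_ring \<longleftrightarrow> complex_subfield K"
proof
  assume K: "subfield K complex_ring"
  note s = subringE[OF subfieldE(1)[OF K]]
  show "complex_subfield K" unfolding complex_subfield_def
  proof (intro conjI ballI)
    show "1 \<in> K" using s(3) by simp
    fix x assume x: "x \<in> K"
    show "inverse x \<in> K"
      using x s(2) ring.subfield_m_inv(1)[OF complex_ring_ring K, of x] by (cases "x = 0") (auto simp: complex_ring_inv)
    fix y assume y: "y \<in> K"
    show "x * y \<in> K" using s(6)[OF x y] by simp
    show "x - y \<in> K" using s(7)[OF x s(5)[OF y]] by (simp add: complex_ring_minus)
  qed
next
  assume K: "complex_subfield K"
  show "subfield K complex_ring"
  proof (rule field.subfieldI'[OF complex_ring_field])
    show "subring K complex_ring"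
      by (rule ring.subringI[OF complex_ring_ring]) (auto simp: complex_ring_minus csf_minus[OF K] csf_1[OF K] csf_mult[OF K] csf_add[OF K])
  qed (auto simp: complex_ring_inv csf_inverse[OF K])
qed

section \<open>Characteristic polynomials and averages over conjugates\<close>

lemma conj_charpoly_rational:
  assumes f: "is_minpoly f \<theta>"
  obtains h where "map_poly of_rat h = (\<Prod>z\<in>roots_of f. [:- rat_eval q z, 1:])"
proof -
  define n where "n = degree f"
  have "finite (roots_of f)" using finite_roots_of is_minpoly_nonzero[OF f] by blast
  then obtain zs where zs: "set zs = roots_of f" "distinct zs" using finite_distinct_list by blast
  have len: "length zs = n" using card_roots_of[OF f] zs distinct_card[of zs] by (simp add: n_def)
  \<comment> \<open>Row j of \<open>A\<close> lists the coefficients of q X^j mod f, so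
    \<open>A\<close> is the rational matrix of multiplication by \<open>rat_eval q \<theta>\<close>.
    Evaluating the rows at the roots gives \<open>C * V = V * Dg\<close> with the Vandermonde matrix
    \<open>V\<close> of the roots and a diagonal \<open>Dg\<close>. So the product sought is the
    characteristic polynomial of \<open>A\<close>, and symmetric functions do not enter.\<close>
  define A where "A = mat n n (\<lambda>(j, k). coeff ((q * monom 1 j) mod f) k)"
  define C :: "complex mat" where "C = map_mat of_rat A"
  define V where "V = mat n n (\<lambda>(k, i). (zs ! i) ^ k)"
  define Dg where "Dg = mat n n (\<lambda>(i, j). if i = j then rat_eval q (zs ! i) else 0)"
  have carr: "C \<in> carrier_mat n n" "V \<in> carrier_mat n n" "Dg \<in> carrier_mat n n" "A \<in> carrier_mat n n"
    by (auto simp: C_def A_def V_def Dg_def)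
  have root: "rat_eval f (zs ! i) = 0" if "i < n" for i
    using that len zs(1) nth_mem[of i zs] by (auto simp: roots_of_iff)
  have CV: "C * V = V * Dg"
  proof (rule eq_matI)
    fix j i assume "j < dim_row (V * Dg)" "i < dim_col (V * Dg)"
    hence ji: "j < n" "i < n" using carr by auto
    define r where "r = (q * monom 1 j) mod f"
    have "(C * V) $$ (j, i) = (\<Sum>k<n. of_rat (coeff r k) * zs ! i ^ k)"
      using ji carr by (auto simp: C_def A_def V_def r_def scalar_prod_def lessThan_atLeast0 intro!: sum.cong)
    also have "\<dots> = rat_eval r (zs ! i)"
    proof -
      have "degree r < n"
        using degree_mod_less[OF is_minpoly_nonzero[OF f], of "q * monom 1 j"] is_minpoly_degree_pos[OF f]
        unfolding r_def n_def by fastforce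
      thus ?thesis by (simp add: rat_eval_altdef)
    qed
    also have "\<dots> = rat_eval (q * monom 1 j) (zs ! i)"
      using root[OF ji(2)] by (simp add: r_def minus_mult_div_eq_mod[symmetric])
    also have "\<dots> = (\<Sum>k<n. V $$ (j, k) * Dg $$ (k, i))"
      using ji by (auto simp: V_def Dg_def if_distrib cong: if_cong)
    also have "\<dots> = (V * Dg) $$ (j, i)"
      using ji carr by (auto simp: scalar_prod_def lessThan_atLeast0 intro!: sum.cong)
    finally show "(C * V) $$ (j, i) = (V * Dg) $$ (j, i)" .
  qed (use carr in auto)
  \<comment> \<open>A kernel vector of the transpose would be the coefficient list of a nonzero
    polynomial of degree below n with the n distinct roots \<open>zs\<close>.\<close>
  have "det (transpose_mat V) \<noteq> 0"
  proof
    assume "det (transpose_mat V) = 0"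
    then obtain v where v: "v \<in> carrier_vec n" "v \<noteq> 0\<^sub>v n" "transpose_mat V *\<^sub>v v = 0\<^sub>v n"
      using det_0_iff_vec_prod_zero[of "transpose_mat V" n] carr by auto
    define p where "p = (\<Sum>k<n. monom (v $ k) k)"
    have cp: "coeff p k = (if k < n then v $ k else 0)" for k
      by (auto simp: p_def coeff_sum)
    have "poly p z = 0" if z: "z \<in> set zs" for z
    proof -
      obtain i where i: "i < n" "z = zs ! i" using z len unfolding in_set_conv_nth by blast
      have "0 = (transpose_mat V *\<^sub>v v) $ i" using v(3) i by simp
      also have "\<dots> = (\<Sum>k<n. z ^ k * v $ k)"
        using i v(1) carr by (auto simp: scalar_prod_def lessThan_atLeast0 V_def intro!: sum.cong)
      also have "\<dots> = poly p z" by (simp add: p_def poly_sum poly_monom mult.commute)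
      finally show ?thesis by simp
    qed
    moreover have "p \<noteq> 0"
    proof
      assume "p = 0"
      hence "v $ k = 0" if "k < n" for k using cp[of k] that by simp
      thus False using v(1,2) by auto
    qed
    moreover have "n > 0" using is_minpoly_degree_pos[OF f] by (simp add: n_def)
    ultimately have "card (set zs) \<le> degree p"
      using card_poly_roots_bound[of p] card_mono[of "{x. poly p x = 0}" "set zs"] poly_roots_finite[of p]
      by force
    moreover have "degree p < n" using cp[of "degree p"] \<open>p \<noteq> 0\<close> by (metis leading_coeff_0_iff)
    ultimately show False using distinct_card[OF zs(2)] len by simp
  qed
  hence "det V \<noteq> 0" using det_transpose[OF carr(2)] by simp
  hence "V \<in> Units (ring_mat TYPE(complex) n ())" by (rule det_non_zero_imp_unit[OF carr(2)])
  then obtain W where W: "W \<in> carrier_mat n n" "V * W = 1\<^sub>m n" "W * V = 1\<^sub>m n"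
    by (auto simp: Units_def ring_mat_def)
  have "C = V * Dg * W"
    using CV W carr assoc_mult_mat[OF carr(1) carr(2) W(1)] right_mult_one_mat[OF carr(1)] by simp
  hence "similar_mat_wit C Dg V W" by (intro similar_mat_witI[OF W(2,3) _ carr(1,3,2) W(1)])
  hence "char_poly C = char_poly Dg" by (intro char_poly_similar) (auto simp: similar_mat_def)
  also have "\<dots> = (\<Prod>a\<leftarrow>diag_mat Dg. [:- a, 1:])"
    by (rule char_poly_upper_triangular[OF carr(3)]) (auto simp: Dg_def)
  also have "diag_mat Dg = map (rat_eval q) zs"
    by (rule nth_equalityI) (auto simp: diag_mat_def Dg_def len)
  also have "(\<Prod>a\<leftarrow>map (rat_eval q) zs. [:- a, 1:]) = (\<Prod>z\<in>roots_of f. [:- rat_eval q z, 1:])"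
    using prod.distinct_set_conv_list[OF zs(2), of "\<lambda>z. [:- rat_eval q z, 1:]"] zs(1) by (simp add: o_def)
  finally have "map_poly of_rat (char_poly A) = (\<Prod>z\<in>roots_of f. [:- rat_eval q z, 1:])"
    using of_rat_hom.char_poly_hom[OF carr(4)] unfolding C_def by metis
  thus ?thesis by (rule that)
qed

lemma rat_eval_pcompose [simp]: "rat_eval (pcompose p q) z = rat_eval p (rat_eval q z)"
  by (induction p) (auto simp: pcompose_pCons)

lemma conj_in_roots_of:
  assumes f: "is_minpoly f \<theta>" and g: "is_minpoly g (rat_eval q \<theta>)" and z: "z \<in> roots_of f"
  shows "rat_eval q z \<in> roots_of g"
proof -
  have "f dvd pcompose g q" using is_minpoly_iff[OF f, of "pcompose g q"] is_minpoly_root[OF g] by simp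
  thus ?thesis using rat_eval_dvd[of f "pcompose g q" z] z by (simp add: roots_of_iff)
qed

text \<open>Every root of \<open>h\<close> has \<open>g\<close> as its minimal polynomial, so a
  factor \<open>g\<close> can be split off as long as \<open>h\<close> is not constant.\<close>

lemma eq_power_minpoly:
  assumes g: "is_minpoly g \<theta>" and "lead_coeff h = 1" and "\<And>w. rat_eval h w = 0 \<Longrightarrow> rat_eval g w = 0"
  shows "\<exists>k. h = g ^ k"
  using assms(2,3)
proof (induction "degree h" arbitrary: h rule: less_induct)
  case less
  show ?case
  proof (cases "degree h = 0")
    case True
    hence "h = 1" using less.prems(1) monic_degree_0 by blast
    thus ?thesis by (intro exI[of _ 0]) simp
  next
    case False
    hence "\<not> constant (poly (map_poly of_rat h :: complex poly))" by (simp add: constant_degree)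
    then obtain w where w: "rat_eval h w = 0"
      using fundamental_theorem_of_algebra unfolding rat_eval_def by blast
    hence "is_minpoly g w" using less.prems(2) is_minpoly_conj[OF g] by blast
    hence "g dvd h" using is_minpoly_iff w by blast
    then obtain h' where h': "h = g * h'" by (elim dvdE)
    have "lead_coeff h' = 1" using less.prems(1) is_minpoly_monic[OF g] by (simp add: h' lead_coeff_mult)
    moreover from this have "degree h' < degree h"
      using is_minpoly_degree_pos[OF g] is_minpoly_nonzero[OF g] unfolding h'
      by (subst degree_mult_eq) auto
    ultimately obtain k where "h' = g ^ k" using less.hyps[of h'] less.prems(2) by (auto simp: h')
    thus ?thesis by (intro exI[of _ "Suc k"]) (simp add: h')
  qed
qed

lemma order_prod_linear_factors:
  fixes c :: "'b \<Rightarrow> complex"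
  assumes "finite A"
  shows "Polynomial.order w (\<Prod>z\<in>A. [:- c z, 1:]) = card {z \<in> A. c z = w}"
  using assms
proof (induction A)
  case (insert a A)
  have "{z \<in> insert a A. c z = w} = (if c a = w then insert a {z \<in> A. c z = w} else {z \<in> A. c z = w})"
    by auto
  moreover have "Polynomial.order w [:- c a, 1:] = (if c a = w then 1 else 0)"
    by (simp add: order_linear')
  moreover have "Polynomial.order w ([:- c a, 1:] * (\<Prod>z\<in>A. [:- c z, 1:])) =
      Polynomial.order w [:- c a, 1:] + Polynomial.order w (\<Prod>z\<in>A. [:- c z, 1:])"
    using insert by (intro order_mult) (auto simp del: mult_pCons_left)
  ultimately show ?case using insert by (simp del: mult_pCons_left)
qed (simp add: order_0I)

lemma order_power_eq:
  fixes p :: "complex poly" assumes "p \<noteq> 0" shows "Polynomial.order w (p ^ k) = k * Polynomial.order w p"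
  by (induction k) (use assms in \<open>auto simp: order_mult order_0I\<close>)

text \<open>The polynomial with the roots \<open>rat_eval q z\<close> is rational and its roots are
  conjugates of one element, so it is a power of \<open>g\<close>. As \<open>g\<close> is
  squarefree, the exponent is the multiplicity of every root, and the multiplicity counts the
  fibre.\<close>

lemma conj_fibre_card:
  assumes f: "is_minpoly f \<theta>" and g: "is_minpoly g (rat_eval q \<theta>)"
  obtains k where "\<And>w. w \<in> roots_of g \<Longrightarrow> card {z \<in> roots_of f. rat_eval q z = w} = k"
proof -
  obtain h where h: "map_poly of_rat h = (\<Prod>z\<in>roots_of f. [:- rat_eval q z, 1:])"
    using conj_charpoly_rational[OF f] by blast
  have fin: "finite (roots_of f)" using finite_roots_of is_minpoly_nonzero[OF f] by blast
  have "lead_coeff (map_poly of_rat h :: complex poly) = 1"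
    unfolding h by (rule monic_prod) auto
  hence "lead_coeff h = 1" by simp
  moreover have "rat_eval g w = 0" if "rat_eval h w = 0" for w
    using that conj_in_roots_of[OF f g] fin by (auto simp: rat_eval_def h poly_prod roots_of_iff)
  ultimately obtain k where k: "h = g ^ k" using eq_power_minpoly[OF g] by blast
  have "card {z \<in> roots_of f. rat_eval q z = w} = k" if w: "w \<in> roots_of g" for w
  proof -
    have 1: "Polynomial.order w (map_poly of_rat h :: complex poly) = card {z \<in> roots_of f. rat_eval q z = w}"
      unfolding h by (rule order_prod_linear_factors[OF fin])
    have "Polynomial.order w (map_poly of_rat g :: complex poly) = 1"
      using rsquarefree_root_order[OF is_minpoly_rsquarefree[OF g], of w] w is_minpoly_nonzero[OF g]
      by (simp add: roots_of_iff rat_eval_def)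
    hence "Polynomial.order w (map_poly of_rat h :: complex poly) = k"
      using is_minpoly_nonzero[OF g] by (simp add: k of_rat_poly_hom.hom_power order_power_eq)
    thus ?thesis using 1 by simp
  qed
  thus ?thesis by (rule that)
qed

text \<open>The reason why heights do not depend on the field: an average over the embeddings of a
  large field equals the average over those of the field generated by one element.\<close>

lemma sum_conj_average:
  fixes \<Phi> :: "complex \<Rightarrow> real"
  assumes f: "is_minpoly f \<theta>" and g: "is_minpoly g (rat_eval q \<theta>)"
  shows "(\<Sum>z\<in>roots_of f. \<Phi> (rat_eval q z)) / degree f = (\<Sum>w\<in>roots_of g. \<Phi> w) / degree g"
proof -
  obtain k where k: "\<And>w. w \<in> roots_of g \<Longrightarrow> card {z \<in> roots_of f. rat_eval q z = w} = k"
    using conj_fibre_card[OF f g] by blast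
  have fin: "finite (roots_of f)" "finite (roots_of g)"
    using finite_roots_of is_minpoly_nonzero[OF f] is_minpoly_nonzero[OF g] by blast+
  have *: "(\<Sum>z\<in>roots_of f. \<Phi> (rat_eval q z)) = real k * (\<Sum>w\<in>roots_of g. \<Phi> w)" for \<Phi> :: "complex \<Rightarrow> real"
  proof -
    have "(\<Sum>z\<in>roots_of f. \<Phi> (rat_eval q z)) =
        (\<Sum>w\<in>roots_of g. \<Sum>z\<in>{z \<in> roots_of f. rat_eval q z = w}. \<Phi> (rat_eval q z))"
      by (rule sum.group[symmetric]) (use fin conj_in_roots_of[OF f g] in auto)
    also have "\<dots> = (\<Sum>w\<in>roots_of g. real k * \<Phi> w)"
      by (intro sum.cong) (auto simp: k)
    finally show ?thesis by (simp add: sum_distrib_left)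
  qed
  have "real (degree f) = real k * real (degree g)"
    using *[of "\<lambda>_. 1"] card_roots_of[OF f] card_roots_of[OF g] by simp
  thus ?thesis
    using *[of \<Phi>] is_minpoly_degree_pos[OF f] is_minpoly_degree_pos[OF g] by (cases "k = 0") auto
qed

section \<open>The primitive element theorem\<close>

definition coeffs_in :: "complex set \<Rightarrow> complex poly \<Rightarrow> bool" where
  "coeffs_in K p \<longleftrightarrow> (\<forall>i. coeff p i \<in> K)"

text \<open>Cancelling the leading term by a multiple of a monic polynomial keeps the coefficients
  in \<open>K\<close>. This permits minimal polynomials over a set \<open>K\<close>, although the
  coefficient type is always complex.\<close>

lemma coeffs_in_mod:
  assumes K: "complex_subfield K" and "coeffs_in K p" "coeffs_in K m" "lead_coeff m = 1"
  shows "coeffs_in K (p mod m)"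
  using assms(2)
proof (induction "degree p" arbitrary: p rule: less_induct)
  case less
  show ?case
  proof (cases "degree p < degree m")
    case True thus ?thesis using less.prems by (simp add: mod_poly_less)
  next
    case False
    define p' where "p' = p - m * monom (lead_coeff p) (degree p - degree m)"
    have "p' mod m = p mod m" unfolding p'_def by (simp add: mod_diff_eq[symmetric])
    have in_K: "coeffs_in K p'"
      using less.prems assms(3) csf_0[OF K]
      by (auto simp: coeffs_in_def p'_def mult.commute[of m] coeff_monom_mult intro!: csf_diff[OF K] csf_mult[OF K])
    show ?thesis
    proof (cases "degree p = 0")
      case True
      hence "degree m = 0" using False by simp
      hence "m = 1" using assms(4) monic_degree_0 by blast
      thus ?thesis by (simp add: coeffs_in_def csf_0[OF K])
    next
      case dp: False
      have "m \<noteq> 0" "p \<noteq> 0" using assms(4) dp by auto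
      have "degree p' < degree p"
      proof -
        have "degree p' \<le> degree p" unfolding p'_def
          using False by (intro degree_diff_le order_trans[OF degree_mult_le]) (auto simp: degree_monom_eq \<open>p \<noteq> 0\<close>)
        moreover have "coeff p' (degree p) = 0"
          using False assms(4) by (auto simp: p'_def mult.commute[of m] coeff_monom_mult)
        ultimately show ?thesis using dp by (metis degree_0 leading_coeff_0_iff le_neq_implies_less neq0_conv)
      qed
      hence "coeffs_in K (p' mod m)" using less.hyps in_K by blast
      thus ?thesis using \<open>p' mod m = p mod m\<close> by simp
    qed
  qed
qed

text \<open>HOL-Algebra lists coefficients from the leading one downwards, \<open>Poly\<close> from
  the constant one upwards.\<close>

lemma complex_ring_eval: "ring.eval complex_ring p x = poly (Poly (rev p)) x"
proof (induction p)
  case Nil thus ?case by (simp add: ring.eval.simps[OF complex_ring_ring])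
next
  case (Cons a p)
  have pow: "x [^]\<^bsub>complex_ring\<^esub> (n :: nat) = x ^ n" for n
    by (induction n) (simp_all add: nat_pow_def)
  show ?case using Cons
    by (simp add: ring.eval.simps[OF complex_ring_ring] pow Poly_append poly_monom)
qed

lemma complex_subfield_Rats: "complex_subfield \<rat>"
  by (auto simp: complex_subfield_def)

text \<open>Serves to transfer the theorem that the elements algebraic over a subfield form a
  subfield.\<close>

lemma algebraic_over_Rats_iff: "(ring.algebraic complex_ring over \<rat>) x \<longleftrightarrow> algebraic x"
proof
  have sub: "subring \<rat> complex_ring"
    using complex_subfield_Rats subfield_iff_complex_subfield subfieldE(1) by blast
  assume "(ring.algebraic complex_ring over \<rat>) x"
  then obtain p where p: "p \<in> carrier (\<rat>[X]\<^bsub>complex_ring\<^esub>)" "p \<noteq> []" "ring.eval complex_ring p x = 0"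
    using domain.algebraicE[OF field.axioms(1)[OF complex_ring_field] sub, of x] by auto
  hence s: "set p \<subseteq> \<rat>" "hd p \<noteq> 0" by (auto simp: univ_poly_def polynomial_def)
  have "coeff (Poly (rev p)) i \<in> \<rat>" for i
    using s(1) nth_mem[of i "rev p"] by (auto simp: nth_default_def simp del: nth_mem)
  moreover have "coeff (Poly (rev p)) (length p - 1) \<noteq> 0"
    using s(2) p(2) by (simp add: nth_default_def rev_nth hd_conv_nth)
  hence "Poly (rev p) \<noteq> 0" by (metis coeff_0)
  ultimately show "algebraic x" using p(3) by (intro algebraicI') (auto simp: complex_ring_eval)
next
  assume "algebraic x"
  then obtain p where p: "\<And>i. coeff p i \<in> \<rat>" "p \<noteq> 0" "poly p x = 0"
    by (auto simp: algebraic_altdef)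
  show "(ring.algebraic complex_ring over \<rat>) x"
  proof (rule ring.algebraicI[OF complex_ring_ring])
    show "rev (coeffs p) \<in> carrier (\<rat>[X]\<^bsub>complex_ring\<^esub>)"
      using p by (auto simp: univ_poly_def polynomial_def coeffs_def hd_rev last_map)
    show "rev (coeffs p) \<noteq> []" using p(2) by simp
    show "ring.eval complex_ring (rev (coeffs p)) x = \<zero>\<^bsub>complex_ring\<^esub>"
      using p(3) by (simp add: complex_ring_eval)
  qed
qed

lemma complex_subfield_algebraic: "complex_subfield {z. algebraic z}"
proof -
  have "subfield \<rat> complex_ring"
    using complex_subfield_Rats subfield_iff_complex_subfield by blast
  from field.subfield_of_algebraics[OF complex_ring_field this]
  show ?thesis by (simp add: algebraic_over_Rats_iff subfield_iff_complex_subfield)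
qed

lemma pcompose_linear_coeffs_in:
  assumes K: "complex_subfield K" and "coeffs_in K p" "a \<in> K" "b \<in> K"
  shows "coeffs_in K (pcompose p [:a, b:])"
  using assms(2)
proof (induction p)
  case 0 thus ?case by (simp add: coeffs_in_def)
next
  case (pCons c p)
  have "coeff (pCons c p) (Suc i) \<in> K" for i using pCons.prems unfolding coeffs_in_def by blast
  hence "coeffs_in K (pcompose p [:a, b:])" using pCons.IH by (auto simp: coeffs_in_def)
  moreover have "coeff (pCons c p) 0 \<in> K" using pCons.prems unfolding coeffs_in_def by blast
  moreover from calculation(1) have "coeff (pcompose p [:a, b:]) 0 \<in> K" unfolding coeffs_in_def by blast
  ultimately show ?case using assms
    by (auto simp: coeffs_in_def pcompose_pCons coeff_pCons split: nat.splits
        intro!: csf_add[OF K] csf_mult[OF K] csf_0[OF K])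
qed

text \<open>Put \<theta> = a + c b. Once c avoids finitely many values, b is the only common root of
  its minimal polynomial g and of f(\<theta> - c X). The minimal polynomial \<open>m\<close> of b
  over \<open>rat_adjoin \<theta>\<close> divides both, so it has no other root, and the root is
  simple because g is squarefree. Hence m = X - b, and b is in the field.\<close>

lemma rat_adjoin_pair:
  assumes "algebraic a" "algebraic b"
  obtains c :: rat where "b \<in> rat_adjoin (a + of_rat c * b)"
proof -
  obtain f g where f: "is_minpoly f a" and g: "is_minpoly g b" using assms exists_minpoly by metis
  \<comment> \<open>The values of c for which a second common root could occur. Pairs with b' = b
    contribute a quotient by zero, that is 0, which only excludes one more value.\<close>
  define B where "B = (\<lambda>(a', b'). (a' - a) / (b - b')) ` (roots_of f \<times> roots_of g)"
  have "finite B" unfolding B_def using finite_roots_of is_minpoly_nonzero f g by blast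
  moreover have "infinite (range (of_rat :: rat \<Rightarrow> complex))"
    using finite_imageD[of "of_rat :: rat \<Rightarrow> complex" UNIV] infinite_UNIV_char_0[where 'a = rat]
    by (auto simp: inj_on_def)
  ultimately have "\<not> range (of_rat :: rat \<Rightarrow> complex) \<subseteq> B" using finite_subset by blast
  then obtain c :: rat where c: "of_rat c \<notin> B" by blast
  define \<theta> where "\<theta> = a + of_rat c * b"
  have "algebraic \<theta>"
    using csf_add[OF complex_subfield_algebraic] csf_mult[OF complex_subfield_algebraic]
      csf_of_rat[OF complex_subfield_algebraic, of c] assms by (auto simp: \<theta>_def)
  then obtain h where h: "is_minpoly h \<theta>" by (rule exists_minpoly)
  define K where "K = rat_adjoin \<theta>"
  have K: "complex_subfield K" unfolding K_def by (rule complex_subfield_rat_adjoin[OF h])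
  have \<theta>: "\<theta> \<in> K" unfolding K_def by (rule in_rat_adjoin_self)
  define P1 :: "complex poly" where "P1 = map_poly of_rat g"
  define P2 :: "complex poly" where "P2 = pcompose (map_poly of_rat f) [:\<theta>, - of_rat c:]"
  have cP1: "coeffs_in K P1" by (simp add: P1_def coeffs_in_def csf_of_rat[OF K])
  have cP2: "coeffs_in K P2" unfolding P2_def
    by (rule pcompose_linear_coeffs_in[OF K _ \<theta>]) (auto simp: coeffs_in_def csf_of_rat[OF K] csf_minus[OF K])
  have root: "poly P1 b = 0" "poly P2 b = 0"
    using is_minpoly_root[OF f] is_minpoly_root[OF g]
    by (simp_all add: P1_def P2_def poly_pcompose rat_eval_def \<theta>_def algebra_simps)
  have sqf: "rsquarefree P1" unfolding P1_def by (rule is_minpoly_rsquarefree[OF g])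
  define Q where "Q = (\<lambda>p. p \<noteq> 0 \<and> coeffs_in K p \<and> poly p b = 0)"
  have "Q P1" using cP1 root(1) sqf by (auto simp: Q_def rsquarefree_def)
  define m0 where "m0 = arg_min degree Q"
  have Q0: "Q m0" and min: "\<And>p. Q p \<Longrightarrow> degree m0 \<le> degree p"
    using \<open>Q P1\<close> arg_min_natI[of Q _ degree] arg_min_nat_le[of Q _ degree] unfolding m0_def by auto
  define m where "m = smult (inverse (lead_coeff m0)) m0"
  have m: "lead_coeff m = 1" "coeffs_in K m" "poly m b = 0" "degree m = degree m0" "m \<noteq> 0"
    using Q0 by (auto simp: m_def Q_def coeffs_in_def csf_mult[OF K] csf_inverse[OF K])
  have dvd: "m dvd p" if p: "coeffs_in K p" "poly p b = 0" for p
  proof -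
    have "poly (p mod m) b = 0"
    proof -
      have "poly (p div m * m + p mod m) b = 0" using p(2) by simp
      hence "poly (p div m) b * poly m b + poly (p mod m) b = 0" by (simp only: poly_add poly_mult)
      thus ?thesis using m(3) by simp
    qed
    moreover have "coeffs_in K (p mod m)" using coeffs_in_mod[OF K p(1) m(2,1)] .
    moreover have "p mod m = 0 \<or> degree (p mod m) < degree m" using m(5) by (rule degree_mod_less)
    ultimately have "p mod m = 0" using min[of "p mod m"] m(4) unfolding Q_def by linarith
    thus ?thesis by auto
  qed
  have only: "w = b" if w: "poly m w = 0" for w
  proof (rule ccontr)
    assume "w \<noteq> b"
    have "poly P1 w = 0" "poly P2 w = 0" using dvd[OF cP1 root(1)] dvd[OF cP2 root(2)] w by (auto elim!: dvdE)
    hence "w \<in> roots_of g" "\<theta> - of_rat c * w \<in> roots_of f"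
      by (simp_all add: P1_def P2_def poly_pcompose rat_eval_def roots_of_iff algebra_simps)
    moreover have "of_rat c = (\<theta> - of_rat c * w - a) / (b - w)"
      using \<open>w \<noteq> b\<close> by (simp add: \<theta>_def field_simps)
    ultimately have "of_rat c \<in> B" unfolding B_def by (intro image_eqI[of _ _ "(\<theta> - of_rat c * w, w)"]) auto
    thus False using c by blast
  qed
  obtain m' where m': "m = [:- b, 1:] * m'" using m(3) by (auto simp: poly_eq_0_iff_dvd elim!: dvdE)
  have "constant (poly m')"
  proof (rule ccontr)
    assume "\<not> ?thesis"
    then obtain w where w: "poly m' w = 0" using fundamental_theorem_of_algebra by blast
    hence "w = b" using only m' by simp
    then obtain m'' where "m' = [:- b, 1:] * m''" using w by (auto simp: poly_eq_0_iff_dvd elim!: dvdE)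
    hence "m = [:- b, 1:] ^ 2 * m''" using m' by (simp only: power2_eq_square mult.assoc)
    hence "[:- b, 1:] ^ 2 dvd P1" using dvd[OF cP1 root(1)] by (meson dvd_trans dvd_triv_left)
    hence "2 \<le> Polynomial.order b P1" using sqf by (intro order_max) (auto simp: rsquarefree_def)
    thus False using sqf by (auto simp: rsquarefree_def dest!: spec[of _ b])
  qed
  hence "degree m' = 0" by (simp add: constant_degree)
  moreover have "lead_coeff m' = 1" using m(1) by (simp add: m' lead_coeff_mult del: mult_pCons_left)
  ultimately have "m' = 1" using monic_degree_0 by blast
  hence "coeff m 0 = - b" using m' by simp
  hence "- b \<in> K" using m(2) unfolding coeffs_in_def by metis
  hence "b \<in> K" using csf_minus[OF K] by force
  thus ?thesis using that[of c] by (simp add: K_def \<theta>_def)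
qed

lemma primitive_element:
  assumes "finite A" "\<And>a. a \<in> A \<Longrightarrow> algebraic a"
  obtains \<theta> where "algebraic \<theta>" "generate_field complex_ring A = rat_adjoin \<theta>"
proof -
  have gf: "complex_subfield (generate_field complex_ring A)" for A
    using field.generate_field_is_subfield[OF complex_ring_field, of A] subfield_iff_complex_subfield by simp
  have incl: "A \<subseteq> generate_field complex_ring A" for A by (auto intro: generate_field.incl)
  \<comment> \<open>Equality of the two fields is replaced by two inclusions on the level of
    generators, which survive adding a generator; minimality of the generated field restores the
    equality.\<close>
  have "\<exists>\<theta>. algebraic \<theta> \<and> \<theta> \<in> generate_field complex_ring A \<and> A \<subseteq> rat_adjoin \<theta>"
    using assms
  proof (induction A)
    case empty
    show ?case by (rule exI[of _ 1]) (auto intro: csf_1[OF gf] csf_1[OF complex_subfield_algebraic, simplified])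
  next
    case (insert b A)
    then obtain a where a: "algebraic a" "a \<in> generate_field complex_ring A" "A \<subseteq> rat_adjoin a" by auto
    obtain c where c: "b \<in> rat_adjoin (a + of_rat c * b)" using rat_adjoin_pair[OF a(1), of b] insert.prems by blast
    define \<theta> where "\<theta> = a + of_rat c * b"
    have "algebraic \<theta>"
      using csf_add[OF complex_subfield_algebraic] csf_mult[OF complex_subfield_algebraic]
        csf_of_rat[OF complex_subfield_algebraic, of c] a insert.prems by (auto simp: \<theta>_def)
    then obtain h where h: "is_minpoly h \<theta>" by (rule exists_minpoly)
    have K: "complex_subfield (rat_adjoin \<theta>)" by (rule complex_subfield_rat_adjoin[OF h])
    have b: "b \<in> rat_adjoin \<theta>" using c by (simp add: \<theta>_def)
    have "\<theta> - of_rat c * b \<in> rat_adjoin \<theta>"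
      by (intro csf_diff[OF K] csf_mult[OF K] csf_of_rat[OF K] b in_rat_adjoin_self)
    hence "a \<in> rat_adjoin \<theta>" by (simp add: \<theta>_def)
    hence "rat_adjoin a \<subseteq> rat_adjoin \<theta>" by (rule csf_rat_adjoin[OF K])
    hence "insert b A \<subseteq> rat_adjoin \<theta>" using a(3) b by blast
    moreover have "\<theta> \<in> generate_field complex_ring (insert b A)"
      unfolding \<theta>_def
    proof (intro csf_add[OF gf] csf_mult[OF gf] csf_of_rat[OF gf])
      show "a \<in> generate_field complex_ring (insert b A)"
        using a(2) field.mono_generate_field[OF complex_ring_field, of A "insert b A"] by auto
      show "b \<in> generate_field complex_ring (insert b A)" using incl by blast
    qed
    ultimately show ?case using \<open>algebraic \<theta>\<close> by blast
  qed
  then obtain \<theta> where \<theta>: "algebraic \<theta>" "\<theta> \<in> generate_field complex_ring A" "A \<subseteq> rat_adjoin \<theta>" by blast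
  obtain h where h: "is_minpoly h \<theta>" using \<theta>(1) by (rule exists_minpoly)
  have "generate_field complex_ring A \<subseteq> rat_adjoin \<theta>"
    using field.generate_field_min_subfield1[OF complex_ring_field, of A "rat_adjoin \<theta>"] \<theta>(3)
      complex_subfield_rat_adjoin[OF h] subfield_iff_complex_subfield by simp
  moreover have "rat_adjoin \<theta> \<subseteq> generate_field complex_ring A" by (rule csf_rat_adjoin[OF gf \<theta>(2)])
  ultimately show ?thesis using that[OF \<theta>(1)] by blast
qed

section \<open>Dimensions and degrees of simple extensions\<close>

lemma (in ring) dim_eqI:
  assumes K: "subfield K R" and Us: "set Us \<subseteq> carrier R"
    and ind: "\<And>Ks. length Ks = length Us \<Longrightarrow> set Ks \<subseteq> K \<Longrightarrow> combine Ks Us = \<zero> \<Longrightarrow> set Ks \<subseteq> {\<zero>}"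
    and E: "E = {combine Ks Us | Ks. length Ks = length Us \<and> set Ks \<subseteq> K}"
  shows "dim K E = length Us"
proof -
  \<comment> \<open>\<open>combine\<close> ignores the surplus of the longer list, so a vanishing
    combination can be cut or padded with zeros to the length of \<open>Us\<close>, where the
    hypothesis applies.\<close>
  have "independent K Us"
  proof (rule trivial_combine_imp_independent[OF K Us])
    fix Ks assume Ks: "set Ks \<subseteq> K" "combine Ks Us = \<zero>"
    have "K \<subseteq> carrier R" using subringE(1)[OF subfieldE(1)[OF K]] .
    hence "set Ks \<subseteq> carrier R" using Ks(1) by blast
    then obtain Ks' where Ks': "set (take (length Us) Ks) \<subseteq> set Ks'"
      "set Ks' \<subseteq> set (take (length Us) Ks) \<union> {\<zero>}" "length Ks' = length Us" "combine Ks' Us = \<zero>"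
      using combine_normalize[OF _ Us Ks(2)] by blast
    have "\<zero> \<in> K" using subringE(2)[OF subfieldE(1)[OF K]] .
    hence "set Ks' \<subseteq> K" using Ks'(2) Ks(1) set_take_subset[of "length Us" Ks] by blast
    thus "set (take (length Us) Ks) \<subseteq> {\<zero>}" using ind[OF Ks'(3) _ Ks'(4)] Ks'(1) by blast
  qed
  moreover have "Span K Us = E" unfolding E using Span_eq_combine_set_length_version[OF K Us] by blast
  ultimately have "dimension (length Us) K E" using dimension_independent by blast
  thus ?thesis unfolding dim_def using dimension_is_inj[OF K] by blast
qed

lemma complex_ring_combine:
  "length Ks = length Us \<Longrightarrow> ring.combine complex_ring Ks Us = (\<Sum>i<length Us. Ks ! i * Us ! i)"
proof (induction Ks Us rule: list_induct2)
  case Nil thus ?case by (simp add: ring.combine.simps[OF complex_ring_ring])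
next
  case (Cons k Ks u Us)
  thus ?case by (simp add: ring.combine.simps[OF complex_ring_ring] sum.lessThan_Suc_shift del: sum.lessThan_Suc)
qed

text \<open>The powers of \<theta> below the degree of f are a basis: remainders modulo f show that
  they span, and a relation between them would be a multiple of f of smaller degree.\<close>

lemma field_degree_rat_adjoin:
  assumes f: "is_minpoly f \<theta>" shows "field_degree (rat_adjoin \<theta>) = degree f"
proof -
  define n where "n = degree f"
  define Us where "Us = map (\<lambda>i. \<theta> ^ i) [0..<n]"
  have len: "length Us = n" by (simp add: Us_def)
  have comb: "ring.combine complex_ring Ks Us = (\<Sum>i<n. Ks ! i * \<theta> ^ i)" if "length Ks = n" for Ks
    using complex_ring_combine[of Ks Us] that by (simp add: Us_def)
  have lists: "\<exists>q. degree q < n \<and> (\<forall>i<n. Ks ! i = of_rat (coeff q i)) \<and> ring.combine complex_ring Ks Us = rat_eval q \<theta>"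
    if Ks: "length Ks = n" "set Ks \<subseteq> \<rat>" for Ks
  proof -
    have "\<forall>i<n. \<exists>r. Ks ! i = of_rat r" using Ks nth_mem[of _ Ks] by (auto elim!: Rats_cases simp del: nth_mem)
    then obtain r where r: "\<And>i. i < n \<Longrightarrow> Ks ! i = of_rat (r i)" by metis
    define q where "q = (\<Sum>i<n. monom (r i) i)"
    have cq: "coeff q i = (if i < n then r i else 0)" for i by (auto simp: q_def coeff_sum)
    have n: "n > 0" using is_minpoly_degree_pos[OF f] by (simp add: n_def)
    have "degree q < n" using cq n by (metis degree_0 leading_coeff_0_iff)
    thus ?thesis using r cq comb[OF Ks(1)] by (intro exI[of _ q]) (auto simp: rat_eval_altdef)
  qed
  have "ring.dim complex_ring \<rat> (rat_adjoin \<theta>) = length Us"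
  proof (rule ring.dim_eqI[OF complex_ring_ring])
    show "subfield \<rat> complex_ring" using complex_subfield_Rats subfield_iff_complex_subfield by blast
    show "set Us \<subseteq> carrier complex_ring" by simp
  next
    fix Ks assume Ks: "length Ks = length Us" "set Ks \<subseteq> (\<rat> :: complex set)" "ring.combine complex_ring Ks Us = \<zero>\<^bsub>complex_ring\<^esub>"
    then obtain q where q: "degree q < n" "\<forall>i<n. Ks ! i = of_rat (coeff q i)" "rat_eval q \<theta> = 0"
      using lists[of Ks] len by auto
    hence "f dvd q" using is_minpoly_iff[OF f] by blast
    hence "q = 0" using q(1) dvd_imp_degree_le[of f q] by (auto simp: n_def)
    thus "set Ks \<subseteq> {\<zero>\<^bsub>complex_ring\<^esub>}" using q(2) Ks(1) len by (auto simp: in_set_conv_nth)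
  next
    show "rat_adjoin \<theta> = {ring.combine complex_ring Ks Us |Ks. length Ks = length Us \<and> set Ks \<subseteq> \<rat>}"
    proof safe
      fix a assume "a \<in> rat_adjoin \<theta>"
      then obtain p where p: "a = rat_eval p \<theta>" by (auto simp: rat_adjoin_iff)
      define q where "q = p mod f"
      have "degree q < n" using degree_mod_less[OF is_minpoly_nonzero[OF f], of p] is_minpoly_degree_pos[OF f]
        unfolding q_def n_def by fastforce
      moreover have "a = rat_eval q \<theta>" using p is_minpoly_root[OF f] by (simp add: q_def minus_mult_div_eq_mod[symmetric])
      ultimately have "a = (\<Sum>i<n. of_rat (coeff q i) * \<theta> ^ i)" by (simp add: rat_eval_altdef)
      thus "\<exists>Ks. a = ring.combine complex_ring Ks Us \<and> length Ks = length Us \<and> set Ks \<subseteq> \<rat>"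
        by (intro exI[of _ "map (\<lambda>i. of_rat (coeff q i)) [0..<n]"]) (auto simp: comb len)
    next
      fix Ks assume "length Ks = length Us" "set Ks \<subseteq> (\<rat> :: complex set)"
      thus "ring.combine complex_ring Ks Us \<in> rat_adjoin \<theta>" using lists[of Ks] len by (auto simp: rat_adjoin_iff)
    qed
  qed
  thus ?thesis by (simp add: field_degree_def len n_def)
qed

section \<open>Extending the p-adic absolute value to the algebraic numbers\<close>

definition complex_subring :: "complex set \<Rightarrow> bool" where
  "complex_subring V \<longleftrightarrow> 1 \<in> V \<and> (\<forall>x\<in>V. \<forall>y\<in>V. x - y \<in> V \<and> x * y \<in> V)"

context
  fixes V assumes V: "complex_subring V"
begin

lemma csr_1: "1 \<in> V" and csr_diff: "x \<in> V \<Longrightarrow> y \<in> V \<Longrightarrow> x - y \<in> V"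
  and csr_mult: "x \<in> V \<Longrightarrow> y \<in> V \<Longrightarrow> x * y \<in> V"
  using V by (auto simp: complex_subring_def)
lemma csr_0: "0 \<in> V" using csr_diff[OF csr_1 csr_1] by simp
lemma csr_minus: "x \<in> V \<Longrightarrow> - x \<in> V" using csr_diff[OF csr_0, of x] by simp
lemma csr_add: "x \<in> V \<Longrightarrow> y \<in> V \<Longrightarrow> x + y \<in> V" using csr_diff[of x "- y"] csr_minus by simp
lemma csr_power: "x \<in> V \<Longrightarrow> x ^ n \<in> V" by (induction n) (auto simp: csr_1 csr_mult)
lemma csr_sum: "(\<And>i. i \<in> A \<Longrightarrow> g i \<in> V) \<Longrightarrow> sum g A \<in> V"
  by (induction A rule: infinite_finite_induct) (auto simp: csr_0 csr_add)
lemma csr_of_nat: "of_nat n \<in> V" by (induction n) (auto simp: csr_0 csr_1 csr_add)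
lemma csr_of_int: "of_int n \<in> V" by (cases n rule: int_cases2) (auto simp: csr_of_nat csr_minus)

lemma coeffs_in_add: "coeffs_in V q \<Longrightarrow> coeffs_in V r \<Longrightarrow> coeffs_in V (q + r)"
  and coeffs_in_diff: "coeffs_in V q \<Longrightarrow> coeffs_in V r \<Longrightarrow> coeffs_in V (q - r)"
  and coeffs_in_mult: "coeffs_in V q \<Longrightarrow> coeffs_in V r \<Longrightarrow> coeffs_in V (q * r)"
  and coeffs_in_monom: "a \<in> V \<Longrightarrow> coeffs_in V (monom a n)"
  and coeffs_in_sum: "(\<And>i. i \<in> A \<Longrightarrow> coeffs_in V (g i)) \<Longrightarrow> coeffs_in V (sum g A)"
  by (auto simp: coeffs_in_def coeff_mult coeff_sum csr_0 intro!: csr_add csr_diff csr_sum csr_mult)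

lemma poly_in_subring: "coeffs_in V q \<Longrightarrow> x \<in> V \<Longrightarrow> poly q x \<in> V"
  unfolding poly_altdef coeffs_in_def by (auto intro!: csr_sum csr_mult csr_power)

end

lemma complex_subring_adjoin:
  assumes V: "complex_subring V" shows "complex_subring {poly q x | q. coeffs_in V q}"
  unfolding complex_subring_def
proof (intro conjI ballI)
  show "1 \<in> {poly q x |q. coeffs_in V q}"
    using coeffs_in_monom[OF V csr_1[OF V], of 0] by (auto intro!: exI[of _ 1])
  fix y z assume "y \<in> {poly q x |q. coeffs_in V q}" "z \<in> {poly q x |q. coeffs_in V q}"
  then obtain q r where "y = poly q x" "coeffs_in V q" "z = poly r x" "coeffs_in V r" by auto
  thus "y - z \<in> {poly q x |q. coeffs_in V q}" "y * z \<in> {poly q x |q. coeffs_in V q}"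
    using coeffs_in_diff[OF V, of q r] coeffs_in_mult[OF V, of q r]
    by (auto intro: exI[of _ "q - r"] exI[of _ "q * r"])
qed

abbreviation algebraic_numbers :: "complex set" where "algebraic_numbers \<equiv> {z. algebraic z}"

lemma complex_subring_algebraic: "complex_subring algebraic_numbers"
  using complex_subfield_algebraic by (auto simp: complex_subfield_def complex_subring_def)

lemma algebraic_int_multiple:
  fixes a :: complex
  assumes a: "algebraic a" obtains c :: int where "c \<noteq> 0" "algebraic_int (of_int c * a)"
proof -
  obtain q where q: "\<And>i. coeff q i \<in> \<int>" "q \<noteq> 0" "poly q a = 0"
    using a by (auto simp: algebraic_def)
  obtain c where c: "lead_coeff q = of_int c" using q(1) by (auto elim!: Ints_cases)
  have "c \<noteq> 0" using c q(2) by auto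
  define n where "n = degree q"
  have "n > 0" using q by (auto simp: n_def intro!: Nat.gr0I elim!: degree_eq_zeroE)
  have "algebraic_int (of_int c * a)"
  proof -
    \<comment> \<open>This is c^(n-1) q(X / c): its leading coefficient is 1, because c is that of
      q, and the powers of c clear the other denominators.\<close>
    define r where "r = (\<Sum>i<n. monom (coeff q i * of_int c ^ (n - 1 - i)) i) + monom 1 n"
    have cr: "coeff r i = (if i < n then coeff q i * of_int c ^ (n - 1 - i) else if i = n then 1 else 0)" for i
      by (auto simp: r_def coeff_sum)
    have "degree r = n"
      by (rule antisym) (auto intro!: degree_le le_degree simp: cr)
    moreover have "poly r (of_int c * a) = 0"
    proof -
      have "0 = of_int c ^ (n - 1) * (\<Sum>i\<le>n. coeff q i * a ^ i)" using q(3) by (simp add: poly_altdef n_def)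
      also have "\<dots> = of_int c ^ (n - 1) * (of_int c * a ^ n) + (\<Sum>i<n. of_int c ^ (n - 1) * (coeff q i * a ^ i))"
        using c by (simp add: lessThan_Suc_atMost[symmetric] n_def algebra_simps sum_distrib_left)
      also have "of_int c ^ (n - 1) * (of_int c * a ^ n) = (of_int c * a) ^ n"
        using \<open>n > 0\<close> by (cases n) (auto simp: power_mult_distrib)
      also have "(\<Sum>i<n. of_int c ^ (n - 1) * (coeff q i * a ^ i)) =
          (\<Sum>i<n. coeff q i * of_int c ^ (n - 1 - i) * (of_int c * a) ^ i)"
      proof (intro sum.cong refl)
        fix i assume "i \<in> {..<n}"
        hence "(of_int c :: complex) ^ (n - 1) = of_int c ^ (n - 1 - i) * of_int c ^ i"
          by (simp add: power_add[symmetric])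
        thus "of_int c ^ (n - 1) * (coeff q i * a ^ i) = coeff q i * of_int c ^ (n - 1 - i) * (of_int c * a) ^ i"
          by (simp add: power_mult_distrib)
      qed
      finally show ?thesis by (simp add: r_def poly_sum poly_monom add.commute)
    qed
    moreover have "coeff r i \<in> \<int>" for i using q(1) by (auto simp: cr)
    ultimately show ?thesis by (intro algebraic_int.intros[of r]) (auto simp: cr)
  qed
  thus ?thesis using that[OF \<open>c \<noteq> 0\<close>] by blast
qed

text \<open>By Zorn's lemma such a subring exists, and by Chevalley's argument it is a valuation ring.\<close>

locale maximal_subring =
  fixes p :: nat and V :: "complex set"
  assumes p: "Factorial_Ring.prime p" and V: "complex_subring V" "V \<subseteq> algebraic_numbers"
    and p_notin: "inverse (of_nat p) \<notin> V"
    and maximal: "\<And>W. complex_subring W \<Longrightarrow> W \<subseteq> algebraic_numbers \<Longrightarrow> inverse (of_nat p) \<notin> W \<Longrightarrow> V \<subseteq> W \<Longrightarrow> W = V"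
begin

abbreviation P :: complex where "P \<equiv> of_nat p"

lemma P_nz [simp]: "P \<noteq> 0" and p_gt_1: "p > 1"
  using p prime_gt_0_nat[of p] prime_gt_1_nat[of p] by auto

lemma p_nz [simp]: "p \<noteq> 0" using p_gt_1 by simp

lemma P_in_V: "P \<in> V" by (rule csr_of_nat[OF V(1)])

text \<open>Adjoining x to \<open>V\<close> gives a strictly larger subring, which contains
  \<open>inverse P\<close> by maximality. Such relations are the raw material of Chevalley's
  argument.\<close>

lemma inverse_p_in_adjoin:
  assumes "algebraic x" "x \<notin> V"
  obtains q where "coeffs_in V q" "P * poly q x = 1"
proof -
  define W where "W = {poly q x |q. coeffs_in V q}"
  have W: "complex_subring W" unfolding W_def by (rule complex_subring_adjoin[OF V(1)])
  have "x \<in> W" unfolding W_def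
    using coeffs_in_monom[OF V(1) csr_1[OF V(1)], of 1] by (auto intro!: exI[of _ "monom 1 1"] simp: poly_monom)
  moreover have "V \<subseteq> W" unfolding W_def using coeffs_in_monom[OF V(1), of _ 0]
    by (auto intro!: exI[of _ "monom _ 0"] simp: poly_monom)
  moreover have "W \<subseteq> algebraic_numbers"
    unfolding W_def using V(2) assms(1) poly_in_subring[OF complex_subring_algebraic, of _ x]
    by (auto simp: coeffs_in_def)
  ultimately have "inverse P \<in> W" using maximal[OF W] assms(2) by blast
  then obtain q where "coeffs_in V q" "inverse P = poly q x" unfolding W_def by auto
  thus ?thesis using that by (metis P_nz right_inverse)
qed

text \<open>Puts the multiples of \<open>P\<close> into the Jacobson radical of \<open>V\<close>. If
  t = 1 - P b had no inverse in V, a relation P r(1/t) = 1 times t^k would show that t^k / P is in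
  V; but t^k is 1 modulo P V, so 1/P would be in V.\<close>

lemma inverse_one_minus:
  assumes b: "b \<in> V" shows "inverse (1 - P * b) \<in> V"
proof (rule ccontr)
  define t where "t = 1 - P * b"
  have t: "t \<in> V" unfolding t_def by (intro csr_diff[OF V(1)] csr_mult[OF V(1)] csr_1[OF V(1)] P_in_V b)
  have "t \<noteq> 0"
  proof
    assume "t = 0"
    hence "inverse P = b" by (simp add: t_def field_simps)
    thus False using b p_notin by simp
  qed
  assume "inverse (1 - P * b) \<notin> V"
  moreover have "algebraic (inverse t)" using V(2) t by auto
  ultimately obtain r where r: "coeffs_in V r" "P * poly r (inverse t) = 1"
    using inverse_p_in_adjoin unfolding t_def by blast
  define k where "k = degree r"
  have "t ^ k * poly r (inverse t) = (\<Sum>i\<le>k. coeff r i * t ^ (k - i))"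
    unfolding poly_altdef sum_distrib_left k_def
    by (intro sum.cong) (use \<open>t \<noteq> 0\<close> in \<open>auto simp: power_diff field_simps\<close>)
  also have "\<dots> \<in> V" using r(1) t unfolding coeffs_in_def by (intro csr_sum[OF V(1)] csr_mult[OF V(1)] csr_power[OF V(1)]) auto
  finally have 1: "t ^ k * poly r (inverse t) \<in> V" .
  have "\<exists>c\<in>V. t ^ k = 1 - P * c" for k
  proof (induction k)
    case 0 show ?case by (rule bexI[of _ 0]) (auto simp: csr_0[OF V(1)])
  next
    case (Suc k)
    then obtain c where c: "c \<in> V" "t ^ k = 1 - P * c" by blast
    have "t ^ Suc k = 1 - P * (b + c - P * b * c)" unfolding power_Suc c(2) by (simp add: t_def algebra_simps)
    moreover have "b + c - P * b * c \<in> V"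
      by (intro csr_diff[OF V(1)] csr_add[OF V(1)] csr_mult[OF V(1)] b c P_in_V)
    ultimately show ?case by blast
  qed
  then obtain c where c: "c \<in> V" "t ^ k = 1 - P * c" by blast
  have "poly r (inverse t) = inverse P" using r(2) by (simp add: field_simps)
  hence "t ^ k * poly r (inverse t) = inverse P - c" by (simp add: c(2) field_simps)
  hence "inverse P - c + c \<in> V" using 1 c(1) csr_add[OF V(1)] by metis
  thus False using p_notin by simp
qed

text \<open>In the relation for y the constant term can be absorbed, as 1 - P b_0 is a unit of V.
  Multiplied by x^m, with m the degree of \<open>q2\<close>, the rest expresses x^m by lower powers
  of x, and this removes the leading term of \<open>q1\<close>.\<close>

lemma reduce_degree:
  assumes xy: "x * y = 1" and q1: "coeffs_in V q1" "P * poly q1 x = 1" and q2: "coeffs_in V q2" "P * poly q2 y = 1"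
    and deg: "degree q2 \<le> degree q1"
  shows "\<exists>q. coeffs_in V q \<and> P * poly q x = 1 \<and> degree q < degree q1"
proof -
  define m n where "m = degree q2" and "n = degree q1"
  define b where "b = coeff q2"
  have b: "b j \<in> V" for j using q2(1) by (simp add: coeffs_in_def b_def)
  have m: "m > 0"
  proof (rule ccontr)
    assume "\<not> m > 0"
    hence "poly q2 y = b 0" by (simp add: poly_altdef m_def b_def)
    hence "b 0 = inverse P" using q2(2) by (simp add: field_simps)
    thus False using b[of 0] p_notin by simp
  qed
  define w where "w = inverse (1 - P * b 0)"
  have w: "w \<in> V" unfolding w_def by (rule inverse_one_minus[OF b])
  have wnz: "1 - P * b 0 \<noteq> 0"
  proof
    assume "1 - P * b 0 = 0"
    hence "b 0 = inverse P" by (simp add: field_simps)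
    thus False using b[of 0] p_notin by simp
  qed
  \<comment> \<open>Multiplication by x^m turns y^j into x^(m - j). As j starts at 1, the degree is
    at most m - 1, while the value at x is x^m.\<close>
  define g where "g = (\<Sum>j\<in>{1..m}. monom (w * P * b j) (m - j))"
  have g: "coeffs_in V g" unfolding g_def
    by (intro coeffs_in_sum[OF V(1)] coeffs_in_monom[OF V(1)] csr_mult[OF V(1)] w b P_in_V)
  have "degree g \<le> m - 1" unfolding g_def
    by (intro degree_sum_le) (auto intro: order_trans[OF degree_monom_le])
  have gx: "poly g x = x ^ m"
  proof -
    have "1 = P * (\<Sum>j\<le>m. b j * y ^ j)" using q2(2) by (simp add: poly_altdef m_def b_def)
    also have "{..m} = insert 0 {1..m}" by auto
    finally have "1 - P * b 0 = P * (\<Sum>j\<in>{1..m}. b j * y ^ j)" by (simp add: algebra_simps)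
    hence "1 = w * P * (\<Sum>j\<in>{1..m}. b j * y ^ j)" using wnz by (simp add: w_def field_simps)
    hence "x ^ m = x ^ m * (w * P * (\<Sum>j\<in>{1..m}. b j * y ^ j))" by simp
    also have "\<dots> = (\<Sum>j\<in>{1..m}. w * P * b j * (x ^ m * y ^ j))"
      by (simp add: sum_distrib_left mult_ac)
    also have "\<dots> = (\<Sum>j\<in>{1..m}. w * P * b j * x ^ (m - j))"
    proof (intro sum.cong refl)
      fix j assume "j \<in> {1..m}"
      hence "x ^ m * y ^ j = x ^ (m - j) * (x * y) ^ j"
        by (simp add: power_mult_distrib power_add[symmetric] mult.assoc[symmetric])
      thus "w * P * b j * (x ^ m * y ^ j) = w * P * b j * x ^ (m - j)" using xy by simp
    qed
    finally show ?thesis by (simp add: g_def poly_sum poly_monom)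
  qed
  define c where "c = coeff q1 n"
  have c: "c \<in> V" using q1(1) by (simp add: c_def coeffs_in_def)
  define q where "q = q1 - monom c n + monom c (n - m) * g"
  have "coeffs_in V q" unfolding q_def
    by (intro coeffs_in_add[OF V(1)] coeffs_in_diff[OF V(1)] coeffs_in_mult[OF V(1)] coeffs_in_monom[OF V(1)] c g q1)
  moreover have "poly q x = poly q1 x"
    using deg by (simp add: q_def gx poly_monom m_def n_def mult.assoc power_add[symmetric])
  moreover have "degree q < n"
  proof -
    have "degree (monom c (n - m) * g) \<le> (n - m) + (m - 1)"
      using \<open>degree g \<le> m - 1\<close> by (intro order_trans[OF degree_mult_le] add_mono degree_monom_le)
    also have "\<dots> < n" using m deg by (simp add: m_def n_def)
    finally have 1: "degree (monom c (n - m) * g) < n" .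
    have "degree (q1 - monom c n) \<le> n" by (intro degree_diff_le) (auto simp: n_def degree_monom_le)
    moreover have "coeff (q1 - monom c n) n = 0" by (simp add: c_def)
    moreover have "n > 0" using m deg by (simp add: m_def n_def)
    ultimately have "degree (q1 - monom c n) < n"
      by (metis degree_0 leading_coeff_0_iff le_neq_implies_less)
    thus ?thesis using 1 unfolding q_def by (rule degree_add_less)
  qed
  ultimately show ?thesis using q1(2) n_def by auto
qed

text \<open>If both failed, take relations of least degree for x and for its inverse;
  \<open>reduce_degree\<close> shortens the one of larger degree.\<close>

lemma valuation_ring:
  assumes x: "algebraic x" "x \<noteq> 0" shows "x \<in> V \<or> inverse x \<in> V"
proof (rule ccontr)
  assume no: "\<not> ?thesis"
  define Q where "Q = (\<lambda>x q. coeffs_in V q \<and> P * poly q x = 1)"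
  have alg: "algebraic (inverse x)" using x by auto
  have ex: "\<exists>q. Q x q" "\<exists>q. Q (inverse x) q"
    using inverse_p_in_adjoin[of x] inverse_p_in_adjoin[of "inverse x"] x alg no unfolding Q_def by metis+
  define q1 q2 where "q1 = arg_min degree (Q x)" and "q2 = arg_min degree (Q (inverse x))"
  have 1: "Q x q1" "\<And>q. Q x q \<Longrightarrow> degree q1 \<le> degree q"
    using ex(1) arg_min_natI[of "Q x" _ degree] arg_min_nat_le[of "Q x" _ degree] unfolding q1_def by auto
  have 2: "Q (inverse x) q2" "\<And>q. Q (inverse x) q \<Longrightarrow> degree q2 \<le> degree q"
    using ex(2) arg_min_natI[of "Q (inverse x)" _ degree] arg_min_nat_le[of "Q (inverse x)" _ degree]
    unfolding q2_def by auto
  show False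
  proof (cases "degree q2 \<le> degree q1")
    case True
    thus False using reduce_degree[of x "inverse x" q1 q2] 1 2 x(2) unfolding Q_def by (metis leD right_inverse)
  next
    case False
    hence "degree q1 \<le> degree q2" by simp
    thus False using reduce_degree[of "inverse x" x q2 q1] 1 2 x(2) unfolding Q_def by (metis leD left_inverse)
  qed
qed

text \<open>By Bezout a multiple of n has the form 1 - P b, which is a unit by
  \<open>inverse_one_minus\<close>.\<close>

lemma inverse_coprime_in_V:
  assumes n: "\<not> int p dvd n" shows "inverse (of_int n) \<in> V"
proof -
  have "coprime n (int p)" using n p by (metis coprime_commute prime_imp_coprime prime_nat_int_transfer)
  then obtain a b where ab: "a * n + b * int p = 1"
    by (metis bezout_int coprime_iff_gcd_eq_1)
  have "(of_int (a * n + b * int p) :: complex) = 1" unfolding ab by simp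
  hence e: "of_int a * of_int n = 1 - P * (of_int b :: complex)" by (simp add: algebra_simps)
  have "inverse (1 - P * of_int b) \<in> V" by (rule inverse_one_minus[OF csr_of_int[OF V(1)]])
  hence "of_int a * inverse (of_int a * of_int n) \<in> V" unfolding e by (intro csr_mult[OF V(1)] csr_of_int[OF V(1)])
  moreover have "a \<noteq> 0"
  proof
    assume "a = 0"
    hence "int p dvd 1" using ab by (metis add_0 dvd_triv_right mult_zero_left)
    thus False using p_gt_1 by simp
  qed
  ultimately show ?thesis by (cases "n = 0") (auto simp: field_simps)
qed

text \<open>If it is 1/y that lies in V, dividing the monic equation by y^(n-1) writes y as a
  polynomial in 1/y with integer coefficients.\<close>

lemma algebraic_int_in_V:
  assumes "algebraic_int y" shows "y \<in> V"
proof (cases "y = 0")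
  case False
  from assms obtain q where q: "lead_coeff q = 1" "\<And>i. coeff q i \<in> \<int>" "poly q y = 0"
    by (auto elim!: algebraic_int.cases)
  have "inverse y \<in> V \<Longrightarrow> y \<in> V"
  proof -
    assume iy: "inverse y \<in> V"
    define n where "n = degree q"
    have "n > 0" using q(1,3) monic_degree_0[of q] by (cases "n = 0") (auto simp: n_def)
    have "0 = (\<Sum>i\<le>n. coeff q i * y ^ i)" using q(3) by (simp add: poly_altdef n_def)
    also have "\<dots> = y ^ n + (\<Sum>i<n. coeff q i * y ^ i)"
      using q(1) by (simp add: lessThan_Suc_atMost[symmetric] n_def)
    finally have "y ^ n = - (\<Sum>i<n. coeff q i * y ^ i)" by (simp add: add_eq_0_iff2)
    hence "inverse y ^ (n - 1) * y ^ n = - (\<Sum>i<n. coeff q i * (inverse y ^ (n - 1) * y ^ i))"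
      by (simp add: sum_distrib_left mult_ac)
    also have "inverse y ^ (n - 1) * y ^ n = y" using \<open>n > 0\<close> False
      by (cases n) (auto simp: field_simps)
    also have "(\<Sum>i<n. coeff q i * (inverse y ^ (n - 1) * y ^ i)) = (\<Sum>i<n. coeff q i * inverse y ^ (n - 1 - i))"
      by (intro sum.cong refl) (use False in \<open>auto simp: power_diff field_simps\<close>)
    also have "- \<dots> \<in> V"
      using q(2) iy csr_of_int[OF V(1)]
      by (intro csr_minus[OF V(1)] csr_sum[OF V(1)] csr_mult[OF V(1)] csr_power[OF V(1)]) (metis Ints_cases)+
    finally show "y \<in> V" .
  qed
  thus ?thesis using valuation_ring[of y] False assms by (auto simp: algebraic_int_imp_algebraic)
qed (simp add: csr_0[OF V(1)])

text \<open>Cofinality of the powers of \<open>P\<close>: an integer clears the denominator of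
  \<open>a\<close>, and the part of this integer prime to p is a unit of V.\<close>

lemma p_power_mult_in_V:
  assumes a: "algebraic a" obtains k :: nat where "P ^ k * a \<in> V"
proof -
  obtain c where "c \<noteq> 0" and "algebraic_int (of_int c * a)" by (rule algebraic_int_multiple[OF a])
  hence ca: "of_int c * a \<in> V" by (intro algebraic_int_in_V)
  obtain k c' where kc: "c = int p ^ k * c'" "\<not> int p dvd c'"
    using multiplicity_decompose'[of c "int p"] \<open>c \<noteq> 0\<close> p by (metis not_prime_unit prime_nat_int_transfer)
  have "inverse (of_int c') * (of_int c * a) \<in> V"
    by (rule csr_mult[OF V(1) inverse_coprime_in_V[OF kc(2)] ca])
  moreover have "c' \<noteq> 0" using kc(2) by auto
  ultimately have "P ^ k * a \<in> V" using kc(1) by (simp add: field_simps)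
  thus ?thesis by (rule that)
qed

end

lemma exists_maximal_subring:
  assumes "Factorial_Ring.prime p" obtains V where "maximal_subring p V"
proof -
  define AA where "AA = {V. complex_subring V \<and> V \<subseteq> algebraic_numbers \<and> inverse (of_nat p) \<notin> V}"
  have "\<exists>M\<in>AA. \<forall>Y\<in>AA. M \<subseteq> Y \<longrightarrow> Y = M"
  proof (rule subset_Zorn_nonempty)
    have "inverse (of_nat p :: complex) \<notin> \<int>"
    proof
      assume "inverse (of_nat p :: complex) \<in> \<int>"
      then obtain n :: int where "inverse (of_nat p :: complex) = of_int n" by (auto elim!: Ints_cases)
      hence "of_int (n * int p) = (1 :: complex)" using assms prime_gt_0_nat[of p] by (auto simp: field_simps)
      hence "n * int p = 1" by (simp only: of_int_eq_1_iff)
      thus False using assms prime_gt_1_nat[of p] by (auto simp: zmult_eq_1_iff)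
    qed
    hence "\<int> \<in> AA" by (auto simp: AA_def complex_subring_def int_imp_algebraic_int algebraic_int_imp_algebraic)
    thus "AA \<noteq> {}" by blast
  next
    fix C assume C: "C \<noteq> {}" "subset.chain AA C"
    have "complex_subring (\<Union>C)"
      unfolding complex_subring_def
    proof (intro conjI ballI)
      show "1 \<in> \<Union>C" using C by (force simp: subset.chain_def AA_def complex_subring_def)
      fix x y assume "x \<in> \<Union>C" "y \<in> \<Union>C"
      then obtain Y Y' where XY: "x \<in> Y" "Y \<in> C" "y \<in> Y'" "Y' \<in> C" by blast
      hence "Y \<subseteq> Y' \<or> Y' \<subseteq> Y" using C by (auto simp: subset_chain_def)
      then obtain Z where Z: "x \<in> Z" "y \<in> Z" "Z \<in> C" using XY by blast
      hence "complex_subring Z" using C by (auto simp: subset_chain_def AA_def)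
      thus "x - y \<in> \<Union>C" "x * y \<in> \<Union>C" using Z by (auto simp: complex_subring_def)
    qed
    thus "\<Union>C \<in> AA" using C by (auto simp: AA_def subset_chain_def)
  qed
  then obtain M where "M \<in> AA" "\<And>Y. Y \<in> AA \<Longrightarrow> M \<subseteq> Y \<Longrightarrow> Y = M" by blast
  hence "maximal_subring p M" using assms by unfold_locales (auto simp: AA_def)
  thus ?thesis by (rule that)
qed

section \<open>The p-adic valuation of a maximal subring\<close>

context maximal_subring
begin

text \<open>No rank-one argument is needed: the supremum of the slopes is the exponent of the absolute value,
  since \<open>P\<close> spans a cofinal subgroup of the value group.\<close>

definition slopes :: "complex \<Rightarrow> real set" where
  "slopes a = {real_of_int k / real m | k m. m > 0 \<and> a ^ m * P powi (- k) \<in> V}"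

lemma P_powi_in_V_iff: "P powi k \<in> V \<longleftrightarrow> k \<ge> 0"
proof
  assume k: "P powi k \<in> V"
  show "k \<ge> 0"
  proof (rule ccontr)
    assume "\<not> k \<ge> 0"
    define j where "j = nat (- 1 - k)"
    have j: "k = - 1 - int j" using \<open>\<not> k \<ge> 0\<close> by (simp add: j_def)
    have "P ^ j * P powi k \<in> V" by (intro csr_mult[OF V(1)] csr_power[OF V(1)] P_in_V k)
    also have "P ^ j * P powi k = inverse P"
      by (simp add: j power_int_diff power_int_minus field_simps)
    finally show False using p_notin by simp
  qed
qed (auto simp: power_int_def intro: csr_power[OF V(1) P_in_V])

lemma slopes_add:
  assumes "s \<in> slopes a" "t \<in> slopes b" shows "s + t \<in> slopes (a * b)"
proof -
  from assms obtain k m l n where *: "s = real_of_int k / real m" "m > 0" "a ^ m * P powi (- k) \<in> V"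
    "t = real_of_int l / real n" "n > 0" "b ^ n * P powi (- l) \<in> V" by (auto simp: slopes_def)
  have "(a ^ m * P powi (- k)) ^ n * (b ^ n * P powi (- l)) ^ m \<in> V"
    by (intro csr_mult[OF V(1)] csr_power[OF V(1)] *)
  also have "(a ^ m * P powi (- k)) ^ n * (b ^ n * P powi (- l)) ^ m =
      (a * b) ^ (m * n) * ((P powi (- k)) ^ n * (P powi (- l)) ^ m)"
    by (simp add: power_mult_distrib power_mult[symmetric] mult_ac)
  also have "(P powi (- k)) ^ n * (P powi (- l)) ^ m = P powi (- (k * int n + l * int m))"
    by (simp add: power_int_mult[symmetric] power_int_add[symmetric] flip: power_int_of_nat)
  finally have "(a * b) ^ (m * n) * P powi (- (k * int n + l * int m)) \<in> V" .
  moreover have "s + t = real_of_int (k * int n + l * int m) / real (m * n)"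
    using * by (simp add: field_simps)
  ultimately show ?thesis using * unfolding slopes_def by (metis (mono_tags, lifting) mem_Collect_eq nat_0_less_mult_iff)
qed

text \<open>One power of \<open>P\<close> carries a into V and gives a slope; another carries 1/a
  into V and bounds all slopes.\<close>

lemma slopes_bounds:
  assumes a: "algebraic a" "a \<noteq> 0" shows "slopes a \<noteq> {}" "bdd_above (slopes a)"
proof -
  obtain k where k: "P ^ k * a \<in> V" using p_power_mult_in_V[OF a(1)] by blast
  hence "real_of_int (- int k) / real 1 \<in> slopes a" unfolding slopes_def
    by (intro CollectI exI[of _ "- int k"] exI[of _ "1 :: nat"]) (simp add: mult.commute)
  thus "slopes a \<noteq> {}" by blast
  have "algebraic (inverse a)" using a by auto
  then obtain l where l: "P ^ l * inverse a \<in> V" using p_power_mult_in_V by blast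
  have "s \<le> real l" if "s \<in> slopes a" for s
  proof -
    from that obtain k m where *: "s = real_of_int k / real m" "m > 0" "a ^ m * P powi (- k) \<in> V" by (auto simp: slopes_def)
    have "(P ^ l * inverse a) ^ m * (a ^ m * P powi (- k)) \<in> V"
      by (intro csr_mult[OF V(1)] csr_power[OF V(1)] * l)
    also have "(P ^ l * inverse a) ^ m * (a ^ m * P powi (- k)) = (P ^ l) ^ m * P powi (- k)"
      using a(2) by (simp add: power_mult_distrib field_simps)
    also have "\<dots> = P powi (int (l * m) - k)"
      by (simp add: power_int_diff power_int_minus power_mult field_simps flip: of_nat_mult)
    finally have "int (l * m) \<ge> k" by (simp add: P_powi_in_V_iff)
    hence "real (l * m) \<ge> real_of_int k" by linarith
    thus ?thesis unfolding *(1) using *(2) by (simp add: pos_divide_le_eq)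
  qed
  thus "bdd_above (slopes a)" by (rule bdd_aboveI)
qed

definition val :: "complex \<Rightarrow> real" where "val a = Sup (slopes a)"

lemma val_upper: "algebraic a \<Longrightarrow> a \<noteq> 0 \<Longrightarrow> s \<in> slopes a \<Longrightarrow> s \<le> val a"
  unfolding val_def using slopes_bounds(2) by (rule cSup_upper[rotated])

lemma val_least: "algebraic a \<Longrightarrow> a \<noteq> 0 \<Longrightarrow> (\<And>s. s \<in> slopes a \<Longrightarrow> s \<le> c) \<Longrightarrow> val a \<le> c"
  unfolding val_def using slopes_bounds(1) by (rule cSup_least)

lemma algebraic_mult: "algebraic a \<Longrightarrow> algebraic b \<Longrightarrow> algebraic (a * b :: complex)"
  using csf_mult[OF complex_subfield_algebraic] by auto

lemma val_add_le:
  assumes "algebraic a" "a \<noteq> 0" "algebraic b" "b \<noteq> 0" shows "val a + val b \<le> val (a * b)"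
proof -
  have ab: "algebraic (a * b)" "a * b \<noteq> 0" using assms by (auto simp: algebraic_mult)
  have "val a \<le> val (a * b) - val b"
  proof (rule val_least[OF assms(1,2)])
    fix s assume s: "s \<in> slopes a"
    have "val b \<le> val (a * b) - s"
      by (rule val_least[OF assms(3,4)]) (use val_upper[OF ab slopes_add[OF s]] in force)
    thus "s \<le> val (a * b) - val b" by simp
  qed
  thus ?thesis by simp
qed

lemma val_nonneg:
  assumes "a \<in> V" "a \<noteq> 0" shows "val a \<ge> 0"
proof -
  have "real_of_int 0 / real 1 \<in> slopes a" unfolding slopes_def using assms
    by (intro CollectI exI[of _ "0 :: int"] exI[of _ "1 :: nat"]) simp
  thus ?thesis using val_upper[of a 0] assms V(2) by auto
qed

lemma val_1: "val 1 = 0"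
proof -
  have "algebraic (1 :: complex)" using csf_1[OF complex_subfield_algebraic] by simp
  thus ?thesis using val_add_le[of 1 1] val_nonneg[of 1] csr_1[OF V(1)] by simp
qed

text \<open>One inequality is \<open>val_add_le\<close>. For the other, a rational k / n strictly
  between \<open>val a\<close> and \<open>- val (inverse a)\<close> would not be a slope of a. Then
  a^n P^(-k) is not in V, its inverse is, and - k / n is a slope of 1/a, a contradiction.\<close>

lemma val_inverse:
  assumes a: "algebraic a" "a \<noteq> 0" shows "val (inverse a) = - val a"
proof -
  have ia: "algebraic (inverse a)" "inverse a \<noteq> 0" using a by auto
  have "- val (inverse a) \<le> val a"
  proof (rule ccontr)
    assume "\<not> ?thesis"
    then obtain r :: rat where r: "val a < of_rat r" "of_rat r < - val (inverse a)" by (meson not_le of_rat_dense)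
    obtain k m where km: "quotient_of r = (k, m)" by fastforce
    have m: "m > 0" using quotient_of_denom_pos[OF km] .
    define n where "n = nat m"
    have rk: "real_of_rat r = real_of_int k / real n"
      using quotient_of_div[OF km] m by (simp add: of_rat_divide n_def)
    have n: "n > 0" using m by (simp add: n_def)
    have "a ^ n * P powi (- k) \<notin> V"
    proof
      assume "a ^ n * P powi (- k) \<in> V"
      hence "real_of_rat r \<in> slopes a" unfolding slopes_def using n rk by blast
      thus False using val_upper[OF a] r by force
    qed
    moreover have "algebraic (a ^ n * P powi (- k))" "a ^ n * P powi (- k) \<noteq> 0"
    proof -
      have "P powi (- k) = of_rat (of_nat p powi (- k))" by (simp add: power_int_def of_rat_power of_rat_inverse)
      thus "algebraic (a ^ n * P powi (- k))"
        using csf_mult[OF complex_subfield_algebraic] csf_power[OF complex_subfield_algebraic]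
          csf_of_rat[OF complex_subfield_algebraic] a by (metis mem_Collect_eq)
      show "a ^ n * P powi (- k) \<noteq> 0" using a by simp
    qed
    ultimately have "inverse (a ^ n * P powi (- k)) \<in> V" using valuation_ring by blast
    hence "inverse a ^ n * P powi (- (- k)) \<in> V" by (simp add: power_int_minus field_simps)
    hence "real_of_int (- k) / real n \<in> slopes (inverse a)" unfolding slopes_def using n by blast
    hence "- real_of_rat r \<le> val (inverse a)" using val_upper[OF ia] rk by simp
    thus False using r by simp
  qed
  moreover have "val a + val (inverse a) \<le> 0" using val_add_le[OF a ia] a val_1 by simp
  ultimately show ?thesis by simp
qed

lemma val_mult:
  assumes "algebraic a" "a \<noteq> 0" "algebraic b" "b \<noteq> 0" shows "val (a * b) = val a + val b"
proof -
  have ab: "algebraic (a * b)" "a * b \<noteq> 0" using assms by (auto simp: algebraic_mult)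
  have "val (a * b) + val (inverse b) \<le> val (a * b * inverse b)"
    using assms ab by (intro val_add_le) auto
  hence "val (a * b) \<le> val a + val b" using val_inverse assms by (simp add: mult.assoc)
  thus ?thesis using val_add_le[OF assms] by simp
qed

text \<open>One of the two quotients lies in V. If it is a / b, then a + b = b (1 + a / b), and the
  second factor is in V, hence of nonnegative value.\<close>

lemma val_add:
  assumes "algebraic a" "a \<noteq> 0" "algebraic b" "b \<noteq> 0" "a + b \<noteq> 0"
  shows "val (a + b) \<ge> min (val a) (val b)"
proof -
  have *: "val (a + b) \<ge> val b" if ab: "algebraic a" "a \<noteq> 0" "algebraic b" "b \<noteq> 0" "a + b \<noteq> 0" "a / b \<in> V" for a b
  proof -
    have "1 + a / b \<in> V" using ab csr_add[OF V(1) csr_1[OF V(1)]] by blast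
    moreover have nz: "1 + a / b \<noteq> 0" using ab by (simp add: add_divide_distrib[symmetric] field_simps add_eq_0_iff2)
    ultimately have "val (1 + a / b) \<ge> 0" "algebraic (1 + a / b)" using val_nonneg V(2) by auto
    moreover have "b * (1 + a / b) = a + b" using ab by (simp add: field_simps)
    ultimately show ?thesis using val_mult[of b "1 + a / b"] ab nz by simp
  qed
  have "algebraic (a / b)" using assms by (simp add: divide_inverse algebraic_mult algebraic_inverse)
  hence "a / b \<in> V \<or> b / a \<in> V" using valuation_ring[of "a / b"] assms by simp
  thus ?thesis using *[of a b] *[of b a] assms by (auto simp: add.commute)
qed

lemma val_p: "val P = 1"
proof (rule antisym)
  have P: "algebraic P" "P \<noteq> 0" using P_in_V V(2) by auto
  show "val P \<le> 1"
  proof (rule val_least[OF P])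
    fix s assume "s \<in> slopes P"
    then obtain k m where *: "s = real_of_int k / real m" "m > 0" "P ^ m * P powi (- k) \<in> V" by (auto simp: slopes_def)
    have "P ^ m * P powi (- k) = P powi (int m - k)" by (simp add: power_int_diff power_int_minus field_simps)
    hence "k \<le> int m" using *(3) by (simp add: P_powi_in_V_iff)
    hence "real_of_int k \<le> real m" by linarith
    thus "s \<le> 1" using * by simp
  qed
  have "real_of_int 1 / real 1 \<in> slopes P" unfolding slopes_def using csr_1[OF V(1)]
    by (intro CollectI exI[of _ "1 :: int"] exI[of _ "1 :: nat"]) simp
  thus "1 \<le> val P" using val_upper[OF P] by fastforce
qed

lemma val_of_int:
  assumes "n \<noteq> 0" shows "val (of_int n) = real (multiplicity (int p) n)"
proof -
  obtain c where c: "n = int p ^ multiplicity (int p) n * c" "\<not> int p dvd c"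
    using multiplicity_decompose'[of n "int p"] assms p by (metis not_prime_unit prime_nat_int_transfer)
  have alg: "algebraic (of_int k :: complex)" for k using csf_of_int[OF complex_subfield_algebraic, of k] by simp
  have cnz: "of_int c \<noteq> (0 :: complex)" using c(2) by auto
  have "val (of_int c) \<ge> 0" using cnz by (intro val_nonneg csr_of_int[OF V(1)]) auto
  moreover have "val (inverse (of_int c)) \<ge> 0" using cnz by (intro val_nonneg inverse_coprime_in_V c(2)) auto
  ultimately have vc: "val (of_int c) = 0" using val_inverse[OF alg cnz] by simp
  have vp: "val (P ^ k) = real k" "algebraic (P ^ k)" for k
  proof -
    show "algebraic (P ^ k)" for k using alg[of "int p ^ k"] by simp
    thus "val (P ^ k) = real k"
      using val_1 val_p by (induction k) (auto simp: val_mult alg[of "int p", simplified])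
  qed
  have "of_int n = P ^ multiplicity (int p) n * (of_int c :: complex)" by (subst c(1)) simp
  thus ?thesis using val_mult[OF vp(2) _ alg cnz] vp(1) vc by simp
qed

definition ext_abs :: "complex \<Rightarrow> real" where "ext_abs a = (if a = 0 then 0 else real p powr (- val a))"

lemma ext_abs_max:
  assumes "algebraic a" "algebraic b" shows "ext_abs (a + b) \<le> max (ext_abs a) (ext_abs b)"
proof (cases "a = 0 \<or> b = 0 \<or> a + b = 0")
  case True thus ?thesis by (auto simp: ext_abs_def le_max_iff_disj)
next
  case False
  hence "val (a + b) \<ge> min (val a) (val b)" using val_add[of a b] assms by auto
  hence "- val (a + b) \<le> - val a \<or> - val (a + b) \<le> - val b" by linarith
  thus ?thesis using False p_gt_1 by (auto simp: ext_abs_def le_max_iff_disj)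
qed

lemma absolute_value_ext_abs: "absolute_value_on algebraic_numbers ext_abs"
  unfolding absolute_value_on_def
proof (intro conjI ballI)
  fix x y :: complex assume "x \<in> algebraic_numbers" "y \<in> algebraic_numbers"
  hence xy: "algebraic x" "algebraic y" by auto
  show "ext_abs (x * y) = ext_abs x * ext_abs y"
    using val_mult[of x y] xy by (auto simp: ext_abs_def simp flip: powr_add)
  have "ext_abs x \<ge> 0" "ext_abs y \<ge> 0" by (auto simp: ext_abs_def)
  thus "ext_abs (x + y) \<le> ext_abs x + ext_abs y" using ext_abs_max[OF xy] by linarith
qed (use p_gt_1 in \<open>auto simp: ext_abs_def\<close>)

lemma ext_abs_of_rat: "ext_abs (of_rat q) = padic_abs p q"
proof (cases "q = 0")
  case False
  obtain k m where km: "quotient_of q = (k, m)" by fastforce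
  have m: "m > 0" using quotient_of_denom_pos[OF km] .
  have q: "of_rat q = of_int k * inverse (of_int m :: complex)"
    using quotient_of_div[OF km] by (simp add: of_rat_mult of_rat_inverse divide_inverse)
  have k: "k \<noteq> 0" using False quotient_of_div[OF km] by auto
  have alg: "algebraic (of_int k :: complex)" for k using csf_of_int[OF complex_subfield_algebraic, of k] by simp
  have "val (of_rat q) = val (of_int k) + val (inverse (of_int m))"
    unfolding q using k m by (intro val_mult) (auto simp: alg intro: algebraic_inverse)
  also have "\<dots> = real (multiplicity (int p) k) - real (multiplicity (int p) m)"
    using k m by (simp add: val_of_int val_inverse alg)
  finally have e: "- val (of_rat q) = real_of_int (int (multiplicity (int p) m) - int (multiplicity (int p) k))"
    (is "_ = real_of_int ?e") by simp
  have "real p powr (- val (of_rat q)) = real p powi ?e"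
    unfolding e by (rule powr_real_of_int') (use p_gt_1 in auto)
  thus ?thesis using False by (simp add: ext_abs_def padic_abs_def km)
qed (simp add: ext_abs_def padic_abs_def)

end

definition is_padic_extension :: "nat \<Rightarrow> (complex \<Rightarrow> real) \<Rightarrow> bool" where
  "is_padic_extension p u \<longleftrightarrow> absolute_value_on algebraic_numbers u \<and> (\<forall>q. u (of_rat q) = padic_abs p q) \<and>
     (\<forall>x y. algebraic x \<longrightarrow> algebraic y \<longrightarrow> u (x + y) \<le> max (u x) (u y))"

lemma exists_padic_extension:
  assumes "Factorial_Ring.prime p" shows "\<exists>u. is_padic_extension p u"
proof -
  obtain V where "maximal_subring p V" using exists_maximal_subring[OF assms] .
  then interpret maximal_subring p V .
  have "is_padic_extension p ext_abs"
    unfolding is_padic_extension_def using absolute_value_ext_abs ext_abs_of_rat ext_abs_max by blast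
  thus ?thesis by blast
qed

section \<open>Weak approximation\<close>

locale absolute_value =
  fixes K :: "complex set" and v :: "complex \<Rightarrow> real"
  assumes K: "complex_subfield K" and av: "absolute_value_on K v"
begin

lemma nonneg: "x \<in> K \<Longrightarrow> 0 \<le> v x" and eq_0_iff: "x \<in> K \<Longrightarrow> v x = 0 \<longleftrightarrow> x = 0"
  and mult: "x \<in> K \<Longrightarrow> y \<in> K \<Longrightarrow> v (x * y) = v x * v y"
  and triangle: "x \<in> K \<Longrightarrow> y \<in> K \<Longrightarrow> v (x + y) \<le> v x + v y"
  using av by (auto simp: absolute_value_on_def)

lemma zero [simp]: "v 0 = 0" using eq_0_iff[of 0] csf_0[OF K] by simp

lemma pos: "x \<in> K \<Longrightarrow> x \<noteq> 0 \<Longrightarrow> v x > 0" using nonneg[of x] eq_0_iff[of x] by force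

lemma one [simp]: "v 1 = 1"
  using mult[of 1 1] eq_0_iff[of 1] csf_1[OF K] by simp

lemma minus: assumes "x \<in> K" shows "v (- x) = v x"
proof -
  have m: "- 1 \<in> K" using csf_minus[OF K csf_1[OF K]] .
  have "v (- 1) * v (- 1) = 1" using mult[OF m m] by simp
  hence "v (- 1) = 1" using nonneg[OF m] by (metis abs_of_nonneg abs_mult_self_eq abs_1 mult.right_neutral real_sqrt_abs2 real_sqrt_one)
  thus ?thesis using mult[OF m assms] by simp
qed

lemma diff: "x \<in> K \<Longrightarrow> y \<in> K \<Longrightarrow> v (x - y) \<le> v x + v y"
  using triangle[of x "- y"] minus[of y] csf_minus[OF K] by simp

lemma diff_commute: "x \<in> K \<Longrightarrow> y \<in> K \<Longrightarrow> v (x - y) = v (y - x)"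
  using minus[of "x - y"] csf_diff[OF K] by simp

lemma reverse_triangle: "x \<in> K \<Longrightarrow> y \<in> K \<Longrightarrow> v x - v y \<le> v (x - y)"
  using triangle[of "x - y" y] csf_diff[OF K] by simp

lemma diff_triangle: "x \<in> K \<Longrightarrow> y \<in> K \<Longrightarrow> z \<in> K \<Longrightarrow> v (x - z) \<le> v (x - y) + v (y - z)"
  using triangle[of "x - y" "y - z"] csf_diff[OF K] by simp

lemma power: "x \<in> K \<Longrightarrow> v (x ^ n) = v x ^ n"
  by (induction n) (auto simp: mult csf_power[OF K])

lemma inverse: assumes "x \<in> K" shows "v (inverse x) = inverse (v x)"
proof (cases "x = 0")
  case False
  have "v x * v (inverse x) = 1" using mult[OF assms csf_inverse[OF K assms]] False by simp
  thus ?thesis by (metis inverse_unique)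
qed simp

lemma divide: "x \<in> K \<Longrightarrow> y \<in> K \<Longrightarrow> v (x / y) = v x / v y"
  by (simp add: divide_inverse mult inverse csf_inverse[OF K])

lemma power_int: "x \<in> K \<Longrightarrow> v (x powi n) = v x powi n"
  by (auto simp: power_int_def power inverse csf_inverse[OF K])

lemma sum_le: "(\<And>i. i \<in> A \<Longrightarrow> g i \<in> K) \<Longrightarrow> v (sum g A) \<le> (\<Sum>i\<in>A. v (g i))"
proof (induction A rule: infinite_finite_induct)
  case (insert a A)
  have "v (g a + sum g A) \<le> v (g a) + v (sum g A)"
    by (rule triangle) (auto intro!: csf_sum[OF K] insert.prems)
  thus ?case using insert by force
qed auto

lemma prod: "(\<And>i. i \<in> A \<Longrightarrow> g i \<in> K) \<Longrightarrow> v (prod g A) = (\<Prod>i\<in>A. v (g i))"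
  by (induction A rule: infinite_finite_induct) (auto simp: mult csf_prod[OF K])

text \<open>The sequence \<open>z ^ k / (1 + z ^ k)\<close> acts as a switch between absolute
  values: it tends to 0 where \<open>z\<close> is small and, by \<open>tendsto_one\<close>, to 1
  where \<open>z\<close> is large.\<close>

lemma tendsto_zero:
  assumes z: "z \<in> K" "v z < 1"
  shows "(\<lambda>k. v (z ^ k / (1 + z ^ k))) \<longlonglongrightarrow> 0"
proof (rule tendsto_sandwich[OF _ _ tendsto_const])
  have zk: "z ^ k \<in> K" "1 + z ^ k \<in> K" for k by (auto intro!: csf_power[OF K] csf_add[OF K] csf_1[OF K] z)
  have "(\<lambda>k. v z ^ k) \<longlonglongrightarrow> 0" using z nonneg[OF z(1)] by (intro LIMSEQ_power_zero) auto
  hence "(\<lambda>k. v z ^ k / (1 - v z ^ k)) \<longlonglongrightarrow> 0 / (1 - 0)"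
    by (intro tendsto_divide tendsto_diff tendsto_const) auto
  thus "(\<lambda>k. v z ^ k / (1 - v z ^ k)) \<longlonglongrightarrow> 0" by simp
  show "\<forall>\<^sub>F k in sequentially. 0 \<le> v (z ^ k / (1 + z ^ k))"
    using zk by (intro always_eventually allI nonneg csf_divide[OF K])
  show "\<forall>\<^sub>F k in sequentially. v (z ^ k / (1 + z ^ k)) \<le> v z ^ k / (1 - v z ^ k)"
    using eventually_gt_at_top[of 0]
  proof eventually_elim
    fix k :: nat assume k: "0 < k"
    have lt: "v z ^ k < 1" using z nonneg[OF z(1)] k by (simp add: power_less_one_iff)
    have le: "1 - v z ^ k \<le> v (1 + z ^ k)"
      using reverse_triangle[of 1 "- (z ^ k)"] zk minus power[OF z(1)] csf_minus[OF K] csf_1[OF K] by simp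
    have "v (z ^ k / (1 + z ^ k)) = v z ^ k / v (1 + z ^ k)" using divide zk power[OF z(1)] by simp
    also have "\<dots> \<le> v z ^ k / (1 - v z ^ k)" using le lt nonneg[OF z(1)] by (intro divide_left_mono) auto
    finally show "v (z ^ k / (1 + z ^ k)) \<le> v z ^ k / (1 - v z ^ k)" .
  qed
qed

lemma tendsto_one:
  assumes z: "z \<in> K" "v z > 1"
  shows "(\<lambda>k. v (z ^ k / (1 + z ^ k) - 1)) \<longlonglongrightarrow> 0"
proof (rule Lim_transform_eventually)
  define w where "w = inverse z"
  have w: "w \<in> K" unfolding w_def by (rule csf_inverse[OF K z(1)])
  have "v w < 1" using z by (simp add: w_def inverse inverse_less_1_iff)
  thus "(\<lambda>k. v (w ^ k / (1 + w ^ k))) \<longlonglongrightarrow> 0" by (rule tendsto_zero[OF w])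
  show "\<forall>\<^sub>F k in sequentially. v (w ^ k / (1 + w ^ k)) = v (z ^ k / (1 + z ^ k) - 1)"
    using eventually_gt_at_top[of 0]
  proof eventually_elim
    fix k :: nat assume k: "0 < k"
    have "z ^ k \<noteq> - 1"
    proof
      assume "z ^ k = - 1"
      hence "v z ^ k = 1" using minus[OF csf_1[OF K]] by (simp flip: power[OF z(1)])
      thus False using z(2) k one_less_power[of "v z" k] by simp
    qed
    hence nz: "1 + z ^ k \<noteq> 0" by (simp add: add_eq_0_iff)
    have znz: "z \<noteq> 0" using z(2) by auto
    have "w ^ k / (1 + w ^ k) = 1 / (1 + z ^ k)"
      using znz nz by (simp add: w_def power_inverse field_simps)
    moreover have "z ^ k / (1 + z ^ k) - 1 = - (1 / (1 + z ^ k))" using nz by (simp add: field_simps)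
    moreover have "1 / (1 + z ^ k) \<in> K" by (intro csf_divide[OF K] csf_add[OF K] csf_1[OF K] csf_power[OF K] z)
    ultimately show "v (w ^ k / (1 + w ^ k)) = v (z ^ k / (1 + z ^ k) - 1)" using minus by simp
  qed
qed

end

text \<open>Prescribing the values \<open>b\<close> on the rationals singles out one absolute value
  in its class, so different ones are inequivalent; the last clause excludes the trivial absolute
  value.\<close>

definition nontrivial_over :: "(rat \<Rightarrow> real) \<Rightarrow> complex set \<Rightarrow> (complex \<Rightarrow> real) \<Rightarrow> bool" where
  "nontrivial_over b K v \<longleftrightarrow> absolute_value_on K v \<and> (\<forall>q. v (of_rat q) = b q) \<and> (\<exists>q. b q > 1)"

text \<open>Some rational q has the same size above 1 for both. A fraction k / n between the
  logarithms of the sizes of x, measured in units of ln (b q), makes x^n / q^k large for one and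
  small for the other. Passing to the inverse of x swaps the two cases.\<close>

lemma separate_two:
  assumes K: "complex_subfield K" and v: "nontrivial_over b K v" and v': "nontrivial_over b K v'"
    and x: "x \<in> K" "v x \<noteq> v' x"
  obtains z where "z \<in> K" "v z > 1" "v' z < 1"
proof -
  interpret v: absolute_value K v by unfold_locales (use K v in \<open>auto simp: nontrivial_over_def\<close>)
  interpret v': absolute_value K v' by unfold_locales (use K v' in \<open>auto simp: nontrivial_over_def\<close>)
  obtain q where q: "b q > 1" "v (of_rat q) = b q" "v' (of_rat q) = b q"
    using v v' by (auto simp: nontrivial_over_def)
  have main: "\<exists>z\<in>K. v z > 1 \<and> v' z < 1" if x: "x \<in> K" "x \<noteq> 0" "v' x < v x" for x
  proof -
    define \<beta> where "\<beta> = ln (b q)"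
    have \<beta>: "\<beta> > 0" using q(1) by (simp add: \<beta>_def)
    have "ln (v' x) < ln (v x)" using x v'.pos v.pos by simp
    hence "ln (v' x) / \<beta> < ln (v x) / \<beta>" using \<beta> by (simp add: divide_strict_right_mono)
    then obtain r :: rat where r: "ln (v' x) / \<beta> < of_rat r" "of_rat r < ln (v x) / \<beta>" using of_rat_dense by blast
    obtain k m where km: "quotient_of r = (k, m)" by fastforce
    define n where "n = nat m"
    have n: "n > 0" using quotient_of_denom_pos[OF km] by (simp add: n_def)
    have rk: "real_of_rat r = real_of_int k / real n"
      using quotient_of_div[OF km] quotient_of_denom_pos[OF km] by (simp add: of_rat_divide n_def)
    define z where "z = x ^ n * of_rat q powi (- k)"
    have qp: "of_rat q powi (- k) \<in> K"
      by (auto simp: power_int_def intro!: csf_power[OF K] csf_inverse[OF K] csf_of_rat[OF K])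
    have z: "z \<in> K" unfolding z_def by (intro csf_mult[OF K] csf_power[OF K] x qp)
    have ln_pow: "ln (t ^ n * b q powi (- k)) = real n * ln t - real_of_int k * \<beta>" if "t > 0" for t
      using that q(1) by (simp add: ln_mult ln_realpow power_int_minus ln_inverse \<beta>_def ln_powr flip: powr_real_of_int')
    have vz: "v z = v x ^ n * b q powi (- k)" "v' z = v' x ^ n * b q powi (- k)"
      unfolding z_def using x qp csf_power[OF K] csf_of_rat[OF K]
      by (simp_all add: v.mult v'.mult v.power v'.power v.power_int v'.power_int q)
    have znz: "z \<noteq> 0" using x q v.zero unfolding z_def by auto
    have "real_of_int k * \<beta> < real n * ln (v x)" "real n * ln (v' x) < real_of_int k * \<beta>"
      using r \<beta> n unfolding rk by (simp_all add: field_simps)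
    hence "ln (v z) > 0" "ln (v' z) < 0"
      unfolding vz using x v.pos[of x] v'.pos[of x] by (simp_all add: ln_pow)
    thus ?thesis using z znz v.pos[of z] v'.pos[of z] by auto
  qed
  have "x \<noteq> 0" using x(2) by auto
  show ?thesis
  proof (cases "v' x < v x")
    case True thus ?thesis using main[of x] x \<open>x \<noteq> 0\<close> that by blast
  next
    case False
    hence "v x < v' x" using x by simp
    hence "v' (inverse x) < v (inverse x)"
      using x(1) \<open>x \<noteq> 0\<close> v.pos[of x] by (simp add: v.inverse v'.inverse)
    thus ?thesis using main[of "inverse x"] x \<open>x \<noteq> 0\<close> that csf_inverse[OF K] by auto
  qed
qed

text \<open>The induction of Artin and Whaples. Let y separate v from the new w. If w z \<le> 1,
  then z^k y works for large k. Otherwise y times z^k / (1 + z^k) does, since this factor tends to 1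
  for v and w and to 0 for the old absolute values.\<close>

lemma separate_many:
  assumes K: "complex_subfield K" and v: "nontrivial_over b K v" and fin: "finite A"
    and A: "\<And>w. w \<in> A \<Longrightarrow> nontrivial_over b K w \<and> (\<exists>x\<in>K. v x \<noteq> w x)"
  shows "\<exists>z\<in>K. v z > 1 \<and> (\<forall>w\<in>A. w z < 1)"
  using fin A
proof (induction A)
  case empty
  obtain q where "v (of_rat q) > 1" using v by (auto simp: nontrivial_over_def)
  thus ?case using csf_of_rat[OF K] by auto
next
  case (insert w A)
  interpret v: absolute_value K v by unfold_locales (use K v in \<open>auto simp: nontrivial_over_def\<close>)
  interpret w: absolute_value K w by unfold_locales (use K insert.prems in \<open>auto simp: nontrivial_over_def\<close>)
  obtain z where z: "z \<in> K" "v z > 1" "\<And>w. w \<in> A \<Longrightarrow> w z < 1" using insert by auto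
  obtain y where y: "y \<in> K" "v y > 1" "w y < 1"
    using separate_two[OF K v, of w] insert.prems by (metis insertI1)
  have wA: "absolute_value K w'" if "w' \<in> A" for w'
    using insert.prems[of w'] that K by unfold_locales (auto simp: nontrivial_over_def)
  show ?case
  proof (cases "w z \<le> 1")
    case True
    have "\<forall>\<^sub>F k in sequentially. w' (z ^ k * y) < 1" if "w' \<in> A" for w'
    proof -
      interpret w': absolute_value K w' by (rule wA[OF that])
      have "(\<lambda>k. w' z ^ k * w' y) \<longlonglongrightarrow> 0 * w' y"
        using z(1,3) that w'.nonneg[OF z(1)] by (intro tendsto_intros LIMSEQ_power_zero) auto
      hence "\<forall>\<^sub>F k in sequentially. w' z ^ k * w' y < 1" by (auto dest: order_tendstoD(2)[of _ _ _ 1])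
      thus ?thesis by (simp add: w'.mult w'.power z y csf_power[OF K])
    qed
    hence "\<forall>\<^sub>F k in sequentially. \<forall>w'\<in>A. w' (z ^ k * y) < 1" using insert.hyps by (simp add: eventually_ball_finite)
    then obtain k where k: "\<forall>w'\<in>A. w' (z ^ k * y) < 1" by (auto simp: eventually_sequentially)
    have "w z ^ k * w y < 1"
      using True y w.nonneg[OF z(1)] w.nonneg[OF y(1)] by (metis mult_left_le_one_le power_le_one zero_le_power le_less_trans)
    moreover have "v z ^ k * v y > 1" using z(2) y(2) by (metis less_le_trans mult.commute mult_le_cancel_left1 one_le_power less_imp_le not_le order.strict_trans zero_less_one)
    ultimately show ?thesis using k csf_mult[OF K csf_power[OF K z(1)] y(1)]
      by (intro bexI[of _ "z ^ k * y"]) (auto simp: w.mult w.power v.mult v.power z y csf_power[OF K])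
  next
    case False
    define t where "t = (\<lambda>k. z ^ k / (1 + z ^ k))"
    have t: "t k \<in> K" for k unfolding t_def by (intro csf_power[OF K] csf_divide[OF K] csf_add[OF K] csf_1[OF K] z)
    have near1: "\<forall>\<^sub>F k in sequentially. \<bar>u (t k) - 1\<bar> < e" if "absolute_value K u" "u z > 1" "e > 0" for u e
    proof -
      interpret u: absolute_value K u by fact
      have "\<forall>\<^sub>F k in sequentially. u (t k - 1) < e"
        using order_tendstoD(2)[OF u.tendsto_one[OF z(1) that(2)] that(3)] by (simp add: t_def)
      thus ?thesis
      proof eventually_elim
        case (elim k)
        thus ?case using u.reverse_triangle[OF t[of k] csf_1[OF K]] u.reverse_triangle[OF csf_1[OF K] t[of k]]
          u.diff_commute[OF t[of k] csf_1[OF K]] by simp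
      qed
    qed
    have 1: "\<forall>\<^sub>F k in sequentially. v (t k * y) > 1"
    proof -
      have e: "1 - 1 / v y > 0" using y(2) by simp
      have "\<forall>\<^sub>F k in sequentially. \<bar>v (t k) - 1\<bar> < 1 - 1 / v y"
        using near1[of v "1 - 1 / v y", OF _ z(2) e] v.absolute_value_axioms by blast
      thus ?thesis
      proof eventually_elim
        case (elim k)
        hence "v (t k) > 1 / v y" by linarith
        thus ?case using y(2) by (simp add: v.mult t y field_simps)
      qed
    qed
    have 2: "\<forall>\<^sub>F k in sequentially. w (t k * y) < 1"
    proof -
      \<comment> \<open>Chosen so that (1 + e) w(y) = 2 w(y) / (1 + w(y)), which is below 1.\<close>
      define e where "e = (1 - w y) / (1 + w y)"
      have e: "e > 0" using y(3) w.nonneg[OF y(1)] by (simp add: e_def)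
      have "\<forall>\<^sub>F k in sequentially. \<bar>w (t k) - 1\<bar> < e" using near1[of w e] False e w.absolute_value_axioms by simp
      thus ?thesis
      proof eventually_elim
        case (elim k)
        have "w (t k) < 1 + e" using elim by linarith
        hence "w (t k) * w y \<le> (1 + e) * w y" using w.nonneg[OF y(1)] by (intro mult_right_mono) auto
        also have "(1 + e) * w y = 2 * w y / (1 + w y)" using w.nonneg[OF y(1)] by (simp add: e_def field_simps)
        also have "\<dots> < 1" using y(3) w.nonneg[OF y(1)] by simp
        finally show ?case by (simp add: w.mult t y)
      qed
    qed
    have "\<forall>\<^sub>F k in sequentially. w' (t k * y) < 1" if "w' \<in> A" for w'
    proof -
      interpret w': absolute_value K w' by (rule wA[OF that])
      have "(\<lambda>k. w' (t k) * w' y) \<longlonglongrightarrow> 0 * w' y"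
        unfolding t_def using z(1,3) that by (intro tendsto_intros w'.tendsto_zero) auto
      hence "\<forall>\<^sub>F k in sequentially. w' (t k) * w' y < 1" by (auto dest: order_tendstoD(2)[of _ _ _ 1])
      thus ?thesis by (simp add: w'.mult t y)
    qed
    hence "\<forall>\<^sub>F k in sequentially. \<forall>w'\<in>A. w' (t k * y) < 1" using insert.hyps by (simp add: eventually_ball_finite)
    hence "\<forall>\<^sub>F k in sequentially. v (t k * y) > 1 \<and> w (t k * y) < 1 \<and> (\<forall>w'\<in>A. w' (t k * y) < 1)"
      using 1 2 by (intro eventually_conj)
    then obtain k where "v (t k * y) > 1 \<and> w (t k * y) < 1 \<and> (\<forall>w'\<in>A. w' (t k * y) < 1)" by (auto simp: eventually_sequentially)
    thus ?thesis by (intro bexI[of _ "t k * y"]) (auto intro: csf_mult[OF K t y(1)])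
  qed
qed

text \<open>Multiply \<open>a\<close> by the switch sequence of a separating element.\<close>

lemma weak_approximation:
  assumes K: "complex_subfield K" and v: "nontrivial_over b K v" and fin: "finite A"
    and A: "\<And>w. w \<in> A \<Longrightarrow> nontrivial_over b K w \<and> (\<exists>x\<in>K. v x \<noteq> w x)" and a: "a \<in> K" and e: "e > 0"
  obtains t where "t \<in> K" "v (t - a) < e" "\<And>w. w \<in> A \<Longrightarrow> w t < e"
proof -
  interpret v: absolute_value K v by unfold_locales (use K v in \<open>auto simp: nontrivial_over_def\<close>)
  obtain z where z: "z \<in> K" "v z > 1" "\<And>w. w \<in> A \<Longrightarrow> w z < 1" using separate_many[OF K v fin A] by blast
  define t where "t = (\<lambda>k. z ^ k / (1 + z ^ k))"
  have t: "t k \<in> K" for k unfolding t_def by (intro csf_power[OF K] csf_divide[OF K] csf_add[OF K] csf_1[OF K] z)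
  have "(\<lambda>k. v a * v (t k - 1)) \<longlonglongrightarrow> v a * 0" unfolding t_def by (intro tendsto_intros v.tendsto_one z)
  moreover have "v a * v (t k - 1) = v (a * t k - a)" for k
    using v.mult[OF a csf_diff[OF K t[of k] csf_1[OF K]]] by (simp add: algebra_simps)
  ultimately have 1: "\<forall>\<^sub>F k in sequentially. v (a * t k - a) < e"
    using e by (auto dest: order_tendstoD(2)[of _ _ _ e])
  have "\<forall>\<^sub>F k in sequentially. w (a * t k) < e" if "w \<in> A" for w
  proof -
    interpret w: absolute_value K w by unfold_locales (use K A that in \<open>auto simp: nontrivial_over_def\<close>)
    have "(\<lambda>k. w a * w (t k)) \<longlonglongrightarrow> w a * 0" unfolding t_def using z that by (intro tendsto_intros w.tendsto_zero) auto
    thus ?thesis using e by (auto simp: w.mult[OF a t] dest: order_tendstoD(2)[of _ _ _ e])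
  qed
  hence "\<forall>\<^sub>F k in sequentially. \<forall>w\<in>A. w (a * t k) < e" using fin by (simp add: eventually_ball_finite)
  hence "\<forall>\<^sub>F k in sequentially. v (a * t k - a) < e \<and> (\<forall>w\<in>A. w (a * t k) < e)" using 1 by (intro eventually_conj)
  then obtain k where "v (a * t k - a) < e \<and> (\<forall>w\<in>A. w (a * t k) < e)" by (auto simp: eventually_sequentially)
  thus ?thesis using that[of "a * t k"] csf_mult[OF K a t] by blast
qed

section \<open>The coefficients depend continuously on the roots\<close>

lemma coeff_mult_linear:
  fixes p :: "complex poly"
  shows "coeff ([:- a, 1:] * p) k = - a * coeff p k + (if k = 0 then 0 else coeff p (k - 1))"
  by (cases k) (auto simp: mult_pCons_left)

lemma (in absolute_value) coeff_prod_continuous: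
  assumes "finite A" "\<And>i. i \<in> A \<Longrightarrow> \<alpha> i \<in> K" "\<epsilon> > 0"
  shows "\<exists>\<delta>>0. \<forall>\<beta>. (\<forall>i\<in>A. \<beta> i \<in> K \<and> v (\<beta> i - \<alpha> i) < \<delta>) \<longrightarrow>
           (\<forall>k. v (coeff (\<Prod>i\<in>A. [:- \<beta> i, 1:]) k - coeff (\<Prod>i\<in>A. [:- \<alpha> i, 1:]) k) < \<epsilon>)"
  using assms
proof (induction A arbitrary: \<epsilon> rule: finite_induct)
  case empty thus ?case by (auto intro!: exI[of _ 1])
next
  case (insert a A)
  define p0 where "p0 = (\<Prod>i\<in>A. [:- \<alpha> i, 1:])"
  have in_K: "coeff (\<Prod>i\<in>A. [:- \<gamma> i, 1:]) k \<in> K" if "\<And>i. i \<in> A \<Longrightarrow> \<gamma> i \<in> K" for \<gamma> k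
    using insert.hyps(1) that
  proof (induction A arbitrary: k rule: finite_induct)
    case (insert x A)
    thus ?case by (simp add: coeff_mult_linear del: mult_pCons_left)
      (auto intro!: csf_add[OF K] csf_mult[OF K] csf_minus[OF K] csf_0[OF K] csf_diff[OF K])
  qed (auto simp: csf_0[OF K] csf_1[OF K] coeff_1)
  have p0K: "coeff p0 k \<in> K" for k unfolding p0_def using in_K insert.prems by auto
  have aK: "\<alpha> a \<in> K" using insert.prems by auto
  define M where "M = (\<Sum>k\<le>degree p0. v (coeff p0 k))"
  have M: "v (coeff p0 k) \<le> M" for k
  proof (cases "k \<le> degree p0")
    case True thus ?thesis unfolding M_def using nonneg p0K by (intro member_le_sum) auto
  next
    case False thus ?thesis unfolding M_def using nonneg p0K by (auto simp: coeff_eq_0 intro!: sum_nonneg)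
  qed
  have "M \<ge> 0" unfolding M_def using nonneg p0K by (auto intro!: sum_nonneg)
  \<comment> \<open>The difference of the coefficients has three parts. The two governed by the
    induction hypothesis add up to at most (v (\<alpha> a) + 2) \<eta> = \<epsilon> / 2, as v
    (\<beta> a) exceeds v (\<alpha> a) by at most 1; the third comes from moving the new root and is
    at most \<delta> M, which is below \<epsilon> / 2.\<close>
  define \<eta> where "\<eta> = \<epsilon> / (2 * (v (\<alpha> a) + 2))"
  have va: "v (\<alpha> a) \<ge> 0" using nonneg[OF aK] .
  have \<eta>: "\<eta> > 0" using insert.prems va by (simp add: \<eta>_def)
  obtain \<delta>0 where \<delta>0: "\<delta>0 > 0" "\<And>\<beta> k. (\<forall>i\<in>A. \<beta> i \<in> K \<and> v (\<beta> i - \<alpha> i) < \<delta>0) \<Longrightarrow>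
      v (coeff (\<Prod>i\<in>A. [:- \<beta> i, 1:]) k - coeff p0 k) < \<eta>"
    using insert.IH[OF _ \<eta>] insert.prems unfolding p0_def by auto
  define \<delta> where "\<delta> = min (min \<delta>0 1) (\<epsilon> / (2 * (M + 1)))"
  have \<delta>: "\<delta> > 0" "\<delta> \<le> \<delta>0" "\<delta> \<le> 1" "\<delta> * (M + 1) \<le> \<epsilon> / 2"
  proof -
    have M1: "M + 1 > 0" using \<open>M \<ge> 0\<close> by simp
    thus "\<delta> > 0" using \<delta>0(1) insert.prems by (simp add: \<delta>_def)
    show "\<delta> \<le> \<delta>0" "\<delta> \<le> 1" by (simp_all add: \<delta>_def)
    have "\<delta> * (M + 1) \<le> \<epsilon> / (2 * (M + 1)) * (M + 1)" using M1 by (intro mult_right_mono) (auto simp: \<delta>_def)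
    also have "\<dots> = \<epsilon> / 2" using M1 by (simp add: divide_simps)
    finally show "\<delta> * (M + 1) \<le> \<epsilon> / 2" .
  qed
  show ?case
  proof (intro exI[of _ \<delta>] conjI \<delta> allI impI)
    fix \<beta> k assume \<beta>: "\<forall>i\<in>insert a A. \<beta> i \<in> K \<and> v (\<beta> i - \<alpha> i) < \<delta>"
    define p where "p = (\<Prod>i\<in>A. [:- \<beta> i, 1:])"
    have pK: "coeff p k \<in> K" for k unfolding p_def using in_K \<beta> by auto
    have bK: "\<beta> a \<in> K" and ba: "v (\<beta> a - \<alpha> a) < \<delta>" using \<beta> by auto
    have IH: "v (coeff p k - coeff p0 k) < \<eta>" for k unfolding p_def using \<delta>0(2) \<beta> \<delta>(2) by fastforce
    define d1 d2 d3 where "d1 = \<beta> a * (coeff p k - coeff p0 k)" and "d2 = (\<beta> a - \<alpha> a) * coeff p0 k"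
      and "d3 = (if k = 0 then 0 else coeff p (k - 1) - coeff p0 (k - 1))"
    have dK: "d1 \<in> K" "d2 \<in> K" "d3 \<in> K" unfolding d1_def d2_def d3_def
      by (auto intro!: csf_mult[OF K] csf_diff[OF K] csf_0[OF K] pK p0K bK aK)
    have eq: "coeff (\<Prod>i\<in>insert a A. [:- \<beta> i, 1:]) k - coeff (\<Prod>i\<in>insert a A. [:- \<alpha> i, 1:]) k = d3 - (d1 + d2)"
      unfolding prod.insert[OF insert.hyps] coeff_mult_linear p_def[symmetric] p0_def[symmetric] d1_def d2_def d3_def
      by (simp add: algebra_simps)
    have "v (\<beta> a) \<le> v (\<alpha> a) + 1"
      using reverse_triangle[OF bK aK] ba \<delta>(3) by linarith
    hence "v d1 \<le> (v (\<alpha> a) + 1) * \<eta>" unfolding d1_def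
      using mult[OF bK csf_diff[OF K pK p0K]] IH[of k] nonneg[OF bK] nonneg[OF csf_diff[OF K pK[of k] p0K[of k]]]
      by (auto intro!: mult_mono)
    moreover have "v d2 \<le> \<delta> * M" unfolding d2_def
      using mult[OF csf_diff[OF K bK aK] p0K] M[of k] ba nonneg[OF csf_diff[OF K bK aK]] nonneg[OF p0K[of k]] \<delta>(1)
      by (auto intro!: mult_mono)
    moreover have "v d3 \<le> \<eta>" using IH[of "k - 1"] \<eta> by (auto simp: d3_def)
    moreover have "v (d3 - (d1 + d2)) \<le> v d3 + (v d1 + v d2)"
      using diff[OF dK(3) csf_add[OF K dK(1,2)]] triangle[OF dK(1,2)] by linarith
    moreover have "(v (\<alpha> a) + 2) * \<eta> = \<epsilon> / 2" using va by (simp add: \<eta>_def divide_simps)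
    hence "\<eta> + (v (\<alpha> a) + 1) * \<eta> = \<epsilon> / 2" by (simp add: algebra_simps)
    moreover have "\<delta> * M < \<epsilon> / 2" using \<delta>(1,4) by (simp add: algebra_simps)
    ultimately show "v (coeff (\<Prod>i\<in>insert a A. [:- \<beta> i, 1:]) k - coeff (\<Prod>i\<in>insert a A. [:- \<alpha> i, 1:]) k) < \<epsilon>"
      unfolding eq by linarith
  qed
qed

section \<open>Places and local degrees\<close>

locale conjugate_places =
  fixes f :: "rat poly" and \<theta> :: complex and u :: "complex \<Rightarrow> real" and b :: "rat \<Rightarrow> real"
  assumes f: "is_minpoly f \<theta>" and alg: "algebraic \<theta>"
    and u: "nontrivial_over b algebraic_numbers u"
begin

definition number_field ("\<F>") where "\<F> = rat_adjoin \<theta>"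

lemma subfield_F: "complex_subfield \<F>" unfolding number_field_def by (rule complex_subfield_rat_adjoin[OF f])

sublocale u: absolute_value algebraic_numbers u
  using u complex_subfield_algebraic by unfold_locales (auto simp: nontrivial_over_def)

lemma F_iff: "a \<in> \<F> \<longleftrightarrow> (\<exists>q. a = rat_eval q \<theta>)" by (simp add: number_field_def rat_adjoin_iff)

lemma root_algebraic: "z \<in> roots_of f \<Longrightarrow> algebraic z"
  using is_minpoly_nonzero[OF f] unfolding roots_of_iff rat_eval_def algebraic_altdef
  by (intro exI[of _ "map_poly of_rat f"]) auto

lemma conj_rat_eval: "z \<in> roots_of f \<Longrightarrow> conj_map \<theta> z (rat_eval q \<theta>) = rat_eval q z"
  by (rule conj_map_rat_eval[OF f])

lemma conj_algebraic: "z \<in> roots_of f \<Longrightarrow> a \<in> \<F> \<Longrightarrow> conj_map \<theta> z a \<in> algebraic_numbers"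
  using csf_rat_eval[OF complex_subfield_algebraic] root_algebraic by (auto simp: F_iff conj_rat_eval)

lemma conj_mult: "z \<in> roots_of f \<Longrightarrow> a \<in> \<F> \<Longrightarrow> c \<in> \<F> \<Longrightarrow> conj_map \<theta> z (a * c) = conj_map \<theta> z a * conj_map \<theta> z c"
  by (auto simp: F_iff conj_rat_eval simp flip: rat_eval_mult)

lemma conj_add: "z \<in> roots_of f \<Longrightarrow> a \<in> \<F> \<Longrightarrow> c \<in> \<F> \<Longrightarrow> conj_map \<theta> z (a + c) = conj_map \<theta> z a + conj_map \<theta> z c"
  by (auto simp: F_iff conj_rat_eval simp flip: rat_eval_add)

lemma conj_diff: "z \<in> roots_of f \<Longrightarrow> a \<in> \<F> \<Longrightarrow> c \<in> \<F> \<Longrightarrow> conj_map \<theta> z (a - c) = conj_map \<theta> z a - conj_map \<theta> z c"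
  by (auto simp: F_iff conj_rat_eval simp flip: rat_eval_diff)

lemma conj_of_rat: "z \<in> roots_of f \<Longrightarrow> conj_map \<theta> z (of_rat c) = of_rat c"
  using conj_rat_eval[of z "[:c:]"] by simp

lemma conj_theta: "z \<in> roots_of f \<Longrightarrow> conj_map \<theta> z \<theta> = z"
  using conj_rat_eval[of z "[:0, 1:]"] by simp

lemma conj_eq_0_iff: assumes z: "z \<in> roots_of f" and a: "a \<in> \<F>" shows "conj_map \<theta> z a = 0 \<longleftrightarrow> a = 0"
proof -
  obtain q where q: "a = rat_eval q \<theta>" using a F_iff by blast
  have "is_minpoly f z" using is_minpoly_conj[OF f] z by (simp add: roots_of_iff)
  thus ?thesis using is_minpoly_iff f q conj_rat_eval[OF z] by metis
qed

text \<open>Restricted to the field in order to be extensional, as \<open>places\<close> requires,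
  so that equality of functions is equality of places.\<close>

definition conj_abs :: "complex \<Rightarrow> complex \<Rightarrow> real" where
  "conj_abs z = restrict (\<lambda>a. u (conj_map \<theta> z a)) \<F>"

lemma conj_abs_nontrivial:
  assumes z: "z \<in> roots_of f" shows "nontrivial_over b \<F> (conj_abs z)"
proof -
  have "absolute_value_on \<F> (conj_abs z)" unfolding absolute_value_on_def
  proof (intro conjI ballI)
    fix x y assume xy: "x \<in> \<F>" "y \<in> \<F>"
    note c = conj_algebraic[OF z xy(1)] conj_algebraic[OF z xy(2)]
    show "conj_abs z (x * y) = conj_abs z x * conj_abs z y"
      using xy csf_mult[OF subfield_F] u.mult[OF c] by (simp add: conj_abs_def conj_mult z)
    show "conj_abs z (x + y) \<le> conj_abs z x + conj_abs z y"
      using xy csf_add[OF subfield_F] u.triangle[OF c] by (simp add: conj_abs_def conj_add z)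
  next
    fix x assume x: "x \<in> \<F>"
    note c = conj_algebraic[OF z x]
    show "0 \<le> conj_abs z x" "conj_abs z x = 0 \<longleftrightarrow> x = 0"
      using x u.nonneg[OF c] u.eq_0_iff[OF c] by (simp_all add: conj_abs_def conj_eq_0_iff z)
  qed
  thus ?thesis using u by (auto simp: nontrivial_over_def conj_abs_def conj_of_rat z csf_of_rat[OF subfield_F])
qed

lemma charpoly_conj:
  assumes t: "t \<in> \<F>"
  obtains h where "map_poly of_rat h = (\<Prod>z\<in>roots_of f. [:- conj_map \<theta> z t, 1:])"
proof -
  obtain q where q: "t = rat_eval q \<theta>" using t F_iff by blast
  obtain h where "map_poly of_rat h = (\<Prod>z\<in>roots_of f. [:- rat_eval q z, 1:])"
    using conj_charpoly_rational[OF f] by blast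
  thus ?thesis using that[of h] q conj_rat_eval by (metis (no_types, lifting) prod.cong)
qed

end

locale conjugate_places_at = conjugate_places +
  fixes v :: "complex \<Rightarrow> real"
  assumes v: "nontrivial_over b \<F> v" and ext: "v \<in> extensional \<F>"
begin

sublocale v: absolute_value \<F> v
  using v subfield_F by unfold_locales (auto simp: nontrivial_over_def)

text \<open>The embeddings that induce the place \<open>v\<close>, each named by the root to which
  it sends \<theta>. Their number will be the local degree.\<close>

definition S where "S = {z \<in> roots_of f. conj_abs z = v}"

lemma finite_roots: "finite (roots_of f)" using finite_roots_of is_minpoly_nonzero[OF f] by blast

lemma finite_S: "finite S" using finite_roots by (simp add: S_def)

lemma S_abs: "z \<in> S \<Longrightarrow> a \<in> \<F> \<Longrightarrow> u (conj_map \<theta> z a) = v a"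
  by (auto simp: S_def conj_abs_def)

text \<open>An embedding outside \<open>S\<close> gives an absolute value different from
  \<open>v\<close>, so weak approximation can make t small there while t is close to a for
  \<open>v\<close>.\<close>

lemma conj_approximation:
  assumes a: "a \<in> \<F>" and e: "e > 0"
  obtains t where "t \<in> \<F>" "v (t - a) < e" "\<And>z. z \<in> roots_of f - S \<Longrightarrow> u (conj_map \<theta> z t) < e"
proof -
  have "\<exists>x\<in>\<F>. v x \<noteq> conj_abs z x" if z: "z \<in> roots_of f - S" for z
  proof (rule ccontr)
    assume "\<not> ?thesis"
    hence "conj_abs z = v" using ext by (intro extensionalityI[of _ \<F>]) (auto simp: conj_abs_def)
    thus False using z by (auto simp: S_def)
  qed
  hence "\<And>w. w \<in> conj_abs ` (roots_of f - S) \<Longrightarrow> nontrivial_over b \<F> w \<and> (\<exists>x\<in>\<F>. v x \<noteq> w x)"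
    using conj_abs_nontrivial by auto
  then obtain t where t: "t \<in> \<F>" "v (t - a) < e" "\<And>w. w \<in> conj_abs ` (roots_of f - S) \<Longrightarrow> w t < e"
    using weak_approximation[OF subfield_F v _ _ a e, of "conj_abs ` (roots_of f - S)"] finite_roots by auto
  have "u (conj_map \<theta> z t) < e" if "z \<in> roots_of f - S" for z
    using t(3)[OF imageI[OF that]] t(1) by (simp add: conj_abs_def)
  thus ?thesis using that t(1,2) by blast
qed

lemma v_of_rat: "v (of_rat q) = u (of_rat q)" using u v by (auto simp: nontrivial_over_def)

lemma theta_in_F: "\<theta> \<in> \<F>" unfolding number_field_def by (rule in_rat_adjoin_self)

lemma theta_root: "\<theta> \<in> roots_of f" using is_minpoly_root[OF f] by (simp add: roots_of_iff)

lemma charpoly_root: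
  assumes t: "t \<in> \<F>" and h: "map_poly of_rat h = (\<Prod>z\<in>roots_of f. [:- conj_map \<theta> z t, 1:])"
  shows "rat_eval h t = 0"
proof -
  have "conj_map \<theta> \<theta> t = t" using t theta_root by (auto simp: F_iff conj_rat_eval)
  thus ?thesis unfolding rat_eval_def h poly_prod using theta_root finite_roots
    by (auto intro!: prod_zero bexI[of _ \<theta>])
qed

text \<open>Otherwise weak approximation gives an element close to 1 for \<open>v\<close> all of whose conjugates are small.
  Its characteristic polynomial is rational and close to a power of the variable, which contradicts \<open>v (t - 1) < 1\<close>.\<close>

lemma S_nonempty: "S \<noteq> {}"
proof
  assume "S = {}"
  define n where "n = card (roots_of f)"
  have n: "n > 0" using theta_root finite_roots by (auto simp: n_def card_gt_0_iff)
  \<comment> \<open>As v(t) lies between 1/2 and 2, the equation of t will give 2^(-n) \<le> n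
    \<epsilon> 2^n; this value of \<epsilon> makes n \<epsilon> 4^n less than 1.\<close>
  define \<epsilon> where "\<epsilon> = 1 / (real n * 4 ^ n + 1)"
  have \<epsilon>: "\<epsilon> > 0" by (simp add: \<epsilon>_def add_nonneg_pos)
  obtain \<delta> where \<delta>: "\<delta> > 0" "\<And>\<beta> k. (\<forall>z\<in>roots_of f. \<beta> z \<in> algebraic_numbers \<and> u (\<beta> z - 0) < \<delta>) \<Longrightarrow>
      u (coeff (\<Prod>z\<in>roots_of f. [:- \<beta> z, 1:]) k - coeff (\<Prod>z\<in>roots_of f. [:- 0, 1:]) k) < \<epsilon>"
    using u.coeff_prod_continuous[OF finite_roots, of "\<lambda>_. 0" \<epsilon>] \<epsilon> csf_0[OF complex_subfield_algebraic] by auto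
  define e where "e = min \<delta> (1 / 2)"
  have e: "e > 0" "e \<le> \<delta>" "e \<le> 1 / 2" using \<delta>(1) by (auto simp: e_def)
  obtain t where t: "t \<in> \<F>" "v (t - 1) < e" "\<And>z. z \<in> roots_of f - S \<Longrightarrow> u (conj_map \<theta> z t) < e"
    using conj_approximation[OF csf_1[OF subfield_F] e(1)] by blast
  obtain h where h: "map_poly of_rat h = (\<Prod>z\<in>roots_of f. [:- conj_map \<theta> z t, 1:])"
    using charpoly_conj[OF t(1)] by blast
  have X: "(\<Prod>z\<in>roots_of f. [:- 0, 1:]) = (monom 1 n :: complex poly)"
    by (simp add: n_def monom_altdef)
  have small: "v (of_rat (coeff h k)) < \<epsilon>" if "k < n" for k
  proof -
    have "u (coeff (\<Prod>z\<in>roots_of f. [:- conj_map \<theta> z t, 1:]) k - coeff (\<Prod>z\<in>roots_of f. [:- 0, 1:]) k) < \<epsilon>"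
    proof (rule \<delta>(2), intro ballI conjI)
      fix z assume z: "z \<in> roots_of f"
      show "conj_map \<theta> z t \<in> algebraic_numbers" by (rule conj_algebraic[OF z t(1)])
      show "u (conj_map \<theta> z t - 0) < \<delta>" using t(3)[of z] z e \<open>S = {}\<close> by auto
    qed
    thus ?thesis unfolding X h[symmetric] using that by (simp add: v_of_rat)
  qed
  have deg: "degree h = n" "lead_coeff h = 1"
  proof -
    have "degree (map_poly of_rat h :: complex poly) = n"
      unfolding h n_def by (subst degree_prod_eq_sum_degree) auto
    thus "degree h = n" by simp
    have "lead_coeff (map_poly of_rat h :: complex poly) = 1" unfolding h by (rule monic_prod) auto
    thus "lead_coeff h = 1" by simp
  qed
  have "0 = (\<Sum>i<Suc n. of_rat (coeff h i) * t ^ i)"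
    using charpoly_root[OF t(1) h] rat_eval_altdef[of h "Suc n" t] deg by simp
  also have "\<dots> = (\<Sum>i<n. of_rat (coeff h i) * t ^ i) + t ^ n" using deg by simp
  finally have eq: "t ^ n = - (\<Sum>i<n. of_rat (coeff h i) * t ^ i)" by (simp add: eq_neg_iff_add_eq_0 add.commute)
  have "(\<Sum>i<n. of_rat (coeff h i) * t ^ i) \<in> \<F>"
    by (intro csf_sum[OF subfield_F] csf_mult[OF subfield_F] csf_power[OF subfield_F] csf_of_rat[OF subfield_F] t(1))
  from v.minus[OF this] have "v t ^ n = v (\<Sum>i<n. of_rat (coeff h i) * t ^ i)"
    unfolding eq[symmetric] by (simp add: v.power[OF t(1)])
  also have "\<dots> \<le> (\<Sum>i<n. v (of_rat (coeff h i) * t ^ i))"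
    by (rule v.sum_le) (auto intro!: csf_mult[OF subfield_F] csf_power[OF subfield_F] csf_of_rat[OF subfield_F] t(1))
  also have "\<dots> \<le> (\<Sum>i<n. \<epsilon> * 2 ^ n)"
  proof (rule sum_mono)
    fix i assume i: "i \<in> {..<n}"
    have "v t \<le> 2" using v.reverse_triangle[OF t(1) csf_1[OF subfield_F]] t(2) e by simp
    hence "v t ^ i \<le> 2 ^ i" using v.nonneg[OF t(1)] by (intro power_mono)
    also have "(2 :: real) ^ i \<le> 2 ^ n" using i by (intro power_increasing) auto
    finally have "v t ^ i \<le> 2 ^ n" .
    thus "v (of_rat (coeff h i) * t ^ i) \<le> \<epsilon> * 2 ^ n"
      using small[of i] i v.nonneg[OF csf_of_rat[OF subfield_F, of "coeff h i"]] v.nonneg[OF t(1)] \<epsilon>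
      by (subst v.mult) (auto intro!: mult_mono csf_power[OF subfield_F] csf_of_rat[OF subfield_F] t(1) simp: v.power t(1))
  qed
  also have "\<dots> = real n * \<epsilon> * 2 ^ n" by simp
  finally have 1: "v t ^ n \<le> real n * \<epsilon> * 2 ^ n" .
  have "v t \<ge> 1 / 2"
    using v.reverse_triangle[OF csf_1[OF subfield_F] t(1)] v.diff_commute[OF csf_1[OF subfield_F] t(1)] t(2) e by simp
  hence "(1 / 2) ^ n \<le> v t ^ n" by (intro power_mono) auto
  hence "2 ^ n * (1 / 2) ^ n \<le> 2 ^ n * (real n * \<epsilon> * 2 ^ n)" using 1 by (intro mult_left_mono) auto
  hence "1 \<le> real n * \<epsilon> * 4 ^ n" by (simp add: power_mult_distrib[symmetric] mult_ac)
  moreover have "real n * \<epsilon> * 4 ^ n < 1"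
  proof -
    have "real n * 4 ^ n + 1 > 0" by (simp add: add_nonneg_pos)
    thus ?thesis by (simp add: \<epsilon>_def pos_divide_less_eq)
  qed
  ultimately show False by simp
qed

text \<open>The factor of f that belongs to \<open>v\<close>. Its coefficients turn out to be limits
  of rationals, so it plays the part of the minimal polynomial of \<theta> over the completed
  rationals.\<close>

definition G :: "complex poly" where "G = (\<Prod>z\<in>S. [:- z, 1:])"

lemma S_sub: "S \<subseteq> roots_of f" by (auto simp: S_def)

text \<open>The characteristic polynomial of an element close to \<open>\<theta>\<close> for \<open>v\<close> and close to 0 for the other
  places is rational and close to \<open>G\<close> times a power of the variable.\<close>

lemma rational_approx_G:
  assumes \<epsilon>: "\<epsilon> > 0"
  obtains r :: "rat poly" where "\<And>i. i > card S \<Longrightarrow> coeff r i = 0" "coeff r (card S) = 1"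
    "\<And>i. u (of_rat (coeff r i) - coeff G i) < \<epsilon>"
proof -
  define \<alpha> where "\<alpha> = (\<lambda>z. if z \<in> S then z else 0 :: complex)"
  define n where "n = card (roots_of f) - card S"
  have \<alpha>: "\<alpha> z \<in> algebraic_numbers" if "z \<in> roots_of f" for z
    using that root_algebraic csf_0[OF complex_subfield_algebraic] by (auto simp: \<alpha>_def)
  have split: "(\<Prod>z\<in>roots_of f. [:- \<alpha> z, 1:]) = G * monom 1 n"
  proof -
    have "(\<Prod>z\<in>roots_of f. [:- \<alpha> z, 1:]) = (\<Prod>z\<in>roots_of f - S. [:- \<alpha> z, 1:]) * (\<Prod>z\<in>S. [:- \<alpha> z, 1:])"
      by (rule prod.subset_diff[OF S_sub finite_roots])
    also have "(\<Prod>z\<in>S. [:- \<alpha> z, 1:]) = G" unfolding G_def by (intro prod.cong) (auto simp: \<alpha>_def)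
    also have "(\<Prod>z\<in>roots_of f - S. [:- \<alpha> z, 1:]) = (\<Prod>z\<in>roots_of f - S. [:0, 1:])"
      by (intro prod.cong) (auto simp: \<alpha>_def)
    also have "\<dots> = monom 1 n" using card_Diff_subset[OF finite_S S_sub] by (simp add: n_def monom_altdef)
    finally show ?thesis by (simp add: mult.commute)
  qed
  obtain \<delta> where \<delta>: "\<delta> > 0" "\<And>\<beta> k. (\<forall>z\<in>roots_of f. \<beta> z \<in> algebraic_numbers \<and> u (\<beta> z - \<alpha> z) < \<delta>) \<Longrightarrow>
      u (coeff (\<Prod>z\<in>roots_of f. [:- \<beta> z, 1:]) k - coeff (\<Prod>z\<in>roots_of f. [:- \<alpha> z, 1:]) k) < \<epsilon>"
    using u.coeff_prod_continuous[OF finite_roots, of \<alpha> \<epsilon>] \<epsilon> \<alpha> by blast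
  obtain t where t: "t \<in> \<F>" "v (t - \<theta>) < \<delta>" "\<And>z. z \<in> roots_of f - S \<Longrightarrow> u (conj_map \<theta> z t) < \<delta>"
    using conj_approximation[OF theta_in_F \<delta>(1)] by blast
  obtain h where h: "map_poly of_rat h = (\<Prod>z\<in>roots_of f. [:- conj_map \<theta> z t, 1:])"
    using charpoly_conj[OF t(1)] by blast
  have near: "u (coeff (map_poly of_rat h) k - coeff (G * monom 1 n) k) < \<epsilon>" for k
    unfolding h split[symmetric]
  proof (rule \<delta>(2), intro ballI conjI)
    fix z assume z: "z \<in> roots_of f"
    show "conj_map \<theta> z t \<in> algebraic_numbers" by (rule conj_algebraic[OF z t(1)])
    show "u (conj_map \<theta> z t - \<alpha> z) < \<delta>"
    proof (cases "z \<in> S")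
      case True
      hence "conj_map \<theta> z t - \<alpha> z = conj_map \<theta> z (t - \<theta>)" using z t(1) theta_in_F by (simp add: \<alpha>_def conj_diff conj_theta)
      thus ?thesis using S_abs[OF True csf_diff[OF subfield_F t(1) theta_in_F]] t(2) by simp
    next
      case False thus ?thesis using t(3)[of z] z by (simp add: \<alpha>_def)
    qed
  qed
  have deg: "degree h = card (roots_of f)"
  proof -
    have "degree (map_poly of_rat h :: complex poly) = card (roots_of f)"
      unfolding h by (subst degree_prod_eq_sum_degree) auto
    thus ?thesis by simp
  qed
  have "lead_coeff (map_poly of_rat h :: complex poly) = 1" unfolding h by (rule monic_prod) auto
  hence lead: "lead_coeff h = 1" by simp
  have card: "card (roots_of f) = card S + n" using card_mono[OF finite_roots S_sub] by (simp add: n_def)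
  \<comment> \<open>\<open>h\<close> is close to G X^n, with n the number of roots outside
    \<open>S\<close>; shifting the index by n divides by X^n. Nothing is lost at the top, since h
    has degree \<open>card S + n\<close>.\<close>
  define r where "r = (\<Sum>i\<le>card S. monom (coeff h (i + n)) i)"
  have cr: "coeff r i = (if i \<le> card S then coeff h (i + n) else 0)" for i by (auto simp: r_def coeff_sum)
  have cr': "coeff r i = coeff h (i + n)" for i using deg card by (auto simp: cr coeff_eq_0)
  show ?thesis
  proof (rule that[of r])
    show "coeff r (card S) = 1" using lead deg card by (simp add: cr)
    show "coeff r i = 0" if "i > card S" for i using that by (simp add: cr)
    show "u (of_rat (coeff r i) - coeff G i) < \<epsilon>" for i
      using near[of "i + n"] by (simp add: cr' mult.commute[of G] coeff_monom_mult)
  qed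
qed

section \<open>Density of the polynomials of low degree in the generator\<close>

lemma card_S_pos: "card S > 0" using S_nonempty finite_S by (simp add: card_gt_0_iff)

text \<open>The closure, for \<open>v\<close> and inside the field, of the rational span of the
  powers of \<theta> below \<open>card S\<close>. The aim is \<open>F_subset_W\<close>, the spanning
  half of the computation of the local degree.\<close>

definition W where "W = {a \<in> \<F>. \<forall>\<epsilon>>0. \<exists>c. degree c < card S \<and> v (a - rat_eval c \<theta>) < \<epsilon>}"

lemma rat_eval_in_F: "rat_eval c \<theta> \<in> \<F>" by (auto simp: F_iff)

lemma W_closure:
  assumes a: "a \<in> \<F>" and "\<And>\<epsilon>. \<epsilon> > 0 \<Longrightarrow> \<exists>w\<in>W. v (a - w) < \<epsilon>" shows "a \<in> W"
  unfolding W_def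
proof (intro CollectI conjI a allI impI)
  fix \<epsilon> :: real assume "\<epsilon> > 0"
  hence e: "\<epsilon> / 2 > 0" by simp
  obtain w where w: "w \<in> W" "v (a - w) < \<epsilon> / 2" using assms(2)[OF e] by blast
  obtain c where c: "degree c < card S" "v (w - rat_eval c \<theta>) < \<epsilon> / 2" using w(1) e unfolding W_def by blast
  have "v (a - rat_eval c \<theta>) < \<epsilon>"
    using v.diff_triangle[OF a _ rat_eval_in_F, of w c] w c by (auto simp: W_def)
  thus "\<exists>c. degree c < card S \<and> v (a - rat_eval c \<theta>) < \<epsilon>" using c(1) by blast
qed

lemma W_add:
  assumes "a \<in> W" "c \<in> W" shows "a + c \<in> W"
  unfolding W_def
proof (intro CollectI conjI allI impI)
  have F: "a \<in> \<F>" "c \<in> \<F>" using assms by (auto simp: W_def)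
  show "a + c \<in> \<F>" by (rule csf_add[OF subfield_F F])
  fix \<epsilon> :: real assume "\<epsilon> > 0"
  hence e: "\<epsilon> / 2 > 0" by simp
  obtain p q where pq: "degree p < card S" "v (a - rat_eval p \<theta>) < \<epsilon> / 2" "degree q < card S" "v (c - rat_eval q \<theta>) < \<epsilon> / 2"
    using assms e unfolding W_def by blast
  have "v ((a - rat_eval p \<theta>) + (c - rat_eval q \<theta>)) < \<epsilon>"
    using v.triangle[of "a - rat_eval p \<theta>" "c - rat_eval q \<theta>"] pq
      csf_diff[OF subfield_F F(1) rat_eval_in_F] csf_diff[OF subfield_F F(2) rat_eval_in_F] by fastforce
  moreover have "(a - rat_eval p \<theta>) + (c - rat_eval q \<theta>) = a + c - rat_eval (p + q) \<theta>" by simp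
  moreover have "degree (p + q) < card S" using pq by (simp add: degree_add_less)
  ultimately show "\<exists>p. degree p < card S \<and> v (a + c - rat_eval p \<theta>) < \<epsilon>" by metis
qed

lemma rat_eval_in_W: "degree c < card S \<Longrightarrow> rat_eval c \<theta> \<in> W"
  unfolding W_def using rat_eval_in_F by (auto intro!: exI[of _ c])

lemma W_smult: assumes "a \<in> W" shows "of_rat k * a \<in> W"
proof (rule W_closure)
  have a: "a \<in> \<F>" using assms by (simp add: W_def)
  show "of_rat k * a \<in> \<F>" using a csf_mult[OF subfield_F csf_of_rat[OF subfield_F]] by blast
  fix \<epsilon> :: real assume e: "\<epsilon> > 0"
  have vk: "v (of_rat k) \<ge> 0" by (rule v.nonneg[OF csf_of_rat[OF subfield_F]])
  have "\<epsilon> / (v (of_rat k) + 1) > 0" using e vk by simp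
  then obtain c where c: "degree c < card S" "v (a - rat_eval c \<theta>) < \<epsilon> / (v (of_rat k) + 1)"
    using assms unfolding W_def by blast
  have "v (of_rat k * a - rat_eval (smult k c) \<theta>) = v (of_rat k * (a - rat_eval c \<theta>))" by (simp add: algebra_simps)
  also have "\<dots> = v (of_rat k) * v (a - rat_eval c \<theta>)"
    by (rule v.mult[OF csf_of_rat[OF subfield_F] csf_diff[OF subfield_F a rat_eval_in_F]])
  also have "\<dots> \<le> v (of_rat k) * (\<epsilon> / (v (of_rat k) + 1))" using c vk by (intro mult_left_mono) auto
  also have "\<dots> < \<epsilon>" using e vk by (simp add: field_simps)
  finally show "\<exists>w\<in>W. v (of_rat k * a - w) < \<epsilon>"
    using rat_eval_in_W[of "smult k c"] c(1) by (intro bexI[of _ "rat_eval (smult k c) \<theta>"]) (auto intro: le_less_trans[OF degree_smult_le])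
qed

text \<open>For a rational r near G and z in \<open>S\<close>, the value r(z) is small because G(z)
  = 0, and its size is that of r(\<theta>) for \<open>v\<close>. As r is monic of degree
  \<open>card S\<close>, this power of \<theta> is close to a combination of lower ones.\<close>

lemma theta_power_in_W: "\<theta> ^ card S \<in> W"
proof (rule W_closure)
  show "\<theta> ^ card S \<in> \<F>" by (rule csf_power[OF subfield_F theta_in_F])
  fix \<epsilon> :: real assume e: "\<epsilon> > 0"
  obtain z where z: "z \<in> S" using S_nonempty by blast
  have zalg: "z \<in> algebraic_numbers" using z root_algebraic by (auto simp: S_def)
  define B where "B = (\<Sum>i\<le>card S. u z ^ i)"
  have B: "B \<ge> 0" unfolding B_def using u.nonneg[OF zalg] by (auto intro!: sum_nonneg)
  have "\<epsilon> / (B + 1) > 0" using e B by simp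
  then obtain r :: "rat poly" where r: "\<And>i. i > card S \<Longrightarrow> coeff r i = 0" "coeff r (card S) = 1"
    "\<And>i. u (of_rat (coeff r i) - coeff G i) < \<epsilon> / (B + 1)" using rational_approx_G by blast
  define c where "c = monom 1 (card S) - r"
  have "coeff c i = 0" if "i \<ge> card S" for i using r(1)[of i] r(2) that by (auto simp: c_def)
  hence degc: "degree c < card S" using card_S_pos by (metis degree_0 leading_coeff_0_iff not_le)
  have degG: "degree G = card S" unfolding G_def by (subst degree_prod_eq_sum_degree) auto
  have degr: "degree r \<le> card S" using r(1) by (intro degree_le) auto
  have Galg: "coeff G i \<in> algebraic_numbers" for i
  proof -
    have "coeffs_in algebraic_numbers (\<Prod>z\<in>A. [:- z, 1:])" if "finite A" "A \<subseteq> S" for A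
      using that
    proof (induction A rule: finite_induct)
      case (insert w A)
      have "w \<in> algebraic_numbers" using insert root_algebraic by (auto simp: S_def)
      hence "coeffs_in algebraic_numbers [:- w, 1:]"
        using csf_0[OF complex_subfield_algebraic] csf_1[OF complex_subfield_algebraic]
        by (auto simp: coeffs_in_def coeff_pCons split: nat.splits)
      thus ?case using insert coeffs_in_mult[OF complex_subring_algebraic] by (simp del: mult_pCons_left)
    qed (use csf_0[OF complex_subfield_algebraic] csf_1[OF complex_subfield_algebraic] in \<open>auto simp: coeffs_in_def coeff_1\<close>)
    thus ?thesis using finite_S unfolding G_def coeffs_in_def by blast
  qed
  have ratalg: "of_rat q \<in> algebraic_numbers" for q by (rule csf_of_rat[OF complex_subfield_algebraic])
  have Gz: "poly G z = 0" unfolding G_def poly_prod using z finite_S by (auto intro!: prod_zero)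
  have "rat_eval r z = (\<Sum>i\<le>card S. of_rat (coeff r i) * z ^ i) - (\<Sum>i\<le>card S. coeff G i * z ^ i)"
    using rat_eval_altdef[of r "Suc (card S)" z] degr Gz degG by (simp add: poly_altdef lessThan_Suc_atMost)
  also have "\<dots> = (\<Sum>i\<le>card S. (of_rat (coeff r i) - coeff G i) * z ^ i)" by (simp add: sum_subtractf algebra_simps)
  finally have eq: "rat_eval r z = (\<Sum>i\<le>card S. (of_rat (coeff r i) - coeff G i) * z ^ i)" .
  have "\<theta> ^ card S - rat_eval c \<theta> = rat_eval r \<theta>" by (simp add: c_def)
  hence "v (\<theta> ^ card S - rat_eval c \<theta>) = u (rat_eval r z)"
    using S_abs[OF z rat_eval_in_F, of r] conj_rat_eval[of z r] z by (auto simp: S_def)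
  also have "\<dots> \<le> (\<Sum>i\<le>card S. u ((of_rat (coeff r i) - coeff G i) * z ^ i))"
    unfolding eq by (intro u.sum_le csf_mult[OF complex_subfield_algebraic] csf_diff[OF complex_subfield_algebraic]
        csf_power[OF complex_subfield_algebraic] ratalg Galg zalg)
  also have "\<dots> = (\<Sum>i\<le>card S. u (of_rat (coeff r i) - coeff G i) * u z ^ i)"
    by (intro sum.cong refl) (simp add: u.mult[OF csf_diff[OF complex_subfield_algebraic ratalg Galg] csf_power[OF complex_subfield_algebraic zalg]] u.power[OF zalg])
  also have "\<dots> \<le> (\<Sum>i\<le>card S. \<epsilon> / (B + 1) * u z ^ i)"
    using r(3) u.nonneg[OF zalg] by (intro sum_mono mult_right_mono) (auto intro: less_imp_le)
  also have "\<dots> = \<epsilon> / (B + 1) * B" by (simp add: B_def sum_distrib_left)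
  also have "\<dots> < \<epsilon>" using e B by (simp add: field_simps)
  finally show "\<exists>w\<in>W. v (\<theta> ^ card S - w) < \<epsilon>" using rat_eval_in_W[OF degc] by blast
qed

lemma theta_mult_in_W: assumes "a \<in> W" shows "\<theta> * a \<in> W"
proof (rule W_closure)
  have a: "a \<in> \<F>" using assms by (simp add: W_def)
  show "\<theta> * a \<in> \<F>" by (rule csf_mult[OF subfield_F theta_in_F a])
  fix \<epsilon> :: real assume e: "\<epsilon> > 0"
  have vk: "v \<theta> \<ge> 0" by (rule v.nonneg[OF theta_in_F])
  have "\<epsilon> / (v \<theta> + 1) > 0" using e vk by simp
  then obtain c where c: "degree c < card S" "v (a - rat_eval c \<theta>) < \<epsilon> / (v \<theta> + 1)"
    using assms unfolding W_def by blast
  have "v (\<theta> * a - \<theta> * rat_eval c \<theta>) = v \<theta> * v (a - rat_eval c \<theta>)"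
    using v.mult[OF theta_in_F csf_diff[OF subfield_F a rat_eval_in_F], of c] by (simp add: algebra_simps)
  also have "\<dots> \<le> v \<theta> * (\<epsilon> / (v \<theta> + 1))" using c vk by (intro mult_left_mono) auto
  also have "\<dots> < \<epsilon>" using e vk by (simp add: field_simps)
  finally have 1: "v (\<theta> * a - \<theta> * rat_eval c \<theta>) < \<epsilon>" .
  \<comment> \<open>Multiplication by \<theta> pushes only the top term out of the degree range, and
    that term is covered by \<open>theta_power_in_W\<close>.\<close>
  define k where "k = coeff c (card S - 1)"
  define c' where "c' = pCons 0 c - monom k (card S)"
  have "coeff c' i = 0" if "i \<ge> card S" for i
    using that c(1) card_S_pos by (auto simp: c'_def k_def coeff_pCons coeff_eq_0 split: nat.splits)
  hence "degree c' < card S" using card_S_pos by (metis degree_0 leading_coeff_0_iff not_le)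
  moreover have "\<theta> * rat_eval c \<theta> = of_rat k * \<theta> ^ card S + rat_eval c' \<theta>" by (simp add: c'_def)
  ultimately have "\<theta> * rat_eval c \<theta> \<in> W" using W_add W_smult theta_power_in_W rat_eval_in_W by metis
  thus "\<exists>w\<in>W. v (\<theta> * a - w) < \<epsilon>" using 1 by blast
qed

lemma F_subset_W: "\<F> \<subseteq> W"
proof
  fix a assume "a \<in> \<F>"
  then obtain q where "a = rat_eval q \<theta>" by (auto simp: F_iff)
  moreover have "rat_eval q \<theta> \<in> W"
  proof (induction q)
    case 0 thus ?case using rat_eval_in_W[of 0] card_S_pos by simp
  next
    case (pCons c q)
    thus ?case using W_add[OF rat_eval_in_W[of "[:c:]"] theta_mult_in_W] card_S_pos by simp
  qed
  ultimately show "a \<in> W" by simp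
qed

text \<open>Lagrange interpolation at the conjugates in \<open>S\<close>.\<close>

lemma coeff_bound:
  "\<exists>M. \<forall>c i. degree c < card S \<longrightarrow> i < card S \<longrightarrow> v (of_rat (coeff c i)) \<le> M * v (rat_eval c \<theta>)"
proof -
  define L where "L = (\<lambda>z. smult (inverse (\<Prod>w\<in>S - {z}. z - w)) (\<Prod>w\<in>S - {z}. [:- w, 1:]))"
  have alg: "z \<in> S \<Longrightarrow> z \<in> algebraic_numbers" for z using root_algebraic by (auto simp: S_def)
  have Lalg: "coeff (L z) i \<in> algebraic_numbers" if z: "z \<in> S" for z i
  proof -
    have "coeffs_in algebraic_numbers (\<Prod>z\<in>A. [:- z, 1:])" if "finite A" "A \<subseteq> S" for A
      using that
    proof (induction A rule: finite_induct)
      case (insert w A)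
      hence "coeffs_in algebraic_numbers [:- w, 1:]"
        using csf_0[OF complex_subfield_algebraic] csf_1[OF complex_subfield_algebraic] alg[of w]
        by (auto simp: coeffs_in_def coeff_pCons split: nat.splits)
      thus ?case using insert coeffs_in_mult[OF complex_subring_algebraic] by (simp del: mult_pCons_left)
    qed (use csf_0[OF complex_subfield_algebraic] csf_1[OF complex_subfield_algebraic] in \<open>auto simp: coeffs_in_def coeff_1\<close>)
    hence "coeff (\<Prod>w\<in>S - {z}. [:- w, 1:]) i \<in> algebraic_numbers" using finite_S unfolding coeffs_in_def by blast
    thus ?thesis unfolding L_def coeff_smult
      by (intro csf_mult[OF complex_subfield_algebraic] csf_inverse[OF complex_subfield_algebraic]
          csf_prod[OF complex_subfield_algebraic] csf_diff[OF complex_subfield_algebraic]) (use alg z in auto)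
  qed
  have degL: "degree (L z) \<le> card S - 1" if "z \<in> S" for z
  proof -
    have "degree (L z) \<le> degree (\<Prod>w\<in>S - {z}. [:- w, 1:])" unfolding L_def by (rule degree_smult_le)
    also have "\<dots> = card (S - {z})" by (subst degree_prod_eq_sum_degree) auto
    finally show ?thesis using that finite_S by simp
  qed
  have evalL: "poly (L z) w = (if w = z then 1 else 0)" if "z \<in> S" "w \<in> S" for z w
    using that finite_S by (auto simp: L_def poly_prod prod_zero_iff)
  have interp: "p = (\<Sum>z\<in>S. smult (poly p z) (L z))" if "degree p < card S" for p
  proof (rule ccontr)
    define d where "d = p - (\<Sum>z\<in>S. smult (poly p z) (L z))"
    assume "p \<noteq> (\<Sum>z\<in>S. smult (poly p z) (L z))"
    hence "d \<noteq> 0" by (simp add: d_def)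
    have "degree (\<Sum>z\<in>S. smult (poly p z) (L z)) \<le> card S - 1"
      by (intro degree_sum_le finite_S order_trans[OF degree_smult_le degL])
    hence "degree d < card S" unfolding d_def using that card_S_pos by (intro degree_diff_less) auto
    moreover have "poly d w = 0" if "w \<in> S" for w
    proof -
      have "(\<Sum>z\<in>S. poly p z * poly (L z) w) = (\<Sum>z\<in>S. if z = w then poly p z else 0)"
        by (intro sum.cong) (use evalL that in auto)
      also have "\<dots> = poly p w" using that finite_S by simp
      finally show ?thesis by (simp add: d_def poly_sum)
    qed
    hence "card S \<le> card {x. poly d x = 0}" using \<open>d \<noteq> 0\<close> by (intro card_mono poly_roots_finite) auto
    ultimately show False using card_poly_roots_bound[OF \<open>d \<noteq> 0\<close>] by simp
  qed
  define M where "M = (\<Sum>i<card S. \<Sum>z\<in>S. u (coeff (L z) i))"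
  show ?thesis
  proof (intro exI[of _ M] allI impI)
    fix c :: "rat poly" and i assume c: "degree c < card S" and i: "i < card S"
    define p :: "complex poly" where "p = map_poly of_rat c"
    have dp: "degree p < card S" using c by (simp add: p_def)
    have pz: "poly p z = conj_map \<theta> z (rat_eval c \<theta>)" if "z \<in> S" for z
      using that conj_rat_eval[of z c] by (auto simp: p_def rat_eval_def S_def)
    have pzalg: "poly p z \<in> algebraic_numbers" if "z \<in> S" for z
      using pz[OF that] conj_algebraic[of z, OF _ rat_eval_in_F] that by (auto simp: S_def)
    have "of_rat (coeff c i) = coeff p i" by (simp add: p_def)
    also have "\<dots> = (\<Sum>z\<in>S. poly p z * coeff (L z) i)" by (subst interp[OF dp]) (simp add: coeff_sum)
    finally have "v (of_rat (coeff c i)) = u (\<Sum>z\<in>S. poly p z * coeff (L z) i)" using v_of_rat[of "coeff c i"] by simp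
    also have "\<dots> \<le> (\<Sum>z\<in>S. u (poly p z * coeff (L z) i))"
      by (rule u.sum_le, rule csf_mult[OF complex_subfield_algebraic pzalg Lalg])
    \<comment> \<open>All embeddings in \<open>S\<close> induce \<open>v\<close>, so the
      interpolation values all have the size of c(\<theta>), and what remains are constants
      independent of c.\<close>
    also have "\<dots> = (\<Sum>z\<in>S. v (rat_eval c \<theta>) * u (coeff (L z) i))"
    proof (intro sum.cong refl)
      fix z assume z: "z \<in> S"
      show "u (poly p z * coeff (L z) i) = v (rat_eval c \<theta>) * u (coeff (L z) i)"
        using u.mult[OF pzalg[OF z] Lalg[OF z]] pz[OF z] S_abs[OF z rat_eval_in_F] by simp
    qed
    also have "\<dots> = (\<Sum>z\<in>S. u (coeff (L z) i)) * v (rat_eval c \<theta>)" by (simp add: sum_distrib_left mult.commute)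
    also have "\<dots> \<le> M * v (rat_eval c \<theta>)" unfolding M_def
      using i v.nonneg[OF rat_eval_in_F] u.nonneg[OF Lalg]
      by (intro mult_right_mono member_le_sum[of i "{..<card S}" "\<lambda>i. \<Sum>z\<in>S. u (coeff (L z) i)"]) (auto intro!: sum_nonneg)
    finally show "v (of_rat (coeff c i)) \<le> M * v (rat_eval c \<theta>)" .
  qed
qed

end

section \<open>The completion as Cauchy sequences modulo null sequences\<close>

locale completed_field = absolute_value
begin

lemma cauchy_seqsD: "s \<in> cauchy_seqs K v \<Longrightarrow> s k \<in> K"
  and cauchy_seqsD': "s \<in> cauchy_seqs K v \<Longrightarrow> e > 0 \<Longrightarrow> \<exists>N. \<forall>k\<ge>N. \<forall>l\<ge>N. v (s k - s l) < e"
  by (auto simp: cauchy_seqs_def)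

lemma cauchy_seqs_bounded:
  assumes s: "s \<in> cauchy_seqs K v" obtains B where "B > 0" "\<And>k. v (s k) \<le> B"
proof -
  obtain N where N: "\<And>k l. k \<ge> N \<Longrightarrow> l \<ge> N \<Longrightarrow> v (s k - s l) < 1" using cauchy_seqsD'[OF s, of 1] by auto
  define B where "B = (\<Sum>k\<le>N. v (s k)) + 1"
  have nn: "0 \<le> v (s k)" for k by (rule nonneg[OF cauchy_seqsD[OF s]])
  have "v (s k) \<le> B" for k
  proof (cases "k \<le> N")
    case True
    hence "v (s k) \<le> (\<Sum>k\<le>N. v (s k))" using nn by (intro member_le_sum) auto
    thus ?thesis by (simp add: B_def)
  next
    case False
    have "v (s k) \<le> v (s N) + v (s k - s N)"
      using reverse_triangle[OF cauchy_seqsD[OF s, of k] cauchy_seqsD[OF s, of N]] by simp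
    also have "v (s k - s N) < 1" using N False by simp
    also have "v (s N) \<le> (\<Sum>k\<le>N. v (s k))" using nn by (intro member_le_sum) auto
    finally show ?thesis by (simp add: B_def)
  qed
  moreover have "B > 0" unfolding B_def using nn by (intro add_nonneg_pos sum_nonneg) auto
  ultimately show ?thesis using that by blast
qed

lemma cauchy_seqs_const: "c \<in> K \<Longrightarrow> (\<lambda>_. c) \<in> cauchy_seqs K v"
  by (auto simp: cauchy_seqs_def)

lemma cauchy_seqs_add:
  assumes s: "s \<in> cauchy_seqs K v" and t: "t \<in> cauchy_seqs K v" shows "(\<lambda>k. s k + t k) \<in> cauchy_seqs K v"
  unfolding cauchy_seqs_def
proof (intro CollectI conjI allI impI)
  note sK = cauchy_seqsD[OF s] and tK = cauchy_seqsD[OF t]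
  show "s k + t k \<in> K" for k by (intro csf_add[OF K] sK tK)
  fix e :: real assume "e > 0"
  hence e: "e / 2 > 0" by simp
  obtain N M where NM: "\<forall>k\<ge>N. \<forall>l\<ge>N. v (s k - s l) < e / 2" "\<forall>k\<ge>M. \<forall>l\<ge>M. v (t k - t l) < e / 2"
    using cauchy_seqsD'[OF s e] cauchy_seqsD'[OF t e] by blast
  have "v (s k + t k - (s l + t l)) < e" if "k \<ge> max N M" "l \<ge> max N M" for k l
  proof -
    have "v ((s k - s l) + (t k - t l)) \<le> v (s k - s l) + v (t k - t l)"
      by (intro triangle csf_diff[OF K] sK tK)
    also have "\<dots> < e / 2 + e / 2" using NM that by (intro add_strict_mono) auto
    finally show ?thesis by (simp add: algebra_simps)
  qed
  thus "\<exists>N. \<forall>k\<ge>N. \<forall>l\<ge>N. v (s k + t k - (s l + t l)) < e" by blast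
qed

lemma cauchy_seqs_mult:
  assumes s: "s \<in> cauchy_seqs K v" and t: "t \<in> cauchy_seqs K v" shows "(\<lambda>k. s k * t k) \<in> cauchy_seqs K v"
  unfolding cauchy_seqs_def
proof (intro CollectI conjI allI impI)
  note sK = cauchy_seqsD[OF s] and tK = cauchy_seqsD[OF t]
  show "s k * t k \<in> K" for k by (intro csf_mult[OF K] sK tK)
  fix e :: real assume e: "e > 0"
  obtain B where B: "B > 0" "\<And>k. v (s k) \<le> B" using cauchy_seqs_bounded[OF s] by blast
  obtain C where C: "C > 0" "\<And>k. v (t k) \<le> C" using cauchy_seqs_bounded[OF t] by blast
  have eC: "e / (2 * C) > 0" and eB: "e / (2 * B) > 0" using e B C by simp_all
  obtain N M where NM: "\<forall>k\<ge>N. \<forall>l\<ge>N. v (s k - s l) < e / (2 * C)" "\<forall>k\<ge>M. \<forall>l\<ge>M. v (t k - t l) < e / (2 * B)"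
    using cauchy_seqsD'[OF s eC] cauchy_seqsD'[OF t eB] by blast
  have "v (s k * t k - s l * t l) < e" if kl: "k \<ge> max N M" "l \<ge> max N M" for k l
  proof -
    have "s k * t k - s l * t l = s k * (t k - t l) + t l * (s k - s l)" by (simp add: algebra_simps)
    hence "v (s k * t k - s l * t l) \<le> v (s k * (t k - t l)) + v (t l * (s k - s l))"
      using triangle[OF csf_mult[OF K sK csf_diff[OF K tK tK]] csf_mult[OF K tK csf_diff[OF K sK sK]]] by metis
    also have "\<dots> = v (s k) * v (t k - t l) + v (t l) * v (s k - s l)"
      using mult[OF sK csf_diff[OF K tK tK]] mult[OF tK csf_diff[OF K sK sK]] by metis
    also have "\<dots> < B * (e / (2 * B)) + C * (e / (2 * C))"
    proof (rule add_le_less_mono)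
      show "v (s k) * v (t k - t l) \<le> B * (e / (2 * B))"
        using B NM(2) kl by (intro mult_mono nonneg csf_diff[OF K] tK) (auto intro: less_imp_le)
      have "v (t l) * v (s k - s l) \<le> C * v (s k - s l)" by (intro mult_right_mono C nonneg csf_diff[OF K] sK)
      also have "\<dots> < C * (e / (2 * C))" using NM(1) kl C(1) by (intro mult_strict_left_mono) auto
      finally show "v (t l) * v (s k - s l) < C * (e / (2 * C))" .
    qed
    also have "\<dots> = e" using B C by simp
    finally show ?thesis .
  qed
  thus "\<exists>N. \<forall>k\<ge>N. \<forall>l\<ge>N. v (s k * t k - s l * t l) < e" by blast
qed

lemma cauchy_seqs_minus: "s \<in> cauchy_seqs K v \<Longrightarrow> (\<lambda>k. - s k) \<in> cauchy_seqs K v"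
  using cauchy_seqs_mult[OF cauchy_seqs_const[OF csf_minus[OF K csf_1[OF K]]]] by simp

lemma cring_cauchy_ring: "cring (cauchy_ring K v)"
proof (rule cringI)
  show "abelian_group (cauchy_ring K v)"
  proof (rule abelian_groupI)
    fix s assume s: "s \<in> carrier (cauchy_ring K v)"
    thus "\<exists>t\<in>carrier (cauchy_ring K v). t \<oplus>\<^bsub>cauchy_ring K v\<^esub> s = \<zero>\<^bsub>cauchy_ring K v\<^esub>"
      by (intro bexI[of _ "\<lambda>k. - s k"]) (auto simp: cauchy_ring_def cauchy_seqs_minus)
  qed (auto simp: cauchy_ring_def cauchy_seqs_add cauchy_seqs_const csf_0[OF K] algebra_simps)
  show "comm_monoid (cauchy_ring K v)"
    by (rule comm_monoidI) (auto simp: cauchy_ring_def cauchy_seqs_mult cauchy_seqs_const csf_1[OF K] mult_ac)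
qed (auto simp: cauchy_ring_def algebra_simps)

lemma cauchy_ring_minus:
  assumes "s \<in> cauchy_seqs K v" shows "\<ominus>\<^bsub>cauchy_ring K v\<^esub> s = (\<lambda>k. - s k)"
  using abelian_group.minus_equality[OF ring.is_abelian_group[OF cring.axioms(1), OF cring_cauchy_ring], of "\<lambda>k. - s k" s]
    assms cauchy_seqs_minus[OF assms] by (auto simp: cauchy_ring_def)

lemma null_seqsI: "s \<in> cauchy_seqs K v \<Longrightarrow> (\<lambda>k. v (s k)) \<longlonglongrightarrow> 0 \<Longrightarrow> s \<in> null_seqs K v"
  and null_seqsD: "s \<in> null_seqs K v \<Longrightarrow> s \<in> cauchy_seqs K v" "s \<in> null_seqs K v \<Longrightarrow> (\<lambda>k. v (s k)) \<longlonglongrightarrow> 0"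
  by (auto simp: null_seqs_def)

lemma null_seqs_squeeze:
  assumes "s \<in> cauchy_seqs K v" "\<And>k. v (s k) \<le> g k" "g \<longlonglongrightarrow> 0" shows "s \<in> null_seqs K v"
  by (rule null_seqsI[OF assms(1)], rule tendsto_sandwich[OF _ _ tendsto_const assms(3)])
    (use assms(2) nonneg[OF cauchy_seqsD[OF assms(1)]] in auto)

lemma null_seqs_add:
  assumes "s \<in> null_seqs K v" "t \<in> null_seqs K v" shows "(\<lambda>k. s k + t k) \<in> null_seqs K v"
proof (rule null_seqs_squeeze)
  note st = null_seqsD(1)[OF assms(1)] null_seqsD(1)[OF assms(2)]
  show "(\<lambda>k. s k + t k) \<in> cauchy_seqs K v" by (rule cauchy_seqs_add[OF st])
  show "v (s k + t k) \<le> v (s k) + v (t k)" for k by (intro triangle cauchy_seqsD st)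
  show "(\<lambda>k. v (s k) + v (t k)) \<longlonglongrightarrow> 0" using tendsto_add[OF null_seqsD(2)[OF assms(1)] null_seqsD(2)[OF assms(2)]] by simp
qed

lemma null_seqs_mult:
  assumes s: "s \<in> null_seqs K v" and t: "t \<in> cauchy_seqs K v" shows "(\<lambda>k. t k * s k) \<in> null_seqs K v"
proof -
  obtain B where B: "B > 0" "\<And>k. v (t k) \<le> B" using cauchy_seqs_bounded[OF t] by blast
  note sc = null_seqsD(1)[OF s]
  show ?thesis
  proof (rule null_seqs_squeeze)
    show "(\<lambda>k. t k * s k) \<in> cauchy_seqs K v" by (rule cauchy_seqs_mult[OF t sc])
    show "v (t k * s k) \<le> B * v (s k)" for k
      using B mult[OF cauchy_seqsD[OF t] cauchy_seqsD[OF sc]] nonneg[OF cauchy_seqsD[OF sc]] by (simp add: mult_right_mono)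
    show "(\<lambda>k. B * v (s k)) \<longlonglongrightarrow> 0" using tendsto_mult[OF tendsto_const null_seqsD(2)[OF s], of B] by simp
  qed
qed

lemma ideal_null_seqs: "ideal (null_seqs K v) (cauchy_ring K v)"
proof (rule idealI)
  interpret R: cring "cauchy_ring K v" by (rule cring_cauchy_ring)
  show "ring (cauchy_ring K v)" by (rule R.ring_axioms)
  show "subgroup (null_seqs K v) (add_monoid (cauchy_ring K v))"
  proof (rule R.add.subgroupI)
    show "null_seqs K v \<subseteq> carrier (cauchy_ring K v)" using null_seqsD by (auto simp: cauchy_ring_def)
    show "null_seqs K v \<noteq> {}"
      using null_seqsI[OF cauchy_seqs_const[OF csf_0[OF K]]] by auto
    fix s assume s: "s \<in> null_seqs K v"
    have "(\<lambda>k. - s k) \<in> null_seqs K v"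
      using null_seqs_mult[OF s cauchy_seqs_const[OF csf_minus[OF K csf_1[OF K]]]] by simp
    moreover have "\<ominus>\<^bsub>cauchy_ring K v\<^esub> s = (\<lambda>k. - s k)"
      by (rule cauchy_ring_minus[OF null_seqsD(1)[OF s]])
    ultimately show "\<ominus>\<^bsub>cauchy_ring K v\<^esub> s \<in> null_seqs K v" by simp
  next
    fix s t assume "s \<in> null_seqs K v" "t \<in> null_seqs K v"
    thus "s \<oplus>\<^bsub>cauchy_ring K v\<^esub> t \<in> null_seqs K v" using null_seqs_add by (simp add: cauchy_ring_def)
  qed
  fix s t assume s: "s \<in> null_seqs K v" and "t \<in> carrier (cauchy_ring K v)"
  hence t: "t \<in> cauchy_seqs K v" by (simp add: cauchy_ring_def)
  show "t \<otimes>\<^bsub>cauchy_ring K v\<^esub> s \<in> null_seqs K v" "s \<otimes>\<^bsub>cauchy_ring K v\<^esub> t \<in> null_seqs K v"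
    using null_seqs_mult[OF s t] by (simp_all add: cauchy_ring_def mult.commute)
qed

sublocale null: ideal "null_seqs K v" "cauchy_ring K v" by (rule ideal_null_seqs)

abbreviation cls :: "(nat \<Rightarrow> complex) \<Rightarrow> (nat \<Rightarrow> complex) set" where
  "cls s \<equiv> null_seqs K v +>\<^bsub>cauchy_ring K v\<^esub> s"

lemma cring_completion: "cring (completion K v)"
  unfolding completion_def by (rule null.quotient_is_cring[OF cring_cauchy_ring])

lemma carrier_completion: "carrier (completion K v) = cls ` cauchy_seqs K v"
  by (auto simp: completion_def FactRing_def A_RCOSETS_def' cauchy_ring_def)

lemma cls_add: "s \<in> cauchy_seqs K v \<Longrightarrow> t \<in> cauchy_seqs K v \<Longrightarrow>
    cls s \<oplus>\<^bsub>completion K v\<^esub> cls t = cls (\<lambda>k. s k + t k)"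
  using null.a_rcos_sum[of s t] by (simp add: completion_def FactRing_def cauchy_ring_def)

lemma cls_mult: "s \<in> cauchy_seqs K v \<Longrightarrow> t \<in> cauchy_seqs K v \<Longrightarrow>
    cls s \<otimes>\<^bsub>completion K v\<^esub> cls t = cls (\<lambda>k. s k * t k)"
  using null.rcoset_mult_add[of s t] by (simp add: completion_def FactRing_def cauchy_ring_def)

lemma cls_one: "\<one>\<^bsub>completion K v\<^esub> = cls (\<lambda>_. 1)"
  by (simp add: completion_def FactRing_def cauchy_ring_def)

lemma null_seqs_zero: "(\<lambda>_. 0) \<in> null_seqs K v"
  by (rule null_seqsI[OF cauchy_seqs_const[OF csf_0[OF K]]]) simp

lemma cls_zero: "\<zero>\<^bsub>completion K v\<^esub> = cls (\<lambda>_. 0)"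
  using null.a_rcos_zero[OF null.ideal_axioms null_seqs_zero] by (simp add: completion_def FactRing_def)

lemma cls_eq_iff:
  assumes s: "s \<in> cauchy_seqs K v" and t: "t \<in> cauchy_seqs K v"
  shows "cls s = cls t \<longleftrightarrow> (\<lambda>k. s k - t k) \<in> null_seqs K v"
proof -
  note mt = cauchy_ring_minus[OF t]
  have "s \<ominus>\<^bsub>cauchy_ring K v\<^esub> t = (\<lambda>k. s k - t k)"
    unfolding a_minus_def mt by (simp add: cauchy_ring_def)
  thus ?thesis using null.quotient_eq_iff_same_a_r_cos[OF null.ideal_axioms, of s t] s t by (simp add: cauchy_ring_def eq_commute)
qed

lemma cauchy_seqs_near:
  assumes s: "s \<in> cauchy_seqs K v" and y: "\<And>k. y k \<in> K" and lim: "(\<lambda>k. v (s k - y k)) \<longlonglongrightarrow> 0"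
  shows "y \<in> cauchy_seqs K v"
  unfolding cauchy_seqs_def
proof (intro CollectI conjI allI impI y)
  note sK = cauchy_seqsD[OF s]
  fix e :: real assume "e > 0"
  hence e: "e / 3 > 0" by simp
  obtain N where N: "\<forall>k\<ge>N. \<forall>l\<ge>N. v (s k - s l) < e / 3" using cauchy_seqsD'[OF s e] by blast
  obtain M where M: "\<forall>k\<ge>M. v (s k - y k) < e / 3"
    using order_tendstoD(2)[OF lim e] by (auto simp: eventually_sequentially)
  have "v (y k - y l) < e" if kl: "k \<ge> max N M" "l \<ge> max N M" for k l
  proof -
    have "v (y k - y l) \<le> v (y k - s k) + (v (s k - s l) + v (s l - y l))"
      using diff_triangle[OF y[of k] sK[of k] y[of l]] diff_triangle[OF sK[of k] sK[of l] y[of l]] by linarith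
    also have "v (y k - s k) = v (s k - y k)" by (rule diff_commute[OF y sK])
    finally have "v (y k - y l) \<le> v (s k - y k) + v (s k - s l) + v (s l - y l)" by simp
    moreover have "v (s k - y k) < e / 3" "v (s l - y l) < e / 3" "v (s k - s l) < e / 3" using M N kl by auto
    ultimately show ?thesis by linarith
  qed
  thus "\<exists>N. \<forall>k\<ge>N. \<forall>l\<ge>N. v (y k - y l) < e" by blast
qed

lemma cauchy_seqs_bounded_below:
  assumes s: "s \<in> cauchy_seqs K v" and "s \<notin> null_seqs K v"
  obtains c N where "c > 0" "\<And>k. k \<ge> N \<Longrightarrow> v (s k) \<ge> c"
proof -
  note sK = cauchy_seqsD[OF s]
  have "\<not> (\<lambda>k. v (s k)) \<longlonglongrightarrow> 0" using assms by (auto simp: null_seqs_def)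
  then obtain c where c: "c > 0" "\<forall>N. \<exists>k\<ge>N. v (s k) \<ge> c"
    using nonneg[OF sK] by (auto simp: LIMSEQ_def not_less)
  hence c2: "c / 2 > 0" by simp
  obtain N where N: "\<forall>k\<ge>N. \<forall>l\<ge>N. v (s k - s l) < c / 2" using cauchy_seqsD'[OF s c2] by blast
  obtain m where m: "m \<ge> N" "v (s m) \<ge> c" using c(2) by blast
  show ?thesis
  proof (rule that[OF c2, of N])
    fix k assume "k \<ge> N"
    hence "v (s m - s k) < c / 2" using N m by blast
    thus "v (s k) \<ge> c / 2" using reverse_triangle[OF sK[of m] sK[of k]] m by linarith
  qed
qed

text \<open>Finitely many terms may vanish, where \<open>inverse\<close> returns 0, so the product
  is 1 only up to a null sequence. The lower bound for the remaining terms controls the differences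
  of the inverses.\<close>

lemma cauchy_seqs_inverse:
  assumes s: "s \<in> cauchy_seqs K v" and nn: "s \<notin> null_seqs K v"
  shows "(\<lambda>k. inverse (s k)) \<in> cauchy_seqs K v" "(\<lambda>k. s k * inverse (s k) - 1) \<in> null_seqs K v"
proof -
  note sK = cauchy_seqsD[OF s]
  obtain c N where c: "c > 0" "\<And>k. k \<ge> N \<Longrightarrow> v (s k) \<ge> c" using cauchy_seqs_bounded_below[OF assms] by blast
  have nz: "s k \<noteq> 0" if "k \<ge> N" for k using c(1) c(2)[OF that] by auto
  show inv: "(\<lambda>k. inverse (s k)) \<in> cauchy_seqs K v"
    unfolding cauchy_seqs_def
  proof (intro CollectI conjI allI impI csf_inverse[OF K] sK)
    fix e :: real assume e: "e > 0"
    hence "e * c\<^sup>2 > 0" using c by simp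
    then obtain M where M: "\<forall>k\<ge>M. \<forall>l\<ge>M. v (s k - s l) < e * c\<^sup>2" using cauchy_seqsD'[OF s] by blast
    have "v (inverse (s k) - inverse (s l)) < e" if kl: "k \<ge> max N M" "l \<ge> max N M" for k l
    proof -
      have nz': "s k \<noteq> 0" "s l \<noteq> 0" using nz kl by auto
      have "inverse (s k) - inverse (s l) = (s l - s k) / (s k * s l)" using nz' by (simp add: field_simps)
      hence "v (inverse (s k) - inverse (s l)) = v (s l - s k) / (v (s k) * v (s l))"
        using divide[OF csf_diff[OF K sK sK] csf_mult[OF K sK sK]] mult[OF sK sK] by metis
      also have "\<dots> \<le> v (s l - s k) / c\<^sup>2"
        unfolding power2_eq_square
        using c kl nonneg[OF csf_diff[OF K sK sK]] nonneg[OF sK] by (intro divide_left_mono mult_mono mult_pos_pos pos sK nz') auto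
      also have "\<dots> < e" using M kl c(1) by (simp add: pos_divide_less_eq)
      finally show ?thesis .
    qed
    thus "\<exists>N. \<forall>k\<ge>N. \<forall>l\<ge>N. v (inverse (s k) - inverse (s l)) < e" by blast
  qed
  show "(\<lambda>k. s k * inverse (s k) - 1) \<in> null_seqs K v"
  proof (rule null_seqsI)
    have "(\<lambda>k. s k * inverse (s k) + (- 1)) \<in> cauchy_seqs K v"
      by (intro cauchy_seqs_add cauchy_seqs_mult s inv cauchy_seqs_const csf_minus[OF K csf_1[OF K]])
    thus "(\<lambda>k. s k * inverse (s k) - 1) \<in> cauchy_seqs K v" by simp
    have "\<forall>\<^sub>F k in sequentially. v (s k * inverse (s k) - 1) = 0"
      using eventually_ge_at_top[of N] by eventually_elim (simp add: nz)
    thus "(\<lambda>k. v (s k * inverse (s k) - 1)) \<longlonglongrightarrow> 0" by (rule tendsto_eventually)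
  qed
qed

text \<open>Makes the estimates for Cauchy sequences available for rational sequences, which gives
  the closure properties of \<open>completed_rationals\<close>.\<close>

lemma completed_field_Rats: "completed_field \<rat> v"
proof -
  have "\<rat> \<subseteq> K" using csf_of_rat[OF K] by (auto elim!: Rats_cases)
  thus ?thesis using av complex_subfield_Rats by unfold_locales (auto simp: absolute_value_on_def)
qed

lemma cauchy_seqs_Rats: "s \<in> cauchy_seqs \<rat> v \<Longrightarrow> s \<in> cauchy_seqs K v"
  using csf_of_rat[OF K] by (auto simp: cauchy_seqs_def elim!: Rats_cases) (metis Rats_cases)

lemma cls_in_carrier: "s \<in> cauchy_seqs K v \<Longrightarrow> cls s \<in> carrier (completion K v)"
  by (auto simp: carrier_completion)

lemma completed_rationals_sub: "completed_rationals K v \<subseteq> carrier (completion K v)"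
  by (auto simp: completed_rationals_def intro: cls_in_carrier cauchy_seqs_Rats)

lemma cls_minus: assumes s: "s \<in> cauchy_seqs K v"
  shows "\<ominus>\<^bsub>completion K v\<^esub> cls s = cls (\<lambda>k. - s k)"
proof (rule abelian_group.minus_equality[OF ring.is_abelian_group[OF cring.axioms(1), OF cring_completion]])
  show "cls (\<lambda>k. - s k) \<oplus>\<^bsub>completion K v\<^esub> cls s = \<zero>\<^bsub>completion K v\<^esub>"
    by (simp add: cls_add s cauchy_seqs_minus cls_zero)
qed (auto intro: cls_in_carrier cauchy_seqs_minus s)

lemma cls_one_neq_zero: "cls (\<lambda>_. 1) \<noteq> cls (\<lambda>_. 0)"
proof
  assume "cls (\<lambda>_. 1) = cls (\<lambda>_. 0)"
  hence "(\<lambda>_. 1) \<in> null_seqs K v"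
    using cls_eq_iff[OF cauchy_seqs_const[OF csf_1[OF K]] cauchy_seqs_const[OF csf_0[OF K]]] by simp
  hence "(\<lambda>_ :: nat. 1 :: real) \<longlonglongrightarrow> 0" using null_seqsD(2) by fastforce
  thus False by (simp add: LIMSEQ_const_iff)
qed

lemma subfield_completed_rationals: "subfield (completed_rationals K v) (completion K v)"
proof -
  interpret C: cring "completion K v" by (rule cring_completion)
  interpret Q: completed_field \<rat> v by (rule completed_field_Rats)
  note QK = cauchy_seqs_Rats
  have sub: "subring (completed_rationals K v) (completion K v)"
  proof (rule C.subringI)
    show "\<one>\<^bsub>completion K v\<^esub> \<in> completed_rationals K v"
      unfolding cls_one completed_rationals_def using Q.cauchy_seqs_const[OF Rats_1] by blast
  next
    fix h assume "h \<in> completed_rationals K v"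
    then obtain s where s: "s \<in> cauchy_seqs \<rat> v" "h = cls s" by (auto simp: completed_rationals_def)
    show "\<ominus>\<^bsub>completion K v\<^esub> h \<in> completed_rationals K v"
      using s Q.cauchy_seqs_minus[OF s(1)] by (auto simp: completed_rationals_def cls_minus QK)
  next
    fix g h assume "g \<in> completed_rationals K v" "h \<in> completed_rationals K v"
    then obtain s t where s: "s \<in> cauchy_seqs \<rat> v" "g = cls s" "t \<in> cauchy_seqs \<rat> v" "h = cls t"
      by (auto simp: completed_rationals_def)
    show "g \<otimes>\<^bsub>completion K v\<^esub> h \<in> completed_rationals K v" "g \<oplus>\<^bsub>completion K v\<^esub> h \<in> completed_rationals K v"
      using s Q.cauchy_seqs_mult[OF s(1,3)] Q.cauchy_seqs_add[OF s(1,3)]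
      by (auto simp: completed_rationals_def cls_mult cls_add QK)
  qed (rule completed_rationals_sub)
  show ?thesis
  proof (rule C.subfieldI)
    show "subcring (completed_rationals K v) (completion K v)"
      by (rule C.subcringI[OF sub]) (use completed_rationals_sub C.m_comm in blast)
    show "Units (completion K v\<lparr>carrier := completed_rationals K v\<rparr>) = completed_rationals K v - {\<zero>\<^bsub>completion K v\<^esub>}"
    proof (intro equalityI subsetI)
      fix y assume "y \<in> Units (completion K v\<lparr>carrier := completed_rationals K v\<rparr>)"
      then obtain x where xy: "y \<in> completed_rationals K v" "x \<in> completed_rationals K v"
        "x \<otimes>\<^bsub>completion K v\<^esub> y = \<one>\<^bsub>completion K v\<^esub>" by (auto simp: Units_def)
      hence "y \<noteq> \<zero>\<^bsub>completion K v\<^esub>"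
        using completed_rationals_sub C.r_null[of x] cls_one_neq_zero by (auto simp: cls_one[symmetric] cls_zero[symmetric])
      thus "y \<in> completed_rationals K v - {\<zero>\<^bsub>completion K v\<^esub>}" using xy by blast
    next
      fix y assume y: "y \<in> completed_rationals K v - {\<zero>\<^bsub>completion K v\<^esub>}"
      then obtain s where s: "s \<in> cauchy_seqs \<rat> v" "y = cls s" by (auto simp: completed_rationals_def)
      have "s \<notin> null_seqs K v"
        using y s cls_eq_iff[OF QK[OF s(1)] cauchy_seqs_const[OF csf_0[OF K]]] by (auto simp: cls_zero)
      moreover have "s \<notin> null_seqs \<rat> v" using calculation QK[OF s(1)] by (auto simp: null_seqs_def)
      ultimately have inv: "(\<lambda>k. inverse (s k)) \<in> cauchy_seqs \<rat> v" "(\<lambda>k. s k * inverse (s k) - 1) \<in> null_seqs K v"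
        using Q.cauchy_seqs_inverse(1)[OF s(1)] cauchy_seqs_inverse(2)[OF QK[OF s(1)]] by blast+
      have "y \<otimes>\<^bsub>completion K v\<^esub> cls (\<lambda>k. inverse (s k)) = \<one>\<^bsub>completion K v\<^esub>"
        using cls_eq_iff[OF cauchy_seqs_mult[OF QK[OF s(1)] QK[OF inv(1)]] cauchy_seqs_const[OF csf_1[OF K]]] inv(2)
        by (simp add: s(2) cls_mult QK[OF s(1)] QK[OF inv(1)] cls_one)
      moreover have "cls (\<lambda>k. inverse (s k)) \<in> completed_rationals K v" using inv(1) by (auto simp: completed_rationals_def)
      ultimately show "y \<in> Units (completion K v\<lparr>carrier := completed_rationals K v\<rparr>)"
        using y C.m_comm completed_rationals_sub unfolding Units_def by (auto intro!: bexI[of _ "cls (\<lambda>k. inverse (s k))"])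
    qed
  qed
qed

lemma completion_combine:
  assumes "length cs = length us" "set cs \<subseteq> cauchy_seqs K v" "set us \<subseteq> cauchy_seqs K v"
  shows "(\<lambda>k. \<Sum>i<length us. (cs ! i) k * (us ! i) k) \<in> cauchy_seqs K v \<and>
    ring.combine (completion K v) (map cls cs) (map cls us) = cls (\<lambda>k. \<Sum>i<length us. (cs ! i) k * (us ! i) k)"
  using assms
proof (induction cs us rule: list_induct2)
  case Nil
  have "ring (completion K v)" using cring_completion by (rule cring.axioms(1))
  thus ?case by (simp add: ring.combine.simps cls_zero cauchy_seqs_const[OF csf_0[OF K]])
next
  case (Cons c cs u us)
  have R: "ring (completion K v)" using cring_completion by (rule cring.axioms(1))
  have cu: "c \<in> cauchy_seqs K v" "u \<in> cauchy_seqs K v" using Cons.prems by auto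
  define S where "S = (\<lambda>k. \<Sum>i<length us. (cs ! i) k * (us ! i) k)"
  have IH: "S \<in> cauchy_seqs K v" "ring.combine (completion K v) (map cls cs) (map cls us) = cls S"
    using Cons unfolding S_def by auto
  have eq: "(\<lambda>k. \<Sum>i<length (u # us). ((c # cs) ! i) k * ((u # us) ! i) k) = (\<lambda>k. c k * u k + S k)"
    by (simp add: S_def sum.lessThan_Suc_shift del: sum.lessThan_Suc)
  show ?case unfolding eq using IH cu
    by (simp add: ring.combine.simps[OF R] cls_mult cls_add cauchy_seqs_mult cauchy_seqs_add)
qed

text \<open>The powers of \<theta> below n are a basis of the completion. Density yields
  approximating polynomials for an element, and the bound makes their coefficient sequences Cauchy,
  so the powers span. The bound also forces the coefficients of a null combination to be null, so
  the powers are independent.\<close>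

lemma local_degree_eqI:
  assumes \<theta>: "\<theta> \<in> K" and n: "n > 0"
    and dense: "\<And>a \<epsilon>. a \<in> K \<Longrightarrow> \<epsilon> > 0 \<Longrightarrow> \<exists>c. degree c < n \<and> v (a - rat_eval c \<theta>) < \<epsilon>"
    and bound: "\<And>c i. degree c < n \<Longrightarrow> i < n \<Longrightarrow> v (of_rat (coeff c i)) \<le> M * v (rat_eval c \<theta>)"
  shows "local_degree K v = n"
proof -
  have R: "ring (completion K v)" using cring_completion by (rule cring.axioms(1))
  define us :: "(nat \<Rightarrow> complex) list" where "us = map (\<lambda>i _. \<theta> ^ i) [0..<n]"
  have us: "set us \<subseteq> cauchy_seqs K v" "length us = n"
    by (auto simp: us_def intro!: cauchy_seqs_const csf_power[OF K \<theta>])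
  have nth_us: "i < n \<Longrightarrow> (us ! i) k = \<theta> ^ i" for i k by (simp add: us_def)
  define Us where "Us = map cls us"
  have len: "length Us = n" by (simp add: Us_def us)
  have evK: "rat_eval c \<theta> \<in> K" for c by (rule csf_rat_eval[OF K \<theta>])
  have lift: "\<exists>cs. length cs = n \<and> set cs \<subseteq> cauchy_seqs \<rat> v \<and> Ks = map cls cs"
    if "length Ks = n" "set Ks \<subseteq> completed_rationals K v" for Ks
  proof -
    have "\<forall>x\<in>set Ks. \<exists>s. s \<in> cauchy_seqs \<rat> v \<and> x = cls s" using that(2) by (auto simp: completed_rationals_def)
    then obtain g where g: "\<And>x. x \<in> set Ks \<Longrightarrow> g x \<in> cauchy_seqs \<rat> v \<and> x = cls (g x)" by metis
    have "map cls (map g Ks) = Ks" unfolding map_map by (rule map_idI) (use g in auto)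
    thus ?thesis using g that(1) by (intro exI[of _ "map g Ks"]) auto
  qed
  have comb: "(\<lambda>k. \<Sum>i<n. (cs ! i) k * \<theta> ^ i) \<in> cauchy_seqs K v"
    "ring.combine (completion K v) (map cls cs) Us = cls (\<lambda>k. \<Sum>i<n. (cs ! i) k * \<theta> ^ i)"
    if "length cs = n" "set cs \<subseteq> cauchy_seqs \<rat> v" for cs
    using completion_combine[of cs us] that us cauchy_seqs_Rats by (auto simp: Us_def nth_us)
  have poly_of: "\<exists>c. degree c < n \<and> (\<forall>i<n. of_rat (coeff c i) = a i) \<and> rat_eval c \<theta> = (\<Sum>i<n. a i * \<theta> ^ i)"
    if "\<And>i. i < n \<Longrightarrow> a i \<in> \<rat>" for a :: "nat \<Rightarrow> complex"
  proof -
    have "\<forall>i<n. \<exists>r. a i = of_rat r" using that by (auto elim!: Rats_cases)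
    then obtain r where r: "\<And>i. i < n \<Longrightarrow> a i = of_rat (r i)" by metis
    define c where "c = (\<Sum>i<n. monom (r i) i)"
    have cc: "coeff c i = (if i < n then r i else 0)" for i by (auto simp: c_def coeff_sum)
    have "degree c < n" using cc n by (metis degree_0 leading_coeff_0_iff)
    thus ?thesis using r cc by (intro exI[of _ c]) (auto simp: rat_eval_altdef)
  qed
  have "ring.dim (completion K v) (completed_rationals K v) (carrier (completion K v)) = length Us"
  proof (rule ring.dim_eqI[OF R subfield_completed_rationals])
    show "set Us \<subseteq> carrier (completion K v)" using us(1) by (auto simp: Us_def intro: cls_in_carrier)
  next
    fix Ks assume Ks: "length Ks = length Us" "set Ks \<subseteq> completed_rationals K v"
      "ring.combine (completion K v) Ks Us = \<zero>\<^bsub>completion K v\<^esub>"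
    obtain cs where cs: "length cs = n" "set cs \<subseteq> cauchy_seqs \<rat> v" "Ks = map cls cs" using lift Ks len by metis
    define y where "y = (\<lambda>k. \<Sum>i<n. (cs ! i) k * \<theta> ^ i)"
    have "cls y = cls (\<lambda>_. 0)" using comb[OF cs(1,2)] Ks(3) cs(3) by (simp add: cls_zero y_def)
    hence ynull: "(\<lambda>k. v (y k)) \<longlonglongrightarrow> 0"
      using cls_eq_iff[OF comb(1)[OF cs(1,2)] cauchy_seqs_const[OF csf_0[OF K]]] null_seqsD(2) by (auto simp: y_def)
    have csc: "cs ! i \<in> cauchy_seqs \<rat> v" if "i < n" for i using that cs nth_mem by blast
    have "cls (cs ! i) = cls (\<lambda>_. 0)" if i: "i < n" for i
    proof -
      have "v ((cs ! i) k) \<le> M * v (y k)" for k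
      proof -
        have "(cs ! i) k \<in> \<rat>" if "i < n" for i using csc[OF that] by (auto simp: cauchy_seqs_def)
        then obtain c where "degree c < n" "\<forall>i<n. of_rat (coeff c i) = (cs ! i) k" "rat_eval c \<theta> = y k"
          using poly_of[of "\<lambda>i. (cs ! i) k"] unfolding y_def by auto
        thus ?thesis using bound[of c i] i by simp
      qed
      moreover have "(\<lambda>k. M * v (y k)) \<longlonglongrightarrow> 0" using tendsto_mult[OF tendsto_const ynull, of M] by simp
      ultimately have "cs ! i \<in> null_seqs K v" using null_seqs_squeeze[OF cauchy_seqs_Rats[OF csc[OF i]], of "\<lambda>k. M * v (y k)"] by blast
      thus ?thesis using cls_eq_iff[OF cauchy_seqs_Rats[OF csc[OF i]] cauchy_seqs_const[OF csf_0[OF K]]] by simp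
    qed
    thus "set Ks \<subseteq> {\<zero>\<^bsub>completion K v\<^esub>}" using cs by (auto simp: cls_zero in_set_conv_nth)
  next
    show "carrier (completion K v) = {ring.combine (completion K v) Ks Us | Ks. length Ks = length Us \<and> set Ks \<subseteq> completed_rationals K v}"
    proof (intro equalityI subsetI)
      fix x assume "x \<in> carrier (completion K v)"
      then obtain s where s: "s \<in> cauchy_seqs K v" "x = cls s" by (auto simp: carrier_completion)
      have "\<forall>k. \<exists>c. degree c < n \<and> v (s k - rat_eval c \<theta>) < 1 / (real k + 1)"
        using dense[OF cauchy_seqsD[OF s(1)]] by simp
      then obtain c where c: "\<And>k. degree (c k) < n" "\<And>k. v (s k - rat_eval (c k) \<theta>) < 1 / (real k + 1)" by metis
      define y where "y = (\<lambda>k. rat_eval (c k) \<theta>)"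
      have yK: "y k \<in> K" for k unfolding y_def by (rule evK)
      have lim: "(\<lambda>k. v (s k - y k)) \<longlonglongrightarrow> 0"
      proof (rule tendsto_sandwich[OF _ _ tendsto_const])
        show "\<forall>\<^sub>F k in sequentially. 0 \<le> v (s k - y k)"
          by (intro always_eventually allI nonneg csf_diff[OF K] yK cauchy_seqsD[OF s(1)])
        show "\<forall>\<^sub>F k in sequentially. v (s k - y k) \<le> 1 / (real k + 1)"
          using c(2) by (auto simp: y_def intro!: always_eventually less_imp_le)
        show "(\<lambda>k. 1 / (real k + 1)) \<longlonglongrightarrow> 0"
          using LIMSEQ_inverse_real_of_nat by (simp add: inverse_eq_divide add.commute)
      qed
      have y: "y \<in> cauchy_seqs K v" by (rule cauchy_seqs_near[OF s(1) yK lim])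
      define cs where "cs = map (\<lambda>i k. of_rat (coeff (c k) i) :: complex) [0..<n]"
      have csc: "(\<lambda>k. of_rat (coeff (c k) i)) \<in> cauchy_seqs \<rat> v" if i: "i < n" for i
        unfolding cauchy_seqs_def
      proof (intro CollectI conjI allI impI)
        fix e :: real assume e: "e > 0"
        \<comment> \<open>Nothing is known about the sign of \<open>M\<close>, hence the positive
          factor \<bar>M\<bar> + 1.\<close>
        hence "e / (\<bar>M\<bar> + 1) > 0" by (simp add: add_nonneg_pos)
        then obtain N where N: "\<forall>k\<ge>N. \<forall>l\<ge>N. v (y k - y l) < e / (\<bar>M\<bar> + 1)" using cauchy_seqsD'[OF y] by blast
        have "v (of_rat (coeff (c k) i) - of_rat (coeff (c l) i)) < e" if "k \<ge> N" "l \<ge> N" for k l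
        proof -
          have "v (of_rat (coeff (c k - c l) i)) \<le> M * v (rat_eval (c k - c l) \<theta>)"
            by (rule bound[OF degree_diff_less[OF c(1) c(1)] i])
          hence "v (of_rat (coeff (c k) i) - of_rat (coeff (c l) i)) \<le> M * v (y k - y l)"
            by (simp add: y_def of_rat_diff)
          also have "\<dots> \<le> (\<bar>M\<bar> + 1) * v (y k - y l)"
            using nonneg[OF csf_diff[OF K yK yK]] by (intro mult_right_mono) auto
          also have "\<dots> < (\<bar>M\<bar> + 1) * (e / (\<bar>M\<bar> + 1))" using N that by (intro mult_strict_left_mono) auto
          also have "\<dots> = e" by (simp add: add_nonneg_pos)
          finally show ?thesis .
        qed
        thus "\<exists>N. \<forall>k\<ge>N. \<forall>l\<ge>N. v (of_rat (coeff (c k) i) - of_rat (coeff (c l) i)) < e" by blast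
      qed simp
      have cs: "length cs = n" "set cs \<subseteq> cauchy_seqs \<rat> v" using csc by (auto simp: cs_def)
      have "(\<lambda>k. \<Sum>i<n. (cs ! i) k * \<theta> ^ i) = y"
        using c(1) by (auto simp: y_def cs_def rat_eval_altdef[of _ n])
      hence "ring.combine (completion K v) (map cls cs) Us = cls y" using comb(2)[OF cs] by simp
      also have "\<dots> = x"
      proof -
        have "(\<lambda>k. s k - y k) \<in> null_seqs K v"
        proof (rule null_seqsI[OF _ lim])
          show "(\<lambda>k. s k - y k) \<in> cauchy_seqs K v" using cauchy_seqs_add[OF s(1) cauchy_seqs_minus[OF y]] by simp
        qed
        thus ?thesis using cls_eq_iff[OF s(1) y] s(2) by simp
      qed
      finally show "x \<in> {ring.combine (completion K v) Ks Us | Ks. length Ks = length Us \<and> set Ks \<subseteq> completed_rationals K v}"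
        using cs len unfolding completed_rationals_def
        by (intro CollectI exI[of _ "map cls cs"] conjI) (auto intro!: imageI)
    next
      fix x assume "x \<in> {ring.combine (completion K v) Ks Us | Ks. length Ks = length Us \<and> set Ks \<subseteq> completed_rationals K v}"
      then obtain Ks where Ks: "x = ring.combine (completion K v) Ks Us" "length Ks = n" "set Ks \<subseteq> completed_rationals K v"
        using len by auto
      obtain cs where "length cs = n" "set cs \<subseteq> cauchy_seqs \<rat> v" "Ks = map cls cs" using lift[OF Ks(2,3)] by blast
      thus "x \<in> carrier (completion K v)" using comb Ks(1) by (auto intro: cls_in_carrier)
    qed
  qed
  thus ?thesis by (simp add: local_degree_def len)
qed

end

context conjugate_places_at
begin

lemma local_degree_eq: "local_degree \<F> v = card S"
proof -
  obtain M where M: "\<And>c i. degree c < card S \<Longrightarrow> i < card S \<Longrightarrow> v (of_rat (coeff c i)) \<le> M * v (rat_eval c \<theta>)"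
    using coeff_bound by blast
  interpret completed_field \<F> v by unfold_locales
  show ?thesis
    by (rule local_degree_eqI[OF theta_in_F card_S_pos _ M]) (use F_subset_W in \<open>auto simp: W_def\<close>)
qed

end

section \<open>Heights as sums over embeddings\<close>

lemma ln_abs_int_eq_sum:
  assumes k: "k \<noteq> 0" and T: "finite T" "\<And>p. p \<in> T \<Longrightarrow> Factorial_Ring.prime p"
    "\<And>p. Factorial_Ring.prime p \<Longrightarrow> int p dvd k \<Longrightarrow> p \<in> T"
  shows "ln \<bar>real_of_int k\<bar> = (\<Sum>p\<in>T. real (multiplicity (int p) k) * ln (real p))"
proof -
  have sub: "prime_factors k \<subseteq> int ` T"
  proof
    fix q assume q: "q \<in> prime_factors k"
    hence "Factorial_Ring.prime q" "q dvd k" by auto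
    moreover from this have "int (nat q) = q" using prime_ge_0_int by simp
    ultimately show "q \<in> int ` T" using T(3)[of "nat q"] by (metis image_eqI prime_nat_int_transfer)
  qed
  have "\<bar>k\<bar> = (\<Prod>q\<in>prime_factors k. q ^ multiplicity q k)" using prod_prime_factors[OF k] by simp
  also have "\<dots> = (\<Prod>q\<in>int ` T. q ^ multiplicity q k)"
    by (rule prod.mono_neutral_left) (use sub T in \<open>auto simp: prime_factors_multiplicity\<close>)
  also have "\<dots> = (\<Prod>p\<in>T. int p ^ multiplicity (int p) k)" by (subst prod.reindex) auto
  finally have "real_of_int \<bar>k\<bar> = (\<Prod>p\<in>T. real p ^ multiplicity (int p) k)" by simp
  hence "ln \<bar>real_of_int k\<bar> = ln (\<Prod>p\<in>T. real p ^ multiplicity (int p) k)" by simp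
  also have "\<dots> = (\<Sum>p\<in>T. ln (real p ^ multiplicity (int p) k))"
    by (rule ln_prod) (use T(1,2) prime_gt_0_nat in auto)
  also have "\<dots> = (\<Sum>p\<in>T. real (multiplicity (int p) k) * ln (real p))"
    by (simp add: ln_realpow)
  finally show ?thesis .
qed

lemma finite_prime_divisors: "(k :: int) \<noteq> 0 \<Longrightarrow> finite {p :: nat. Factorial_Ring.prime p \<and> int p dvd k}"
  by (rule finite_subset[of _ "{..nat \<bar>k\<bar>}"]) (auto dest: dvd_imp_le_int)

lemma ln_padic_abs:
  assumes "Factorial_Ring.prime p" "c \<noteq> 0" "quotient_of c = (k, m)"
  shows "ln (padic_abs p c) = (real (multiplicity (int p) m) - real (multiplicity (int p) k)) * ln (real p)"
proof -
  have "real p > 0" using assms(1) prime_gt_0_nat by simp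
  thus ?thesis using assms by (simp add: padic_abs_def ln_powr flip: powr_real_of_int')
qed

lemma rational_product_formula:
  assumes c: "c \<noteq> 0" and T: "finite T" "\<And>p. p \<in> T \<Longrightarrow> Factorial_Ring.prime p"
    "\<And>p. Factorial_Ring.prime p \<Longrightarrow> p \<notin> T \<Longrightarrow> padic_abs p c = 1"
  shows "ln (real_of_rat \<bar>c\<bar>) + (\<Sum>p\<in>T. ln (padic_abs p c)) = 0"
proof -
  obtain k m where km: "quotient_of c = (k, m)" by fastforce
  have m: "m > 0" using quotient_of_denom_pos[OF km] .
  have q: "c = of_int k / of_int m" using quotient_of_div[OF km] .
  have k: "k \<noteq> 0" using c q by auto
  \<comment> \<open>Includes every prime dividing the numerator or the denominator, as the
    factorisation demands; the primes added to T have value 1 and contribute ln 1 = 0.\<close>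
  define T' where "T' = T \<union> {p. Factorial_Ring.prime p \<and> int p dvd k} \<union> {p. Factorial_Ring.prime p \<and> int p dvd m}"
  have T': "finite T'" "\<And>p. p \<in> T' \<Longrightarrow> Factorial_Ring.prime p"
    using T finite_prime_divisors k m by (auto simp: T'_def)
  have lk: "ln \<bar>real_of_int k\<bar> = (\<Sum>p\<in>T'. real (multiplicity (int p) k) * ln (real p))"
    by (rule ln_abs_int_eq_sum[OF k T']) (auto simp: T'_def)
  have lm: "ln \<bar>real_of_int m\<bar> = (\<Sum>p\<in>T'. real (multiplicity (int p) m) * ln (real p))"
    by (rule ln_abs_int_eq_sum[OF _ T']) (use m in \<open>auto simp: T'_def\<close>)
  have "(\<Sum>p\<in>T. ln (padic_abs p c)) = (\<Sum>p\<in>T'. ln (padic_abs p c))"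
  proof (rule sum.mono_neutral_left[OF T'(1)])
    show "T \<subseteq> T'" by (auto simp: T'_def)
    show "\<forall>p\<in>T' - T. ln (padic_abs p c) = 0" using T(3) T'(2) by simp
  qed
  also have "\<dots> = (\<Sum>p\<in>T'. (real (multiplicity (int p) m) - real (multiplicity (int p) k)) * ln (real p))"
    by (intro sum.cong refl ln_padic_abs[OF _ c km] T'(2))
  also have "\<dots> = ln \<bar>real_of_int m\<bar> - ln \<bar>real_of_int k\<bar>"
    by (simp add: lk lm sum_subtractf left_diff_distrib)
  finally have "(\<Sum>p\<in>T. ln (padic_abs p c)) = ln \<bar>real_of_int m\<bar> - ln \<bar>real_of_int k\<bar>" .
  moreover have "real_of_rat \<bar>c\<bar> = \<bar>real_of_int k\<bar> / \<bar>real_of_int m\<bar>"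
    by (simp add: q abs_divide of_rat_divide del: abs_of_rat flip: abs_of_rat)
  hence "ln (real_of_rat \<bar>c\<bar>) = ln \<bar>real_of_int k\<bar> - ln \<bar>real_of_int m\<bar>"
    using k m by (simp add: ln_div)
  ultimately show ?thesis by simp
qed

text \<open>The index \<open>p = 0\<close> stands for the Archimedean place.\<close>

definition base_abs :: "nat \<Rightarrow> rat \<Rightarrow> real" where
  "base_abs p = (if p = 0 then (\<lambda>q. real_of_rat \<bar>q\<bar>) else padic_abs p)"

definition ext_place :: "nat \<Rightarrow> complex \<Rightarrow> real" where
  "ext_place p = (if p = 0 then cmod else (SOME u. is_padic_extension p u))"

lemma ext_place_0 [simp]: "ext_place 0 = cmod" by (simp add: ext_place_def)

lemma is_padic_extension_ext_place:
  assumes "Factorial_Ring.prime p" shows "is_padic_extension p (ext_place p)"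
proof -
  have "p \<noteq> 0" using assms prime_gt_0_nat by auto
  moreover have "is_padic_extension p (SOME u. is_padic_extension p u)"
    by (rule someI_ex[OF exists_padic_extension[OF assms]])
  ultimately show ?thesis by (simp add: ext_place_def)
qed

lemma absolute_value_ext_place_prime:
  assumes "Factorial_Ring.prime p" shows "absolute_value algebraic_numbers (ext_place p)"
  using is_padic_extension_ext_place[OF assms] complex_subfield_algebraic
  unfolding is_padic_extension_def absolute_value_def by blast

abbreviation place_index :: "nat \<Rightarrow> bool" where "place_index p \<equiv> p = 0 \<or> Factorial_Ring.prime p"

lemma quotient_of_of_int: "quotient_of (of_int k) = (k, 1)"
  by (simp add: quotient_of_Fract Rat.normalize_def flip: of_int_rat)

lemma padic_abs_self: assumes "Factorial_Ring.prime p" shows "padic_abs p (of_nat p) = inverse (real p)"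
proof -
  have "quotient_of (rat_of_int (int p)) = (int p, 1)" by (rule quotient_of_of_int)
  hence "quotient_of (of_nat p) = (int p, 1)" by simp
  moreover have "p > 1" using prime_gt_1_nat[OF assms] .
  ultimately show ?thesis using multiplicity_self[of "int p"] by (simp add: padic_abs_def power_int_minus)
qed

lemma nontrivial_ext_place:
  assumes "place_index p" shows "nontrivial_over (base_abs p) algebraic_numbers (ext_place p)"
proof (cases "p = 0")
  case True
  have "absolute_value_on algebraic_numbers cmod"
    by (auto simp: absolute_value_on_def norm_mult norm_triangle_ineq)
  moreover have "cmod (of_rat q) = real_of_rat \<bar>q\<bar>" for q
  proof -
    have "(of_rat q :: complex) = of_real (of_rat q)" by (cases q) (simp add: of_rat_rat)
    thus ?thesis by (simp only: norm_of_real abs_of_rat)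
  qed
  moreover have "\<exists>q. real_of_rat \<bar>q\<bar> > 1" by (rule exI[of _ 2]) simp
  ultimately show ?thesis using True by (auto simp: nontrivial_over_def base_abs_def)
next
  case False
  hence p: "Factorial_Ring.prime p" using assms by simp
  interpret u: absolute_value algebraic_numbers "ext_place p"
    by (rule absolute_value_ext_place_prime[OF p])
  have E: "ext_place p (of_rat q) = padic_abs p q" for q
    using is_padic_extension_ext_place[OF p] by (simp add: is_padic_extension_def)
  have "padic_abs p (inverse (of_nat p)) = real p"
    using E[of "inverse (of_nat p)"] E[of "of_nat p"] padic_abs_self[OF p]
      u.inverse[OF csf_of_rat[OF complex_subfield_algebraic], of "of_nat p"] by (simp add: of_rat_inverse)
  hence "\<exists>q. padic_abs p q > 1" using prime_gt_1_nat[OF p] by (intro exI[of _ "inverse (of_nat p)"]) simp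
  thus ?thesis using False E u.av by (auto simp: nontrivial_over_def base_abs_def)
qed

section \<open>Values at integers and algebraic integers\<close>

context
  fixes p :: nat assumes p: "Factorial_Ring.prime p"
begin

lemma ext_place_of_rat: "ext_place p (of_rat q) = padic_abs p q"
  using is_padic_extension_ext_place[OF p] by (simp add: is_padic_extension_def)

lemma ext_place_sum_le:
  assumes "B \<ge> 0" "\<And>i. i \<in> A \<Longrightarrow> algebraic (g i)" "\<And>i. i \<in> A \<Longrightarrow> ext_place p (g i) \<le> B"
  shows "ext_place p (sum g A) \<le> B"
  using assms(2,3)
proof (induction A rule: infinite_finite_induct)
  case (insert a A)
  have "algebraic (sum g A)" using csf_sum[OF complex_subfield_algebraic, of A g] insert.prems by auto
  hence "ext_place p (g a + sum g A) \<le> max (ext_place p (g a)) (ext_place p (sum g A))"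
    using is_padic_extension_ext_place[OF p] insert.prems by (simp add: is_padic_extension_def)
  thus ?case using insert by force
qed (use assms(1) absolute_value.zero[OF absolute_value_ext_place_prime[OF p]] in auto)

lemma ext_place_of_int: "ext_place p (of_int k) \<le> 1"
proof -
  have "quotient_of (rat_of_int k) = (k, 1)" by (rule quotient_of_of_int)
  hence "padic_abs p (of_int k) \<le> 1"
    using prime_gt_1_nat[OF p] by (simp add: padic_abs_def power_int_minus field_simps)
  thus ?thesis using ext_place_of_rat[of "of_int k"] by simp
qed

lemma ext_place_of_int_coprime: assumes "\<not> int p dvd k" shows "ext_place p (of_int k) = 1"
proof -
  have "quotient_of (rat_of_int k) = (k, 1)" by (rule quotient_of_of_int)
  moreover have "k \<noteq> 0" using assms by auto
  ultimately have "padic_abs p (of_int k) = 1"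
    using assms by (simp add: padic_abs_def not_dvd_imp_multiplicity_0)
  thus ?thesis using ext_place_of_rat[of "of_int k"] by simp
qed

text \<open>If y had size above 1, the other terms of its monic equation would have at most the size
  of y^(n-1), and so would their sum by the ultrametric inequality; but this sum has the size of
  y^n.\<close>

lemma ext_place_algebraic_int:
  assumes "algebraic_int y" shows "ext_place p y \<le> 1"
proof (rule ccontr)
  interpret u: absolute_value algebraic_numbers "ext_place p" by (rule absolute_value_ext_place_prime[OF p])
  assume "\<not> ?thesis"
  hence gt: "ext_place p y > 1" by simp
  have y: "y \<in> algebraic_numbers" using assms by (auto intro: algebraic_int_imp_algebraic)
  from assms obtain q where q: "lead_coeff q = 1" "\<And>i. coeff q i \<in> \<int>" "poly q y = 0"
    by (auto elim!: algebraic_int.cases)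
  define n where "n = degree q"
  have "n > 0" using q(1,3) monic_degree_0[of q] by (cases "n = 0") (auto simp: n_def)
  have cq: "algebraic (coeff q i)" "ext_place p (coeff q i) \<le> 1" for i
    using q(2)[of i] ext_place_of_int csf_of_int[OF complex_subfield_algebraic] by (auto elim!: Ints_cases)
  have "0 = (\<Sum>i\<le>n. coeff q i * y ^ i)" using q(3) by (simp add: poly_altdef n_def)
  also have "\<dots> = y ^ n + (\<Sum>i<n. coeff q i * y ^ i)"
    using q(1) by (simp add: lessThan_Suc_atMost[symmetric] n_def)
  finally have eq: "y ^ n = - (\<Sum>i<n. coeff q i * y ^ i)" by (simp add: add_eq_0_iff2)
  have tm: "coeff q i * y ^ i \<in> algebraic_numbers" for i
    using csf_mult[OF complex_subfield_algebraic] csf_power[OF complex_subfield_algebraic] y cq(1) by auto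
  have "(\<Sum>i<n. coeff q i * y ^ i) \<in> algebraic_numbers"
    by (rule csf_sum[OF complex_subfield_algebraic tm])
  hence "ext_place p y ^ n = ext_place p (\<Sum>i<n. coeff q i * y ^ i)"
    using u.power[OF y, of n] u.minus eq by metis
  also have "\<dots> \<le> ext_place p y ^ (n - 1)"
  proof (rule ext_place_sum_le)
    show "ext_place p y ^ (n - 1) \<ge> 0" using gt by simp
    fix i assume i: "i \<in> {..<n}"
    show "algebraic (coeff q i * y ^ i)" using tm by auto
    have "ext_place p (coeff q i * y ^ i) = ext_place p (coeff q i) * ext_place p y ^ i"
      using cq y csf_power[OF complex_subfield_algebraic] by (simp add: u.mult u.power)
    also have "\<dots> \<le> 1 * ext_place p y ^ (n - 1)"
      using cq(2)[of i] i gt u.nonneg[of "coeff q i"] cq(1)[of i] by (intro mult_mono power_increasing) auto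
    finally show "ext_place p (coeff q i * y ^ i) \<le> ext_place p y ^ (n - 1)" by simp
  qed
  also have "\<dots> < ext_place p y ^ n" using gt \<open>n > 0\<close> by (intro power_strict_increasing) auto
  finally show False by simp
qed

end

text \<open>An integer c that makes c a integral bounds the size of a by 1 at all primes not
  dividing c. Applied to a and to its inverse, this leaves finitely many exceptions.\<close>

lemma finite_nonunit_places:
  assumes a: "algebraic a" "a \<noteq> 0"
  shows "finite {p. Factorial_Ring.prime p \<and> ext_place p a \<noteq> 1}"
proof -
  have main: "\<exists>T. finite T \<and> (\<forall>p. Factorial_Ring.prime p \<longrightarrow> p \<notin> T \<longrightarrow> ext_place p a \<le> 1)" if a: "algebraic a" for a
  proof -
    obtain c :: int where c: "c \<noteq> 0" "algebraic_int (of_int c * a)" using algebraic_int_multiple[OF a] by blast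
    have "ext_place p a \<le> 1" if p: "Factorial_Ring.prime p" "\<not> int p dvd c" for p
    proof -
      interpret u: absolute_value algebraic_numbers "ext_place p"
        by (rule absolute_value_ext_place_prime[OF p(1)])
      have "ext_place p (of_int c * a) = ext_place p a"
        using u.mult[OF csf_of_int[OF complex_subfield_algebraic, of c], of a] a ext_place_of_int_coprime[OF p] by simp
      thus ?thesis using ext_place_algebraic_int[OF p(1) c(2)] by simp
    qed
    thus ?thesis using finite_prime_divisors[OF c(1)]
      by (intro exI[of _ "{p. Factorial_Ring.prime p \<and> int p dvd c}"]) auto
  qed
  define N where "N = (\<lambda>T a. finite T \<and> (\<forall>p. Factorial_Ring.prime p \<longrightarrow> p \<notin> T \<longrightarrow> ext_place p a \<le> 1))"
  have ia: "algebraic (inverse a)" using a by auto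
  obtain T where "N T a" using main[OF a(1)] unfolding N_def by metis
  moreover obtain T' where "N T' (inverse a)" using main[OF ia] unfolding N_def by metis
  ultimately have T: "finite T" "finite T'" "\<And>p. Factorial_Ring.prime p \<Longrightarrow> p \<notin> T \<Longrightarrow> ext_place p a \<le> 1"
    "\<And>p. Factorial_Ring.prime p \<Longrightarrow> p \<notin> T' \<Longrightarrow> ext_place p (inverse a) \<le> 1"
    by (simp_all add: N_def)
  have "ext_place p a = 1" if p: "Factorial_Ring.prime p" "p \<notin> T \<union> T'" for p
  proof -
    interpret u: absolute_value algebraic_numbers "ext_place p"
      by (rule absolute_value_ext_place_prime[OF p(1)])
    have "inverse (ext_place p a) \<le> 1" using T(4)[of p] p u.inverse[of a] a by simp
    moreover have "ext_place p a > 0" using u.pos[of a] a by simp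
    ultimately show ?thesis using T(3)[of p] p by (simp add: inverse_le_1_iff)
  qed
  hence "{p. Factorial_Ring.prime p \<and> ext_place p a \<noteq> 1} \<subseteq> T \<union> T'" by blast
  thus ?thesis using T(1,2) by (meson finite_UnI finite_subset)
qed

section \<open>Places of a number field and embeddings\<close>

definition places_over :: "nat \<Rightarrow> complex set \<Rightarrow> (complex \<Rightarrow> real) set" where
  "places_over p K = {v \<in> extensional K. nontrivial_over (base_abs p) K v}"

lemma absolute_value_ext_place:
  assumes "place_index p" shows "absolute_value algebraic_numbers (ext_place p)"
  using nontrivial_ext_place[OF assms] complex_subfield_algebraic
  unfolding nontrivial_over_def absolute_value_def by blast

lemma base_abs_gt_1: "place_index p \<Longrightarrow> \<exists>q. base_abs p q > 1"
  using nontrivial_ext_place[of p] by (simp add: nontrivial_over_def)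

lemma places_eq: "places K = (\<Union>p\<in>{p. place_index p}. places_over p K)"
proof (intro equalityI subsetI)
  fix v assume "v \<in> places K"
  hence v: "v \<in> extensional K" "absolute_value_on K v"
    "(\<exists>p. Factorial_Ring.prime p \<and> (\<forall>q. v (of_rat q) = padic_abs p q)) \<or> (\<forall>q. v (of_rat q) = real_of_rat \<bar>q\<bar>)"
    by (auto simp: places_def)
  have "\<exists>p. place_index p \<and> (\<forall>q. v (of_rat q) = base_abs p q)"
    using v(3)
  proof
    assume "\<exists>p. Factorial_Ring.prime p \<and> (\<forall>q. v (of_rat q) = padic_abs p q)"
    then obtain p where p: "Factorial_Ring.prime p" "\<forall>q. v (of_rat q) = padic_abs p q" by blast
    hence "p \<noteq> 0" using prime_gt_0_nat by auto
    thus ?thesis using p by (intro exI[of _ p]) (simp add: base_abs_def)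
  next
    assume "\<forall>q. v (of_rat q) = real_of_rat \<bar>q\<bar>"
    thus ?thesis by (intro exI[of _ 0]) (simp add: base_abs_def)
  qed
  then obtain p where "place_index p" "\<forall>q. v (of_rat q) = base_abs p q" by blast
  thus "v \<in> (\<Union>p\<in>{p. place_index p}. places_over p K)"
    using v base_abs_gt_1[of p] by (auto simp: places_over_def nontrivial_over_def)
next
  fix v assume "v \<in> (\<Union>p\<in>{p. place_index p}. places_over p K)"
  then obtain p where p: "place_index p" "v \<in> extensional K" "absolute_value_on K v" "\<forall>q. v (of_rat q) = base_abs p q"
    by (auto simp: places_over_def nontrivial_over_def)
  thus "v \<in> places K" by (cases "p = 0") (auto simp: places_def base_abs_def)
qed

text \<open>The prime p has size below 1 at its own place and at no other one.\<close>

lemma base_abs_inj: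
  assumes "place_index p" "place_index p'" "base_abs p = base_abs p'" shows "p = p'"
proof (rule ccontr)
  have *: False if p: "Factorial_Ring.prime p" and p': "place_index p'" "p \<noteq> p'" "base_abs p = base_abs p'" for p p'
  proof -
    have "p > 1" using prime_gt_1_nat[OF p] .
    have "base_abs p (of_nat p) = inverse (real p)" using padic_abs_self[OF p] \<open>p > 1\<close> by (simp add: base_abs_def)
    also have "\<dots> < 1" using \<open>p > 1\<close> by (simp add: inverse_less_1_iff)
    finally have lt: "base_abs p' (of_nat p) < 1" using p'(3) by simp
    show False
    proof (cases "p' = 0")
      case True thus False using lt \<open>p > 1\<close> by (simp add: base_abs_def)
    next
      case False
      hence "Factorial_Ring.prime p'" using p' by simp
      moreover from this have "\<not> p' dvd p" using p p'(2) primes_dvd_imp_eq by blast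
      hence "\<not> int p' dvd int p" by simp
      ultimately have "ext_place p' (of_int (int p)) = 1" by (intro ext_place_of_int_coprime)
      hence "padic_abs p' (of_nat p) = 1" using ext_place_of_rat[of p' "of_nat p"] \<open>Factorial_Ring.prime p'\<close> by simp
      thus False using lt False by (simp add: base_abs_def)
    qed
  qed
  assume "p \<noteq> p'"
  thus False using *[of p p'] *[of p' p] assms by metis
qed

lemma places_over_disjoint:
  assumes "place_index p" "place_index p'" "p \<noteq> p'" shows "places_over p K \<inter> places_over p' K = {}"
proof (rule ccontr)
  assume "\<not> ?thesis"
  then obtain v where "v \<in> places_over p K" "v \<in> places_over p' K" by blast
  hence "\<forall>q. v (of_rat q) = base_abs p q" "\<forall>q. v (of_rat q) = base_abs p' q"
    unfolding places_over_def nontrivial_over_def by blast+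
  hence "base_abs p = base_abs p'" by (simp add: fun_eq_iff)
  thus False using base_abs_inj assms by blast
qed

definition conj_place :: "nat \<Rightarrow> complex \<Rightarrow> complex \<Rightarrow> complex \<Rightarrow> real" where
  "conj_place p \<theta> z = restrict (\<lambda>a. ext_place p (conj_map \<theta> z a)) (rat_adjoin \<theta>)"

context
  fixes f \<theta> assumes f: "is_minpoly f \<theta>" and alg: "algebraic \<theta>"
begin

lemma conjugate_places_ext_place: "place_index p \<Longrightarrow> conjugate_places f \<theta> (ext_place p) (base_abs p)"
  using f alg nontrivial_ext_place by unfold_locales auto

lemma conj_abs_eq: assumes "place_index p" shows "conjugate_places.conj_abs \<theta> (ext_place p) z = conj_place p \<theta> z"
  unfolding conjugate_places.conj_abs_def[OF conjugate_places_ext_place[OF assms]] conjugate_places.number_field_def[OF conjugate_places_ext_place[OF assms]] conj_place_def ..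

lemma finite_roots_minpoly: "finite (roots_of f)" using finite_roots_of is_minpoly_nonzero[OF f] by blast

text \<open>That every place comes from an embedding is \<open>S_nonempty\<close>.\<close>

lemma places_over_eq:
  assumes p: "place_index p" shows "places_over p (rat_adjoin \<theta>) = conj_place p \<theta> ` roots_of f"
proof (intro equalityI subsetI)
  interpret conjugate_places f \<theta> "ext_place p" "base_abs p" by (rule conjugate_places_ext_place[OF p])
  fix v assume "v \<in> places_over p (rat_adjoin \<theta>)"
  then interpret conjugate_places_at f \<theta> "ext_place p" "base_abs p" v
    by unfold_locales (auto simp: places_over_def number_field_def)
  obtain z where "z \<in> S" using S_nonempty by blast
  thus "v \<in> conj_place p \<theta> ` roots_of f" using conj_abs_eq[OF p] by (auto simp: S_def)
next
  interpret conjugate_places f \<theta> "ext_place p" "base_abs p" by (rule conjugate_places_ext_place[OF p])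
  fix v assume "v \<in> conj_place p \<theta> ` roots_of f"
  then obtain z where "z \<in> roots_of f" "v = conj_place p \<theta> z" by blast
  thus "v \<in> places_over p (rat_adjoin \<theta>)"
    using conj_abs_nontrivial[of z] conj_abs_eq[OF p, of z] by (simp add: places_over_def number_field_def) (simp add: conj_place_def)
qed

lemma local_degree_places_over:
  assumes p: "place_index p" and v: "v \<in> places_over p (rat_adjoin \<theta>)"
  shows "local_degree (rat_adjoin \<theta>) v = card {z \<in> roots_of f. conj_place p \<theta> z = v}"
proof -
  interpret conjugate_places f \<theta> "ext_place p" "base_abs p" by (rule conjugate_places_ext_place[OF p])
  interpret conjugate_places_at f \<theta> "ext_place p" "base_abs p" v
    using v by unfold_locales (auto simp: places_over_def number_field_def)
  show ?thesis using local_degree_eq unfolding S_def conj_abs_eq[OF p] number_field_def .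
qed

text \<open>Group the embeddings by the place they induce: the local degree is the size of the
  group.\<close>

lemma sum_places_over:
  assumes p: "place_index p"
  shows "(\<Sum>v\<in>places_over p (rat_adjoin \<theta>). real (local_degree (rat_adjoin \<theta>) v) * g v) =
    (\<Sum>z\<in>roots_of f. g (conj_place p \<theta> z))"
proof -
  have "(\<Sum>z\<in>roots_of f. g (conj_place p \<theta> z)) = (\<Sum>v\<in>conj_place p \<theta> ` roots_of f.
      \<Sum>z\<in>{z \<in> roots_of f. conj_place p \<theta> z = v}. g (conj_place p \<theta> z))"
    by (rule sum.image_gen[OF finite_roots_minpoly])
  also have "\<dots> = (\<Sum>v\<in>places_over p (rat_adjoin \<theta>). real (local_degree (rat_adjoin \<theta>) v) * g v)"
    unfolding places_over_eq[OF p]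
    by (intro sum.cong refl) (simp add: local_degree_places_over[OF p] places_over_eq[OF p])
  finally show ?thesis ..
qed

lemma Max_powr:
  assumes "finite A" "A \<noteq> {}" "\<And>a. a \<in> A \<Longrightarrow> a \<ge> 0" "c > 0"
  shows "Max ((\<lambda>a. a powr c) ` A) = Max A powr (c :: real)"
proof (rule Max_eqI)
  show "y \<le> Max A powr c" if "y \<in> (\<lambda>a. a powr c) ` A" for y
    using that assms by (auto intro!: powr_mono2)
  show "Max A powr c \<in> (\<lambda>a. a powr c) ` A" using Max_in[OF assms(1,2)] by blast
qed (use assms in auto)

text \<open>Outside \<open>T\<close> the logarithms vanish, so \<open>infsum\<close> becomes a
  finite sum. Leaving \<open>T\<close> free lets one set of primes serve for all groups of
  coordinates and for the product formula at once.\<close>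

lemma log_height_over_rat_adjoin:
  assumes y: "\<And>j. j \<le> n \<Longrightarrow> y j \<in> rat_adjoin \<theta> \<and> y j \<noteq> 0"
    and T: "finite T" "\<And>p. p \<in> T \<Longrightarrow> Factorial_Ring.prime p"
    "\<And>p z j. Factorial_Ring.prime p \<Longrightarrow> p \<notin> T \<Longrightarrow> z \<in> roots_of f \<Longrightarrow> j \<le> n \<Longrightarrow> ext_place p (conj_map \<theta> z (y j)) = 1"
  shows "log_height_over (rat_adjoin \<theta>) n y = (\<Sum>z\<in>roots_of f. \<Sum>p\<in>insert 0 T.
      ln (Max ((\<lambda>j. ext_place p (conj_map \<theta> z (y j))) ` {0..n}))) / degree f"
proof -
  define K where "K = rat_adjoin \<theta>"
  define D where "D = real (degree f)"
  have D: "D > 0" "real (field_degree K) = D"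
    using is_minpoly_degree_pos[OF f] field_degree_rat_adjoin[OF f] by (simp_all add: D_def K_def)
  define h where "h = (\<lambda>v :: complex \<Rightarrow> real. ln (Max ((\<lambda>j. v (y j)) ` {0..n})))"
  define t where "t = (\<lambda>v. ln (Max ((\<lambda>j. normalized_abs K v (y j)) ` {0..n})))"
  have T0: "place_index p" if "p \<in> insert 0 T" for p using that T(2) by auto
  have fin: "finite (places_over p K)" if "place_index p" for p
    unfolding K_def places_over_eq[OF that] using finite_roots_minpoly by blast
  have t_eq: "t v = real (local_degree K v) * h v / D" if p: "place_index p" and v: "v \<in> places_over p K" for v p
  proof -
    have av: "absolute_value_on K v" using v by (auto simp: places_over_def nontrivial_over_def)
    \<comment> \<open>Some embedding induces \<open>v\<close>, so the local degree is positive; a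
      positive exponent lets \<open>powr\<close> commute with the maximum.\<close>
    have "card {z \<in> roots_of f. conj_place p \<theta> z = v} > 0"
      using v finite_roots_minpoly unfolding K_def places_over_eq[OF p] by (auto simp: card_gt_0_iff)
    hence ld: "local_degree K v > 0" using local_degree_places_over[OF p] v by (simp add: K_def)
    define A where "A = (\<lambda>j. v (y j)) ` {0..n}"
    have vpos: "v (y j) > 0" if "j \<le> n" for j
    proof -
      have "y j \<in> K" "y j \<noteq> 0" using y[OF that] by (auto simp: K_def)
      thus ?thesis using av unfolding absolute_value_on_def by (metis order.not_eq_order_implies_strict)
    qed
    have pos: "a > 0" if "a \<in> A" for a using that vpos by (auto simp: A_def)
    have A: "finite A" "A \<noteq> {}" by (auto simp: A_def)
    have "(\<lambda>j. normalized_abs K v (y j)) ` {0..n} = (\<lambda>a. a powr (real (local_degree K v) / D)) ` A"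
      unfolding A_def image_image normalized_abs_def D ..
    moreover have "Max ((\<lambda>a. a powr (real (local_degree K v) / D)) ` A) = Max A powr (real (local_degree K v) / D)"
      using pos ld D(1) by (intro Max_powr[OF A]) (auto intro: less_imp_le)
    ultimately have "t v = ln (Max A powr (real (local_degree K v) / D))" unfolding t_def by (simp only:)
    also have "\<dots> = real (local_degree K v) / D * ln (Max A)"
      using pos[OF Max_in[OF A]] by (simp add: ln_powr)
    finally show ?thesis by (simp add: h_def A_def)
  qed
  have h0: "h v = 0" if p: "place_index p" "p \<notin> insert 0 T" and v: "v \<in> places_over p K" for v p
  proof -
    obtain z where z: "z \<in> roots_of f" "v = conj_place p \<theta> z" using v unfolding K_def places_over_eq[OF p(1)] by blast
    have "v (y j) = 1" if "j \<le> n" for j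
      using T(3)[of p z j] p z that y[of j] by (auto simp: conj_place_def)
    hence "(\<lambda>j. v (y j)) ` {0..n} = {1}" by (auto simp: image_iff)
    thus ?thesis by (simp add: h_def)
  qed
  define PT where "PT = (\<Union>p\<in>insert 0 T. places_over p K)"
  have "log_height_over K n y = infsum t (places K)" by (simp add: log_height_over_def t_def)
  also have "\<dots> = infsum t PT"
  proof (rule infsum_cong_neutral)
    show "t v = 0" if v: "v \<in> places K - PT" for v
    proof -
      obtain p where p: "place_index p" "v \<in> places_over p K" using v unfolding places_eq by blast
      have "p \<notin> insert 0 T" using p(2) v unfolding PT_def by blast
      thus ?thesis using t_eq[OF p] h0[OF p(1) _ p(2)] by simp
    qed
    show "t v = 0" if "v \<in> PT - places K" for v using that T0 unfolding PT_def places_eq by blast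
  qed simp
  also have "\<dots> = sum t PT"
  proof (rule infsum_finite)
    show "finite PT" unfolding PT_def by (rule finite_UN_I) (use T(1) fin[OF T0] in auto)
  qed
  also have "\<dots> = (\<Sum>p\<in>insert 0 T. sum t (places_over p K))" unfolding PT_def
  proof (rule sum.UNION_disjoint)
    show "finite (insert 0 T)" using T(1) by simp
    show "\<forall>p\<in>insert 0 T. finite (places_over p K)" using fin[OF T0] by blast
    show "\<forall>p\<in>insert 0 T. \<forall>p'\<in>insert 0 T. p \<noteq> p' \<longrightarrow> places_over p K \<inter> places_over p' K = {}"
      using places_over_disjoint[OF T0 T0] by blast
  qed
  also have "\<dots> = (\<Sum>p\<in>insert 0 T. (\<Sum>v\<in>places_over p K. real (local_degree K v) * h v) / D)"
    unfolding sum_divide_distrib by (intro sum.cong refl t_eq T0)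
  also have "\<dots> = (\<Sum>p\<in>insert 0 T. (\<Sum>z\<in>roots_of f. h (conj_place p \<theta> z)) / D)"
    unfolding K_def by (intro sum.cong refl arg_cong2[of _ _ _ _ "(/)"] sum_places_over T0)
  also have "\<dots> = (\<Sum>z\<in>roots_of f. \<Sum>p\<in>insert 0 T. h (conj_place p \<theta> z)) / D"
    unfolding sum_divide_distrib[symmetric] by (simp only: sum.swap[of _ "insert 0 T"])
  also have "(\<Sum>z\<in>roots_of f. \<Sum>p\<in>insert 0 T. h (conj_place p \<theta> z)) = (\<Sum>z\<in>roots_of f. \<Sum>p\<in>insert 0 T.
      ln (Max ((\<lambda>j. ext_place p (conj_map \<theta> z (y j))) ` {0..n})))"
  proof (intro sum.cong refl)
    fix z p assume "p \<in> insert 0 T"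
    have "(\<lambda>j. conj_place p \<theta> z (y j)) ` {0..n} = (\<lambda>j. ext_place p (conj_map \<theta> z (y j))) ` {0..n}"
      using y by (intro image_cong) (auto simp: conj_place_def)
    thus "h (conj_place p \<theta> z) = ln (Max ((\<lambda>j. ext_place p (conj_map \<theta> z (y j))) ` {0..n}))" by (simp add: h_def)
  qed
  finally show ?thesis by (simp add: K_def D_def)
qed

end

text \<open>Immediate from averaging: every conjugate of \<open>rat_eval q \<theta>\<close> is hit equally often.\<close>

lemma roots_of_surj:
  assumes f: "is_minpoly f \<theta>" and g: "is_minpoly g (rat_eval q \<theta>)" and w: "w \<in> roots_of g"
  obtains z where "z \<in> roots_of f" "w = rat_eval q z"
proof -
  have "(\<Sum>z\<in>roots_of f. (if rat_eval q z = w then 1 else 0 :: real)) / degree f =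
      (\<Sum>v\<in>roots_of g. if v = w then 1 else 0) / degree g"
    by (rule sum_conj_average[OF f g])
  also have "\<dots> = 1 / degree g" using w finite_roots_of[OF is_minpoly_nonzero[OF g]] by simp
  also have "\<dots> > 0" using is_minpoly_degree_pos[OF g] by simp
  finally have "\<exists>z\<in>roots_of f. rat_eval q z = w" by (rule contrapos_pp) (simp add: sum.neutral)
  thus ?thesis using that by blast
qed

text \<open>\<open>log_height\<close> uses the field generated by the coordinates, which has its own
  primitive element \<open>\<kappa>\<close>. Each embedding of the large field restricts to one of
  the small field, and \<open>sum_conj_average\<close> converts the averages.\<close>

lemma log_height_eq:
  assumes f: "is_minpoly f \<theta>" and y: "\<And>j. j \<le> n \<Longrightarrow> y j \<in> rat_adjoin \<theta> \<and> y j \<noteq> 0" and alg: "algebraic \<theta>"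
    and T: "finite T" "\<And>p. p \<in> T \<Longrightarrow> Factorial_Ring.prime p"
    "\<And>p z j. Factorial_Ring.prime p \<Longrightarrow> p \<notin> T \<Longrightarrow> z \<in> roots_of f \<Longrightarrow> j \<le> n \<Longrightarrow> ext_place p (conj_map \<theta> z (y j)) = 1"
  shows "log_height n y = (\<Sum>z\<in>roots_of f. \<Sum>p\<in>insert 0 T.
      ln (Max ((\<lambda>j. ext_place p (conj_map \<theta> z (y j))) ` {0..n}))) / degree f"
proof -
  have sub: "complex_subfield (rat_adjoin \<theta>)" by (rule complex_subfield_rat_adjoin[OF f])
  have "rat_adjoin \<theta> \<subseteq> algebraic_numbers" by (rule csf_rat_adjoin[OF complex_subfield_algebraic]) (use alg in simp)
  moreover have y_sub: "y ` {0..n} \<subseteq> rat_adjoin \<theta>" using y by auto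
  ultimately have "algebraic a" if "a \<in> y ` {0..n}" for a using that by blast
  then obtain \<kappa> where \<kappa>: "algebraic \<kappa>" "generate_field complex_ring (y ` {0..n}) = rat_adjoin \<kappa>"
    by (rule primitive_element[rotated]) auto
  have "generate_field complex_ring (y ` {0..n}) \<subseteq> rat_adjoin \<theta>"
    using field.generate_field_min_subfield1[OF complex_ring_field, of "y ` {0..n}" "rat_adjoin \<theta>"] y_sub sub
      subfield_iff_complex_subfield by simp
  hence "\<kappa> \<in> rat_adjoin \<theta>" using \<kappa>(2) in_rat_adjoin_self[of \<kappa>] by auto
  then obtain q where q: "\<kappa> = rat_eval q \<theta>" by (auto simp: rat_adjoin_iff)
  obtain g where g: "is_minpoly g \<kappa>" using exists_minpoly[OF \<kappa>(1)] .
  have yk: "y j \<in> rat_adjoin \<kappa>" if "j \<le> n" for j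
    using generate_field.incl[of "y j" "y ` {0..n}" complex_ring] that \<kappa>(2) by auto
  have conj: "conj_map \<kappa> (rat_eval q z) (y j) = conj_map \<theta> z (y j)" if z: "z \<in> roots_of f" and j: "j \<le> n" for z j
  proof -
    obtain r where r: "y j = rat_eval r \<kappa>" using yk[OF j] by (auto simp: rat_adjoin_iff)
    have "conj_map \<kappa> (rat_eval q z) (y j) = rat_eval r (rat_eval q z)"
      unfolding r by (rule conj_map_rat_eval[OF g conj_in_roots_of[OF f g[unfolded q] z]])
    also have "\<dots> = conj_map \<theta> z (rat_eval (pcompose r q) \<theta>)" unfolding conj_map_rat_eval[OF f z] by simp
    also have "rat_eval (pcompose r q) \<theta> = y j" by (simp add: r q)
    finally show ?thesis .
  qed
  define \<Phi> where "\<Phi> = (\<lambda>w. \<Sum>p\<in>insert 0 T. ln (Max ((\<lambda>j. ext_place p (conj_map \<kappa> w (y j))) ` {0..n})))"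
  have "log_height n y = log_height_over (rat_adjoin \<kappa>) n y" by (simp add: log_height_def \<kappa>(2))
  also have "\<dots> = (\<Sum>w\<in>roots_of g. \<Phi> w) / degree g" unfolding \<Phi>_def
  proof (rule log_height_over_rat_adjoin[OF g \<kappa>(1) _ T(1,2)])
    show "y j \<in> rat_adjoin \<kappa> \<and> y j \<noteq> 0" if "j \<le> n" for j using yk y that by blast
    show "ext_place p (conj_map \<kappa> w (y j)) = 1" if pw: "Factorial_Ring.prime p" "p \<notin> T" "w \<in> roots_of g" "j \<le> n" for p w j
    proof -
      obtain z where "z \<in> roots_of f" "w = rat_eval q z" using roots_of_surj[OF f g[unfolded q] pw(3)] .
      thus ?thesis using T(3)[of p z j] conj pw by simp
    qed
  qed auto
  also have "\<dots> = (\<Sum>z\<in>roots_of f. \<Phi> (rat_eval q z)) / degree f"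
    by (rule sum_conj_average[OF f g[unfolded q], symmetric])
  also have "(\<Sum>z\<in>roots_of f. \<Phi> (rat_eval q z)) = (\<Sum>z\<in>roots_of f. \<Sum>p\<in>insert 0 T.
      ln (Max ((\<lambda>j. ext_place p (conj_map \<theta> z (y j))) ` {0..n})))"
    unfolding \<Phi>_def by (intro sum.cong refl arg_cong[of _ _ ln] arg_cong[of _ _ Max] image_cong) (simp add: conj)
  finally show ?thesis .
qed

lemma global_product_formula:
  assumes f: "is_minpoly f \<theta>" and alg: "algebraic \<theta>" and a: "a \<in> rat_adjoin \<theta>" "a \<noteq> 0"
    and T: "finite T" "\<And>p. p \<in> T \<Longrightarrow> Factorial_Ring.prime p"
    "\<And>p z. Factorial_Ring.prime p \<Longrightarrow> p \<notin> T \<Longrightarrow> z \<in> roots_of f \<Longrightarrow> ext_place p (conj_map \<theta> z a) = 1"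
  shows "(\<Sum>z\<in>roots_of f. \<Sum>p\<in>insert 0 T. ln (ext_place p (conj_map \<theta> z a))) = 0"
proof -
  have ps: "conjugate_places f \<theta> (ext_place p) (base_abs p)" if "place_index p" for p
    by (rule conjugate_places_ext_place[OF f alg that])
  interpret conjugate_places f \<theta> "ext_place 0" "base_abs 0" by (rule ps) simp
  have aF: "a \<in> \<F>" using a by (simp add: number_field_def)
  have fin: "finite (roots_of f)" using finite_roots_of is_minpoly_nonzero[OF f] by blast
  obtain h where h: "map_poly of_rat h = (\<Prod>z\<in>roots_of f. [:- conj_map \<theta> z a, 1:])"
    using charpoly_conj[OF aF] by blast
  \<comment> \<open>Up to sign the constant coefficient is the norm of a. It is rational, so the
    product formula for rationals applies to it.\<close>
  have "of_rat (coeff h 0) = poly (map_poly of_rat h) (0 :: complex)" by (simp add: poly_0_coeff_0)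
  also have "\<dots> = (\<Prod>z\<in>roots_of f. - conj_map \<theta> z a)" unfolding h poly_prod by simp
  finally have h0: "(\<Prod>z\<in>roots_of f. - conj_map \<theta> z a) = of_rat (coeff h 0)" ..
  define c where "c = coeff h 0"
  have nz: "conj_map \<theta> z a \<noteq> 0" if "z \<in> roots_of f" for z using conj_eq_0_iff[OF that aF] a(2) by simp
  have cnz: "c \<noteq> 0" using h0 nz fin by (auto simp: c_def)
  have E: "ext_place p (of_rat c) = (\<Prod>z\<in>roots_of f. ext_place p (conj_map \<theta> z a))" if p: "place_index p" for p
  proof -
    interpret u: absolute_value algebraic_numbers "ext_place p"
      by (rule absolute_value_ext_place[OF p])
    note ca = conj_algebraic[OF _ aF]
    have "ext_place p (of_rat c) = (\<Prod>z\<in>roots_of f. ext_place p (- conj_map \<theta> z a))"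
      unfolding c_def h0[symmetric] by (rule u.prod) (rule csf_minus[OF complex_subfield_algebraic ca])
    also have "\<dots> = (\<Prod>z\<in>roots_of f. ext_place p (conj_map \<theta> z a))"
      by (intro prod.cong refl u.minus ca)
    finally show ?thesis .
  qed
  have L: "(\<Sum>z\<in>roots_of f. ln (ext_place p (conj_map \<theta> z a))) = ln (base_abs p c)" if p: "place_index p" for p
  proof -
    interpret u: absolute_value algebraic_numbers "ext_place p"
      by (rule absolute_value_ext_place[OF p])
    have "ln (base_abs p c) = ln (\<Prod>z\<in>roots_of f. ext_place p (conj_map \<theta> z a))"
      using E[OF p] nontrivial_ext_place[OF p] by (simp add: nontrivial_over_def)
    also have "\<dots> = (\<Sum>z\<in>roots_of f. ln (ext_place p (conj_map \<theta> z a)))"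
      by (rule ln_prod[OF fin]) (use u.eq_0_iff[OF conj_algebraic[OF _ aF]] nz in blast)
    finally show ?thesis ..
  qed
  have "0 \<notin> T" using T(2) prime_gt_0_nat by blast
  have bT: "(\<Sum>p\<in>T. ln (base_abs p c)) = (\<Sum>p\<in>T. ln (padic_abs p c))"
    using \<open>0 \<notin> T\<close> by (intro sum.cong refl) (auto simp: base_abs_def)
  have "(\<Sum>z\<in>roots_of f. \<Sum>p\<in>insert 0 T. ln (ext_place p (conj_map \<theta> z a))) =
      (\<Sum>p\<in>insert 0 T. \<Sum>z\<in>roots_of f. ln (ext_place p (conj_map \<theta> z a)))" by (rule sum.swap)
  also have "\<dots> = (\<Sum>p\<in>insert 0 T. ln (base_abs p c))" using T(2) by (intro sum.cong refl L) auto
  also have "(\<Sum>p\<in>insert 0 T. ln (base_abs p c)) = ln (real_of_rat \<bar>c\<bar>) + (\<Sum>p\<in>T. ln (padic_abs p c))"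
    using T(1) \<open>0 \<notin> T\<close> bT by (simp add: base_abs_def[of 0])
  also have "\<dots> = 0"
  proof (rule rational_product_formula[OF cnz T(1,2)])
    fix p assume p: "Factorial_Ring.prime p" "p \<notin> T"
    have "padic_abs p c = ext_place p (of_rat c)" using ext_place_of_rat[OF p(1)] by simp
    also have "\<dots> = 1" using E[of p] p T(3) by simp
    finally show "padic_abs p c = 1" .
  qed auto
  finally show ?thesis .
qed

section \<open>The local inequalities\<close>

text \<open>A convex function vanishing at 0 lies below its chord from the origin.\<close>

lemma sinh_le_linear:
  assumes "0 \<le> p" "p \<le> S" "S > 0" shows "S * sinh p \<le> p * sinh (S :: real)"
proof -
  have "convex_on {0..} (sinh :: real \<Rightarrow> real)"
  proof (rule convex_on_realI[where f' = cosh])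
    show "(sinh has_real_derivative cosh x) (at x)" for x :: real by (auto intro!: derivative_eq_intros)
  qed (auto simp: cosh_real_nonneg_le_iff)
  hence "sinh ((1 - p / S) *\<^sub>R 0 + (p / S) *\<^sub>R S) \<le> (1 - p / S) * sinh 0 + (p / S) * sinh S"
    using assms by (intro convex_onD) auto
  thus ?thesis using assms by (simp add: field_simps)
qed

text \<open>1 - exp(-2p) is concave in p and vanishes at 0, so its quotient by p decreases.\<close>

lemma one_minus_exp_le_linear:
  assumes "0 < S" "S \<le> p" shows "S * (1 - exp (- 2 * p)) \<le> p * (1 - exp (- 2 * S :: real))"
proof -
  have "exp ((1 - S / p) *\<^sub>R 0 + (S / p) *\<^sub>R (- 2 * p)) \<le> (1 - S / p) * exp 0 + (S / p) * exp (- 2 * p)"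
    using assms convex_onD[OF exp_convex, of "S / p" 0 "- 2 * p"] by auto
  thus ?thesis using assms by (simp add: field_simps)
qed

text \<open>The bound is linear in p, so that it can be summed over monomials. For p above S,
  exp(-D) is at most exp(-p) and the concavity of 1 - exp(-2p) applies; below S it is at most
  exp(-S) and the convexity of sinh applies.\<close>

lemma exp_sinh_bound:
  assumes "S > 0" "p \<ge> 0" "D \<ge> p" "D \<ge> S"
  shows "exp (- D) * (exp p - exp (- p)) \<le> p / S * (1 - exp (- 2 * S :: real))"
proof (cases "p \<ge> S")
  case True
  have "exp (- D) * (exp p - exp (- p)) \<le> exp (- p) * (exp p - exp (- p))"
    using assms by (intro mult_right_mono) auto
  also have "\<dots> = 1 - exp (- 2 * p)" by (simp add: algebra_simps flip: exp_add)
  also have "\<dots> \<le> p / S * (1 - exp (- 2 * S))"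
    using one_minus_exp_le_linear[OF assms(1) True] assms(1) by (simp add: field_simps)
  finally show ?thesis .
next
  case False
  have "exp (- D) * (exp p - exp (- p)) \<le> exp (- S) * (exp p - exp (- p))"
    using assms by (intro mult_right_mono) auto
  also have "\<dots> = exp (- S) * (2 * sinh p)" by (simp add: sinh_def)
  also have "\<dots> \<le> exp (- S) * (2 * (p / S * sinh S))"
    using sinh_le_linear[of p S] False assms by (intro mult_left_mono) (auto simp: field_simps)
  also have "\<dots> = p / S * (exp (- S) * (exp S - exp (- S)))" by (simp add: sinh_def)
  also have "exp (- S) * (exp S - exp (- S)) = 1 - exp (- 2 * S)" by (simp add: algebra_simps flip: exp_add)
  finally show ?thesis .
qed

text \<open>Since the coefficients are real, the point \<open>cnj x\<close> is a zero too. Comparing \<open>x\<^sup>-\<^sup>1\<close> with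
  \<open>cnj x\<close> monomial by monomial bounds the value at \<open>x\<^sup>-\<^sup>1\<close>; the two points agree up to a
  positive factor in the coordinates outside \<open>R\<close>.\<close>

lemma reciprocal_value_bound:
  fixes a :: "'m \<Rightarrow> complex" and e :: "'m \<Rightarrow> 'w \<Rightarrow> nat" and d k :: "'w \<Rightarrow> nat" and x :: "'w \<Rightarrow> complex"
  assumes fin: "finite M" "finite W" and R: "R \<subseteq> W" "\<And>w. w \<in> W - R \<Longrightarrow> x w = 1"
    and real: "\<And>m. m \<in> M \<Longrightarrow> cnj (a m) = a m"
    and e: "\<And>m w. m \<in> M \<Longrightarrow> w \<in> W \<Longrightarrow> k w \<le> e m w \<and> e m w \<le> d w"
    and nz: "\<And>w. w \<in> W \<Longrightarrow> x w \<noteq> 0"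
    and zero: "(\<Sum>m\<in>M. a m * (\<Prod>w\<in>W. x w ^ e m w)) = 0"
    and C: "\<And>w. w \<in> R \<Longrightarrow> (\<Sum>m\<in>M. cmod (a m) * real (e m w)) \<le> C" "C \<ge> 0"
  defines "S \<equiv> (\<Sum>w\<in>R. \<bar>ln (cmod (x w))\<bar>)"
  shows "cmod (\<Sum>m\<in>M. a m * (\<Prod>w\<in>W. x w ^ (d w - e m w))) \<le>
    C * (1 - exp (- 2 * S)) * exp (2 * (\<Sum>w\<in>R. real (d w - k w) * max 0 (ln (cmod (x w)))))"
proof (cases "M = {}")
  case True
  have "S \<ge> 0" unfolding S_def by (simp add: sum_nonneg)
  thus ?thesis using True C(2) by simp
next
  case False
  define t where "t = (\<lambda>w. ln (cmod (x w)))"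
  define s where "s = (\<lambda>w. \<bar>t w\<bar>)"
  have t0: "t w = 0" if "w \<in> W - R" for w using R(2)[OF that] by (simp add: t_def)
  have exp_t: "cmod (x w) = exp (t w)" if "w \<in> W" for w using nz[OF that] by (simp add: t_def)
  have finR: "finite R" using R(1) fin(2) finite_subset by blast
  define d' where "d' = (\<lambda>w. real (d w - k w))"
  define e' where "e' = (\<lambda>m w. real (e m w - k w))"
  have kd: "k w \<le> d w" if "w \<in> W" for w using e[OF _ that] False by (meson all_not_in_conv le_trans)
  \<comment> \<open>Where d w = k w, all monomials have the same exponent and w contributes nothing
    to the comparison. For the other variables d w - k w is at least 1, which gives
    \<open>S0 \<le> Dd\<close> as \<open>exp_sinh_bound\<close> demands; \<open>S0\<close> is
    replaced by the larger \<open>S\<close> at the end.\<close>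
  define R0 where "R0 = {w \<in> R. d w > k w}"
  define S0 where "S0 = (\<Sum>w\<in>R0. s w)"
  have R0: "R0 \<subseteq> R" "finite R0" using finR by (auto simp: R0_def)
  have S0: "0 \<le> S0" "S0 \<le> S" unfolding S0_def S_def
    using R0 finR by (auto simp: s_def t_def intro!: sum_nonneg sum_mono2)
  define p where "p = (\<lambda>m. \<Sum>w\<in>R. e' m w * s w)"
  define Dd where "Dd = (\<Sum>w\<in>R. d' w * s w)"
  define E where "E = exp (2 * (\<Sum>w\<in>R. d' w * max 0 (t w)))"
  \<comment> \<open>Divides out the powers k w common to all monomials. Per variable, x^d (x cnj
    x)^(-k) (cnj x)^e equals x^(d-e) \<bar>x\<bar>^(2(e-k)), a positive multiple of the term it is
    compared with. Subtracting the vanishing value at the conjugate point, with this factor, leaves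
    only differences.\<close>
  define \<mu> where "\<mu> = (\<Prod>w\<in>W. inverse ((x w * cnj (x w)) ^ k w))"
  have conj_zero: "(\<Sum>m\<in>M. a m * (\<Prod>w\<in>W. cnj (x w) ^ e m w)) = 0"
  proof -
    have "cnj (\<Sum>m\<in>M. a m * (\<Prod>w\<in>W. x w ^ e m w)) = 0" using zero by simp
    thus ?thesis using real by (simp add: cnj_sum cnj_prod)
  qed
  have "(\<Sum>m\<in>M. a m * (\<Prod>w\<in>W. x w ^ (d w - e m w))) =
      (\<Sum>m\<in>M. a m * (\<Prod>w\<in>W. x w ^ (d w - e m w))) -
      (\<Prod>w\<in>W. x w ^ d w) * \<mu> * (\<Sum>m\<in>M. a m * (\<Prod>w\<in>W. cnj (x w) ^ e m w))"
    using conj_zero by simp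
  also have "\<dots> = (\<Sum>m\<in>M. a m * ((\<Prod>w\<in>W. x w ^ (d w - e m w)) -
      (\<Prod>w\<in>W. x w ^ d w) * \<mu> * (\<Prod>w\<in>W. cnj (x w) ^ e m w)))"
    by (simp add: sum_subtractf sum_distrib_left algebra_simps)
  also have "\<dots> = (\<Sum>m\<in>M. a m * ((\<Prod>w\<in>W. x w ^ (d w - e m w)) *
      (1 - of_real (\<Prod>w\<in>W. cmod (x w) ^ (2 * (e m w - k w))))))"
  proof (intro sum.cong refl arg_cong2[of _ _ _ _ "(*)"])
    fix m assume m: "m \<in> M"
    have "(\<Prod>w\<in>W. x w ^ d w) * \<mu> * (\<Prod>w\<in>W. cnj (x w) ^ e m w) =
        (\<Prod>w\<in>W. x w ^ d w * inverse ((x w * cnj (x w)) ^ k w) * cnj (x w) ^ e m w)"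
      by (simp add: \<mu>_def prod.distrib)
    also have "\<dots> = (\<Prod>w\<in>W. x w ^ (d w - e m w) * of_real (cmod (x w) ^ (2 * (e m w - k w))))"
    proof (intro prod.cong refl)
      fix w assume w: "w \<in> W"
      obtain i j where ij: "e m w = k w + i" "d w = e m w + j" using e[OF m w] by (metis le_Suc_ex)
      have "of_real (cmod (x w) ^ (2 * i)) = (x w * cnj (x w)) ^ i"
        by (simp add: power_mult flip: complex_norm_square)
      thus "x w ^ d w * inverse ((x w * cnj (x w)) ^ k w) * cnj (x w) ^ e m w =
          x w ^ (d w - e m w) * of_real (cmod (x w) ^ (2 * (e m w - k w)))"
        using nz[OF w] by (simp add: ij power_add power_mult_distrib field_simps)
    qed
    also have "\<dots> = (\<Prod>w\<in>W. x w ^ (d w - e m w)) * of_real (\<Prod>w\<in>W. cmod (x w) ^ (2 * (e m w - k w)))"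
      by (simp add: prod.distrib)
    finally show "(\<Prod>w\<in>W. x w ^ (d w - e m w)) - (\<Prod>w\<in>W. x w ^ d w) * \<mu> * (\<Prod>w\<in>W. cnj (x w) ^ e m w) =
      (\<Prod>w\<in>W. x w ^ (d w - e m w)) * (1 - of_real (\<Prod>w\<in>W. cmod (x w) ^ (2 * (e m w - k w))))"
      by (simp add: algebra_simps)
  qed
  finally have "cmod (\<Sum>m\<in>M. a m * (\<Prod>w\<in>W. x w ^ (d w - e m w))) \<le>
      (\<Sum>m\<in>M. cmod (a m * ((\<Prod>w\<in>W. x w ^ (d w - e m w)) *
      (1 - of_real (\<Prod>w\<in>W. cmod (x w) ^ (2 * (e m w - k w)))))))" by (simp only: norm_sum)
  also have "\<dots> = (\<Sum>m\<in>M. cmod (a m) * ((\<Prod>w\<in>W. cmod (x w) ^ (d w - e m w)) *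
      \<bar>1 - (\<Prod>w\<in>W. cmod (x w) ^ (2 * (e m w - k w)))\<bar>))"
  proof (intro sum.cong refl)
    fix m
    have "cmod (1 - of_real y) = \<bar>1 - y\<bar>" for y :: real
      by (metis norm_of_real of_real_1 of_real_diff)
    thus "cmod (a m * ((\<Prod>w\<in>W. x w ^ (d w - e m w)) * (1 - of_real (\<Prod>w\<in>W. cmod (x w) ^ (2 * (e m w - k w)))))) =
        cmod (a m) * ((\<Prod>w\<in>W. cmod (x w) ^ (d w - e m w)) * \<bar>1 - (\<Prod>w\<in>W. cmod (x w) ^ (2 * (e m w - k w)))\<bar>)"
      by (simp only: norm_mult prod_norm[symmetric] norm_power)
  qed
  also have "\<dots> \<le> (\<Sum>m\<in>M. cmod (a m) * (E * (exp (- Dd) * (exp (p m) - exp (- p m)))))"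
  proof (intro sum_mono mult_left_mono)
    fix m assume m: "m \<in> M"
    define q where "q = (\<Sum>w\<in>R. e' m w * t w)"
    have R_sum: "(\<Sum>w\<in>W. h w * t w) = (\<Sum>w\<in>R. h w * t w)" for h
      by (rule sum.mono_neutral_right) (use fin R t0 in auto)
    have 1: "(\<Prod>w\<in>W. cmod (x w) ^ (2 * (e m w - k w))) = exp (2 * q)"
    proof -
      have "(\<Prod>w\<in>W. cmod (x w) ^ (2 * (e m w - k w))) = (\<Prod>w\<in>W. exp (2 * e' m w * t w))"
        by (intro prod.cong refl) (simp add: exp_t e'_def exp_of_nat_mult[symmetric])
      also have "\<dots> = exp (\<Sum>w\<in>W. 2 * e' m w * t w)" by (rule exp_sum[OF fin(2), symmetric])
      also have "(\<Sum>w\<in>W. 2 * e' m w * t w) = 2 * q"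
        unfolding R_sum q_def by (simp add: sum_distrib_left mult_ac)
      finally show ?thesis .
    qed
    have 2: "(\<Prod>w\<in>W. cmod (x w) ^ (d w - e m w)) = exp ((\<Sum>w\<in>R. d' w * t w) - q)"
    proof -
      have "(\<Prod>w\<in>W. cmod (x w) ^ (d w - e m w)) = (\<Prod>w\<in>W. exp ((d' w - e' m w) * t w))"
      proof (intro prod.cong refl)
        fix w assume w: "w \<in> W"
        have "real (d w - e m w) = d' w - e' m w" using e[OF m w] kd[OF w] by (simp add: d'_def e'_def of_nat_diff)
        thus "cmod (x w) ^ (d w - e m w) = exp ((d' w - e' m w) * t w)"
          by (simp add: exp_t[OF w] exp_of_nat_mult[symmetric])
      qed
      also have "\<dots> = exp (\<Sum>w\<in>W. (d' w - e' m w) * t w)" by (rule exp_sum[OF fin(2), symmetric])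
      also have "(\<Sum>w\<in>W. (d' w - e' m w) * t w) = (\<Sum>w\<in>R. d' w * t w) - q"
        unfolding R_sum q_def by (simp add: sum_subtractf left_diff_distrib)
      finally show ?thesis .
    qed
    have "exp (- q) * \<bar>1 - exp (2 * q)\<bar> = \<bar>exp (- q) * (1 - exp (2 * q))\<bar>" by (simp add: abs_mult)
    also have "exp (- q) * (1 - exp (2 * q)) = exp (- q) - exp q" by (simp add: algebra_simps flip: exp_add)
    also have "\<bar>exp (- q) - exp q\<bar> = exp \<bar>q\<bar> - exp (- \<bar>q\<bar>)" by (auto simp: abs_if)
    also have "\<bar>q\<bar> \<le> p m" unfolding q_def p_def s_def
      by (rule order_trans[OF sum_abs]) (auto simp: abs_mult e'_def)
    hence "exp \<bar>q\<bar> - exp (- \<bar>q\<bar>) \<le> exp (p m) - exp (- p m)" by (intro diff_mono) auto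
    finally have 3: "exp (- q) * \<bar>1 - exp (2 * q)\<bar> \<le> exp (p m) - exp (- p m)" .
    \<comment> \<open>By t = 2 max 0 t - \<bar>t\<bar>, the coordinates outside the unit disc are
      collected in \<open>E\<close> and what remains decays like exp(- Dd).\<close>
    have "(\<Sum>w\<in>R. d' w * t w) = 2 * (\<Sum>w\<in>R. d' w * max 0 (t w)) - Dd"
      unfolding Dd_def s_def sum_distrib_left sum_subtractf[symmetric] by (intro sum.cong) (auto simp: max_def abs_if)
    hence 4: "exp (\<Sum>w\<in>R. d' w * t w) = E * exp (- Dd)" by (simp add: E_def exp_diff exp_minus divide_inverse)
    have "(\<Prod>w\<in>W. cmod (x w) ^ (d w - e m w)) * \<bar>1 - (\<Prod>w\<in>W. cmod (x w) ^ (2 * (e m w - k w)))\<bar> =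
        E * exp (- Dd) * (exp (- q) * \<bar>1 - exp (2 * q)\<bar>)"
      unfolding 1 2 exp_diff 4 by (simp add: exp_minus divide_inverse)
    also have "\<dots> \<le> E * exp (- Dd) * (exp (p m) - exp (- p m))"
      using 3 by (intro mult_left_mono) (auto simp: E_def)
    finally show "(\<Prod>w\<in>W. cmod (x w) ^ (d w - e m w)) * \<bar>1 - (\<Prod>w\<in>W. cmod (x w) ^ (2 * (e m w - k w)))\<bar> \<le>
        E * (exp (- Dd) * (exp (p m) - exp (- p m)))" by simp
  qed auto
  also have "\<dots> \<le> E * (C * (1 - exp (- 2 * S0)))"
  proof -
    have p_R0: "p m = (\<Sum>w\<in>R0. e' m w * s w)" if "m \<in> M" for m
      unfolding p_def
    proof (rule sum.mono_neutral_right[OF finR R0(1)], intro ballI)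
      fix w assume "w \<in> R - R0"
      hence "e m w \<le> k w" using e[OF that, of w] R(1) by (auto simp: R0_def)
      thus "e' m w * s w = 0" by (simp add: e'_def)
    qed
    show ?thesis
    proof (cases "S0 = 0")
      case True
      hence "s w = 0" if "w \<in> R0" for w
        using that R0(2) unfolding S0_def by (subst (asm) sum_nonneg_eq_0_iff) (auto simp: s_def)
      hence "p m = 0" if "m \<in> M" for m using p_R0[OF that] by simp
      thus ?thesis using True by simp
    next
      case False
      hence S0p: "S0 > 0" using S0 by simp
      have "(\<Sum>m\<in>M. cmod (a m) * (E * (exp (- Dd) * (exp (p m) - exp (- p m))))) \<le>
          (\<Sum>m\<in>M. cmod (a m) * (E * (p m / S0 * (1 - exp (- 2 * S0)))))"
      proof (intro sum_mono mult_left_mono exp_sinh_bound S0p)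
        fix m assume m: "m \<in> M"
        show "p m \<ge> 0" unfolding p_def by (auto intro!: sum_nonneg simp: e'_def s_def)
        show "p m \<le> Dd" unfolding p_def Dd_def
          using e[OF m] R(1) by (intro sum_mono mult_right_mono) (auto simp: e'_def d'_def s_def intro!: diff_le_mono)
        have "S0 \<le> (\<Sum>w\<in>R0. d' w * s w)" unfolding S0_def
        proof (rule sum_mono)
          fix w assume "w \<in> R0"
          hence "d' w \<ge> 1" by (auto simp: R0_def d'_def)
          thus "s w \<le> d' w * s w" using mult_right_mono[of 1 "d' w" "s w"] by (simp add: s_def)
        qed
        also have "\<dots> \<le> Dd" unfolding Dd_def using R0 finR by (intro sum_mono2) (auto simp: d'_def s_def)
        finally show "S0 \<le> Dd" .
      qed (auto simp: E_def)
      also have "\<dots> = E * ((1 - exp (- 2 * S0)) / S0 * (\<Sum>m\<in>M. cmod (a m) * p m))"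
        by (simp add: sum_distrib_left mult_ac divide_inverse)
      \<comment> \<open>Exchanging the sums gives each variable w the factor formed from \<bar>a
        m\<bar> e m w. This is where the coefficient sums of the partial derivatives, and with them
        C, enter.\<close>
      also have "\<dots> \<le> E * ((1 - exp (- 2 * S0)) / S0 * (C * S0))"
      proof (intro mult_left_mono)
        have "(\<Sum>m\<in>M. cmod (a m) * p m) = (\<Sum>m\<in>M. \<Sum>w\<in>R0. cmod (a m) * e' m w * s w)"
          by (intro sum.cong refl) (simp add: p_R0 sum_distrib_left mult_ac)
        also have "\<dots> = (\<Sum>w\<in>R0. \<Sum>m\<in>M. cmod (a m) * e' m w * s w)" by (rule sum.swap)
        also have "\<dots> = (\<Sum>w\<in>R0. (\<Sum>m\<in>M. cmod (a m) * e' m w) * s w)" by (simp add: sum_distrib_right)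
        also have "\<dots> \<le> (\<Sum>w\<in>R0. C * s w)"
        proof (intro sum_mono mult_right_mono)
          fix w assume w: "w \<in> R0"
          have "(\<Sum>m\<in>M. cmod (a m) * e' m w) \<le> (\<Sum>m\<in>M. cmod (a m) * real (e m w))"
            by (intro sum_mono mult_left_mono) (auto simp: e'_def)
          also have "\<dots> \<le> C" using C(1) w R0 by blast
          finally show "(\<Sum>m\<in>M. cmod (a m) * e' m w) \<le> C" .
        qed (auto simp: s_def)
        also have "\<dots> = C * S0" by (simp add: S0_def sum_distrib_left)
        finally show "(\<Sum>m\<in>M. cmod (a m) * p m) \<le> C * S0" .
      qed (use S0p in \<open>auto simp: E_def\<close>)
      also have "\<dots> = E * (C * (1 - exp (- 2 * S0)))" using S0p by simp
      finally show ?thesis .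
    qed
  qed
  also have "\<dots> \<le> E * (C * (1 - exp (- 2 * S)))"
    using S0 C(2) by (intro mult_left_mono) (auto simp: E_def)
  finally show ?thesis by (simp add: E_def d'_def t_def mult_ac)
qed

section \<open>The equation for the constant of the theorem\<close>

lemma exists_unique_rho:
  fixes C \<delta> :: real
  assumes C: "C > 0" and \<delta>: "\<delta> > 0"
  obtains \<rho> where "\<rho> > 1" "\<And>t. t > 1 \<Longrightarrow> t powr (-2) + inverse C * t powr (- \<delta>) = 1 \<longleftrightarrow> t = \<rho>"
proof -
  define h where "h = (\<lambda>t :: real. t powr (-2) + inverse C * t powr (- \<delta>))"
  \<comment> \<open>The function falls strictly from 1 + 1 / C at t = 1 towards 0 at infinity, so it
    takes the value 1 exactly once.\<close>
  have dec: "h t < h s" if "0 < s" "s < t" for s t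
    unfolding h_def using that C \<delta> by (intro add_strict_mono mult_strict_left_mono powr_less_mono2_neg) auto
  have cont: "continuous_on {1..b} h" for b unfolding h_def by (intro continuous_intros) auto
  have "((\<lambda>t. t powr (-2) + inverse C * t powr (- \<delta>)) \<longlongrightarrow> 0 + inverse C * 0) at_top"
    using \<delta> by (intro tendsto_intros tendsto_neg_powr filterlim_ident) auto
  hence "(h \<longlongrightarrow> 0) at_top" by (simp add: h_def)
  hence "\<forall>\<^sub>F t in at_top. h t < 1" by (rule order_tendstoD) simp
  then obtain N where N: "\<And>t. t \<ge> N \<Longrightarrow> h t < 1" by (auto simp: eventually_at_top_linorder)
  define b where "b = max N 2"
  have h1: "h 1 > 1" using C by (simp add: h_def)
  have "\<exists>t\<ge>1. t \<le> b \<and> h t = 1"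
    using N[of b] h1 cont by (intro IVT2') (auto simp: b_def intro: less_imp_le)
  then obtain \<rho> where \<rho>: "\<rho> \<ge> 1" "h \<rho> = 1" by blast
  have "\<rho> > 1" using \<rho> h1 by (cases "\<rho> = 1") auto
  moreover have "h t = 1 \<longleftrightarrow> t = \<rho>" if "t > 1" for t
    using dec[of t \<rho>] dec[of \<rho> t] \<rho> that \<open>\<rho> > 1\<close> by (cases t \<rho> rule: linorder_cases) auto
  ultimately show ?thesis using that by (simp add: h_def)
qed

text \<open>The exponent \<open>B\<close> is chosen so that \<open>P \<mapsto> P\<^bsup>1 - B\<delta>\<^esup> (C (1 - P\<^sup>2))\<^bsup>B\<^esup>\<close> is stationary at \<open>P = 1 / \<rho>\<close>.\<close>

lemma rho_optimal:
  fixes C \<delta> \<rho> :: real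
  assumes C: "C > 0" and \<delta>: "\<delta> > 0" and \<rho>: "\<rho> > 1" "\<rho> powr (-2) + inverse C * \<rho> powr (- \<delta>) = 1"
  obtains B where "B > 0" "B * \<delta> \<le> 1"
    "\<And>S. S > 0 \<Longrightarrow> ln \<rho> \<le> (1 - B * \<delta>) * S - B * ln C - B * ln (1 - exp (- 2 * S))"
proof -
  define P where "P = 1 / \<rho>"
  have P: "P > 0" "P < 1" using \<rho> by (auto simp: P_def)
  have P2: "P\<^sup>2 < 1" "P\<^sup>2 > 0" using P by (auto simp: power_less_one_iff)
  \<comment> \<open>Solves 1 - B \<delta> = 2 B P^2 / (1 - P^2), which says that the S-derivative of
    the lower bound for ln \<rho>'s competitor vanishes at exp(-S) = P.\<close>
  define B where "B = 1 / (\<delta> + 2 * P\<^sup>2 / (1 - P\<^sup>2))"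
  have den: "\<delta> + 2 * P\<^sup>2 / (1 - P\<^sup>2) > 0" using \<delta> P2 by (simp add: add_pos_pos)
  have B: "B > 0" using den by (simp add: B_def)
  have Bd: "1 - B * \<delta> = B * (2 * P\<^sup>2 / (1 - P\<^sup>2))"
  proof -
    have "B * (\<delta> + 2 * P\<^sup>2 / (1 - P\<^sup>2)) = 1" using den by (simp add: B_def)
    thus ?thesis by (simp add: algebra_simps)
  qed
  have r2: "\<rho> powr (-2) = P\<^sup>2" using \<rho> by (simp add: P_def powr_minus_divide power_one_over)
  have "\<rho> powr (- \<delta>) = P powr \<delta>" using \<rho> by (simp add: P_def powr_minus_divide powr_divide)
  hence "1 - P\<^sup>2 = P powr \<delta> / C" using \<rho>(2) r2 by (simp add: divide_inverse mult.commute)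
  hence "ln (1 - P\<^sup>2) = \<delta> * ln P - ln C" using C P by (simp add: ln_div ln_powr)
  moreover have "ln P = - ln \<rho>" using \<rho> by (simp add: P_def ln_div)
  ultimately have base: "ln (1 - P\<^sup>2) = - \<delta> * ln \<rho> - ln C" by simp
  show ?thesis
  proof (rule that[OF B])
    have "1 - B * \<delta> \<ge> 0" unfolding Bd using B P2 by simp
    thus "B * \<delta> \<le> 1" by simp
    fix S :: real assume S: "S > 0"
    define Q where "Q = exp (- 2 * S)"
    have Q: "Q > 0" "Q < 1" using S by (auto simp: Q_def)
    have lnQ: "ln Q = - 2 * S" by (simp add: Q_def)
    \<comment> \<open>Minimality by two tangents: ln y \<le> y - 1 at y = Q / P^2 and at y = (1 - Q)
      / (1 - P^2). With the weights P^2 / (1 - P^2) and 1 the right-hand sides cancel. Both are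
      equalities at Q = P^2, that is at S = ln \<rho>.\<close>
    have "ln (Q / P\<^sup>2) \<le> Q / P\<^sup>2 - 1" using Q P2 by (intro ln_le_minus_one) auto
    hence 1: "- 2 * S + 2 * ln \<rho> \<le> Q / P\<^sup>2 - 1"
      using Q P \<rho> \<open>ln P = - ln \<rho>\<close> by (simp add: ln_div lnQ ln_realpow)
    have "ln ((1 - Q) / (1 - P\<^sup>2)) \<le> (1 - Q) / (1 - P\<^sup>2) - 1" using Q P2 by (intro ln_le_minus_one) auto
    hence 2: "ln (1 - Q) + \<delta> * ln \<rho> + ln C \<le> (1 - Q) / (1 - P\<^sup>2) - 1"
      using Q P2 by (simp add: ln_div base)
    have "P\<^sup>2 / (1 - P\<^sup>2) * (- 2 * S + 2 * ln \<rho>) \<le> P\<^sup>2 / (1 - P\<^sup>2) * (Q / P\<^sup>2 - 1)"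
      using 1 P2 by (intro mult_left_mono) auto
    also have "\<dots> = (Q - P\<^sup>2) / (1 - P\<^sup>2)" using P by (simp add: right_diff_distrib diff_divide_distrib)
    also have "\<dots> = - ((1 - Q) / (1 - P\<^sup>2) - 1)"
    proof -
      have "(1 - P\<^sup>2) / (1 - P\<^sup>2) = 1" using P2 by simp
      hence "1 / (1 - P\<^sup>2) - P\<^sup>2 / (1 - P\<^sup>2) = 1" unfolding diff_divide_distrib .
      thus ?thesis by (simp add: diff_divide_distrib)
    qed
    finally have "P\<^sup>2 / (1 - P\<^sup>2) * (- 2 * S + 2 * ln \<rho>) + (ln (1 - Q) + \<delta> * ln \<rho> + ln C) \<le> 0" using 2 by linarith
    hence "B * (P\<^sup>2 / (1 - P\<^sup>2) * (- 2 * S + 2 * ln \<rho>) + (ln (1 - Q) + \<delta> * ln \<rho> + ln C)) \<le> 0"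
      using B by (simp add: mult_le_0_iff)
    hence "(1 - B * \<delta>) * (ln \<rho> - S) + B * (ln (1 - Q) + \<delta> * ln \<rho> + ln C) \<le> 0"
      unfolding Bd by (simp add: algebra_simps)
    thus "ln \<rho> \<le> (1 - B * \<delta>) * S - B * ln C - B * ln (1 - exp (- 2 * S))"
      unfolding Q_def[symmetric] by (simp add: algebra_simps)
  qed
qed

section \<open>The polynomial: degrees, rescaling and constants\<close>

locale multihomogeneous_polynomial =
  fixes r :: nat and n d :: "nat \<Rightarrow> nat" and I :: "nat set" and F :: mpolynomial
  assumes r: "r \<ge> 1" and n: "\<And>i. i \<in> {1..r} \<Longrightarrow> n i \<ge> 1"
    and I: "I \<subseteq> {i \<in> {1..r}. n i = 1}"
    and F: "multihomogeneous r n d F" and F_nz: "Poly_Mapping.keys F \<noteq> {}"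
begin

abbreviation "IP \<equiv> index_pairs r n"
abbreviation "M \<equiv> Poly_Mapping.keys F"
abbreviation "dg \<equiv> degree_in F"
abbreviation "ex \<equiv> Poly_Mapping.lookup :: monomial \<Rightarrow> nat \<times> nat \<Rightarrow> nat"

text \<open>The coefficients are a parameter because an embedding conjugates them while the
  monomials of \<open>F\<close> stay.\<close>

definition eval_with :: "(monomial \<Rightarrow> complex) \<Rightarrow> (nat \<times> nat \<Rightarrow> complex) \<Rightarrow> complex" where
  "eval_with a x = (\<Sum>m\<in>M. a m * (\<Prod>w\<in>IP. x w ^ ex m w))"

definition reciprocal :: "(monomial \<Rightarrow> complex) \<Rightarrow> (nat \<times> nat \<Rightarrow> complex) \<Rightarrow> complex" where
  "reciprocal a x = (\<Sum>m\<in>M. a m * (\<Prod>w\<in>IP. x w ^ (dg w - ex m w)))"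

lemma finite_IP: "finite IP" by (simp add: index_pairs_def)

lemma I_D: "i \<in> I \<Longrightarrow> i \<in> {1..r}" "i \<in> I \<Longrightarrow> n i = 1" using I by auto

lemma keys_sub: "m \<in> M \<Longrightarrow> Poly_Mapping.keys m \<subseteq> IP"
  and ex_sum: "m \<in> M \<Longrightarrow> i \<in> {1..r} \<Longrightarrow> (\<Sum>j=0..n i. ex m (i, j)) = d i"
  using F by (auto simp: multihomogeneous_def)

lemma ex_le_dg: "m \<in> M \<Longrightarrow> ex m w \<le> dg w"
  unfolding degree_in_def by (rule Max_ge) auto

lemma dg_le: assumes "\<And>m. m \<in> M \<Longrightarrow> ex m w \<le> c" shows "dg w \<le> c"
  unfolding degree_in_def using assms by (subst Max_le_iff) auto

lemma mpoly_eval_eq: "mpoly_eval F x = eval_with (Poly_Mapping.lookup F) x"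
  unfolding mpoly_eval_def eval_with_def
proof (intro sum.cong refl arg_cong2[of _ _ _ _ "(*)"])
  fix m assume "m \<in> M"
  thus "(\<Prod>w\<in>Poly_Mapping.keys m. x w ^ ex m w) = (\<Prod>w\<in>IP. x w ^ ex m w)"
    using keys_sub finite_IP by (intro prod.mono_neutral_left) (auto simp: in_keys_iff)
qed

lemma reciprocal_eq:
  assumes "\<And>w. w \<in> IP \<Longrightarrow> x w \<noteq> 0"
  shows "reciprocal a x = (\<Prod>w\<in>IP. x w ^ dg w) * eval_with a (\<lambda>w. inverse (x w))"
  unfolding reciprocal_def eval_with_def sum_distrib_left
proof (intro sum.cong refl)
  fix m assume m: "m \<in> M"
  have "(\<Prod>w\<in>IP. x w ^ (dg w - ex m w)) = (\<Prod>w\<in>IP. x w ^ dg w * inverse (x w) ^ ex m w)"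
    using assms ex_le_dg[OF m] by (intro prod.cong refl) (simp add: power_diff power_inverse divide_inverse)
  thus "a m * (\<Prod>w\<in>IP. x w ^ (dg w - ex m w)) = (\<Prod>w\<in>IP. x w ^ dg w) * (a m * (\<Prod>w\<in>IP. inverse (x w) ^ ex m w))"
    by (simp add: prod.distrib)
qed

text \<open>\<open>d_tilde\<close> as a natural number, which is the degree of
  \<open>reciprocal\<close> in the i-th group. For i in range the subtraction does not truncate, by
  \<open>d_le\<close>.\<close>

definition dt :: "nat \<Rightarrow> nat" where "dt i = (\<Sum>j=0..n i. dg (i, j)) - d i"

lemma d_le: "i \<in> {1..r} \<Longrightarrow> d i \<le> (\<Sum>j=0..n i. dg (i, j))"
  using F_nz ex_sum ex_le_dg by (metis (no_types, lifting) all_not_in_conv sum_mono)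

lemma d_tilde_eq: "i \<in> {1..r} \<Longrightarrow> d_tilde n d F i = real (dt i)"
  using d_le by (simp add: d_tilde_def dt_def of_nat_diff)

lemma sum_dg_minus_ex:
  assumes "m \<in> M" "i \<in> {1..r}" shows "(\<Sum>j=0..n i. dg (i, j) - ex m (i, j)) = dt i"
  unfolding dt_def using ex_sum[OF assms, symmetric] ex_le_dg[OF assms(1)] by (simp add: sum_subtractf_nat)

lemma dg0_le: "i \<in> I \<Longrightarrow> dg (i, 0) \<le> d i"
  by (rule dg_le) (use ex_sum I_D in \<open>fastforce\<close>)

lemma dt_I: assumes "i \<in> I" shows "dt i = dg (i, 1) - (d i - dg (i, 0))" "d i - dg (i, 0) \<le> dg (i, 1)"
  using dg0_le[OF assms] d_le[of i] I_D[OF assms] by (auto simp: dt_def)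

lemma prod_index_pairs: "(\<Prod>w\<in>IP. g w) = (\<Prod>i=1..r. \<Prod>j=0..n i. g (i, j))"
  and sum_index_pairs: "(\<Sum>w\<in>IP. h w) = (\<Sum>i=1..r. \<Sum>j=0..n i. h (i, j))"
  for g :: "nat \<times> nat \<Rightarrow> 'c :: comm_monoid_mult" and h :: "nat \<times> nat \<Rightarrow> 'd :: comm_monoid_add"
  unfolding index_pairs_def by (simp_all add: prod.Sigma sum.Sigma)

definition rescale :: "(nat \<Rightarrow> complex) \<Rightarrow> (nat \<times> nat \<Rightarrow> complex) \<Rightarrow> nat \<times> nat \<Rightarrow> complex" where
  "rescale c x = (\<lambda>(i, j). x (i, j) / c i)"

lemma prod_rescale:
  "(\<Prod>w\<in>IP. rescale c x w ^ e w) = (\<Prod>w\<in>IP. x w ^ e w) / (\<Prod>i=1..r. c i ^ (\<Sum>j=0..n i. e (i, j)))"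
  by (simp add: prod_index_pairs rescale_def power_divide prod_dividef power_sum)

lemma eval_rescale: "eval_with a (rescale c x) = eval_with a x / (\<Prod>i=1..r. c i ^ d i)"
  unfolding eval_with_def sum_divide_distrib
  by (intro sum.cong refl) (simp add: prod_rescale ex_sum)

lemma reciprocal_rescale: "reciprocal a (rescale c x) = reciprocal a x / (\<Prod>i=1..r. c i ^ dt i)"
  unfolding reciprocal_def sum_divide_distrib
  by (intro sum.cong refl) (simp add: prod_rescale sum_dg_minus_ex)

lemma delta_set_finite:
  "finite ((\<lambda>i. (d_tilde n d F i + real (dg (i, 1))) / (real (n i) + 1)) ` I \<union>
      (\<lambda>i. d_tilde n d F i / (real (n i) + 1)) ` ({1..r} - I))"
proof -
  have "finite I" by (rule finite_subset[of I "{1..r}"]) (use I in auto)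
  thus ?thesis by simp
qed

text \<open>Here n i + 1 = 2, and the mean of \<open>dt i\<close> and \<open>dg (i, 1)\<close> is at
  least \<open>dt i\<close>, since \<open>dt i\<close> is the smaller of the two.\<close>

lemma delta_I: assumes "i \<in> I" shows "real (dt i) \<le> delta r n d I F"
proof -
  have "(d_tilde n d F i + real (dg (i, 1))) / (real (n i) + 1) \<le> delta r n d I F"
    unfolding delta_def by (rule Max_ge[OF delta_set_finite]) (use assms in blast)
  moreover have "d_tilde n d F i = real (dt i)" by (rule d_tilde_eq[OF I_D(1)[OF assms]])
  moreover have "dt i \<le> dg (i, 1)" using dt_I[OF assms] by simp
  ultimately show ?thesis using I_D(2)[OF assms] by simp
qed

lemma delta_not_I: assumes "i \<in> {1..r} - I" shows "real (dt i) / (real (n i) + 1) \<le> delta r n d I F"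
proof -
  have "d_tilde n d F i / (real (n i) + 1) \<le> delta r n d I F"
    unfolding delta_def by (rule Max_ge[OF delta_set_finite]) (use assms in blast)
  thus ?thesis using d_tilde_eq assms by simp
qed

text \<open>If all \<open>dt i\<close> vanished, each exponent would equal the degree of F in its
  variable. F would be a single monomial, which has no zero with nonzero coordinates.\<close>

lemma delta_pos:
  assumes x: "\<And>w. w \<in> IP \<Longrightarrow> x w \<noteq> 0" and zero: "mpoly_eval F x = 0"
  shows "delta r n d I F > 0"
proof (rule ccontr)
  assume neg: "\<not> ?thesis"
  have dt0: "dt i = 0" if i: "i \<in> {1..r}" for i
  proof (cases "i \<in> I")
    case True thus ?thesis using delta_I neg by fastforce
  next
    case False
    hence "real (dt i) / (real (n i) + 1) \<le> delta r n d I F" using i by (intro delta_not_I) simp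
    hence "real (dt i) / (real (n i) + 1) \<le> 0" using neg by linarith
    thus ?thesis by (simp add: divide_le_0_iff)
  qed
  have eq: "ex m w = dg w" if m: "m \<in> M" and w: "w \<in> IP" for m w
  proof -
    obtain i j where ij: "w = (i, j)" "i \<in> {1..r}" "j \<in> {0..n i}" using w by (auto simp: index_pairs_def)
    have "dg (i, j) - ex m (i, j) = 0"
      using sum_dg_minus_ex[OF m ij(2)] dt0[OF ij(2)] ij(3) by simp
    thus ?thesis using ex_le_dg[OF m, of w] ij(1) by simp
  qed
  obtain m where m: "m \<in> M" using F_nz by blast
  have "m' = m" if m': "m' \<in> M" for m'
  proof (rule poly_mapping_eqI)
    fix w
    show "ex m' w = ex m w"
    proof (cases "w \<in> IP")
      case True thus ?thesis using eq m m' by simp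
    next
      case False thus ?thesis using keys_sub[OF m] keys_sub[OF m'] by (metis in_keys_iff subsetD)
    qed
  qed
  hence "M = {m}" using m by blast
  hence "mpoly_eval F x = Poly_Mapping.lookup F m * (\<Prod>w\<in>IP. x w ^ ex m w)"
    by (simp add: mpoly_eval_eq eval_with_def)
  moreover have "Poly_Mapping.lookup F m \<noteq> 0" using m by (simp add: in_keys_iff)
  ultimately show False using zero x finite_IP by simp
qed

abbreviation "E \<equiv> exceptional_pairs I"
abbreviation "C \<equiv> C_const r n E F"

text \<open>Distinct monomials containing w stay distinct after differentiation, so nothing cancels
  and the sum can be taken over the monomials of F itself.\<close>

lemma coeff_sum_ge: "(\<Sum>m\<in>M. cmod (Poly_Mapping.lookup F m) * real (ex m w)) \<le> coeff_sum F cmod w"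
proof -
  \<comment> \<open>Subtraction of exponents truncates at 0, so injectivity is claimed on the set
    \<open>N\<close> of monomials containing w; the other terms have coefficient 0.\<close>
  define \<phi> where "\<phi> = (\<lambda>m :: monomial. m - Poly_Mapping.single w 1)"
  define N where "N = {m \<in> M. ex m w > 0}"
  have add_back: "m = \<phi> m + Poly_Mapping.single w 1" if "ex m w > 0" for m
    by (rule poly_mapping_eqI) (use that in \<open>auto simp: \<phi>_def lookup_minus lookup_add lookup_single when_def\<close>)
  have inj: "inj_on \<phi> N" by (rule inj_onI) (metis (no_types, lifting) N_def add_back mem_Collect_eq)
  have "finite N" by (simp add: N_def)
  define t where "t = (\<lambda>m. of_nat (ex m w) * Poly_Mapping.lookup F m)"
  have lk: "Poly_Mapping.lookup (partial_derivative w F) (\<phi> m) = t m" if m: "m \<in> N" for m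
  proof -
    have "Poly_Mapping.lookup (partial_derivative w F) (\<phi> m) = (\<Sum>m'\<in>M. if \<phi> m' = \<phi> m then t m' else 0)"
      unfolding partial_derivative_def by (simp add: lookup_sum lookup_single when_def \<phi>_def t_def cong: if_cong)
    also have "\<dots> = (\<Sum>m'\<in>M. if m' = m then t m' else 0)"
    proof (intro sum.cong refl)
      fix m' assume "m' \<in> M"
      show "(if \<phi> m' = \<phi> m then t m' else 0) = (if m' = m then t m' else 0)"
      proof (cases "ex m' w = 0")
        case True thus ?thesis by (simp add: t_def)
      next
        case False
        hence "m' \<in> N" using \<open>m' \<in> M\<close> by (simp add: N_def)
        thus ?thesis using inj m by (auto dest: inj_onD)
      qed
    qed
    also have "\<dots> = t m" using m by (simp add: N_def)
    finally show ?thesis .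
  qed
  have "(\<Sum>m\<in>M. cmod (Poly_Mapping.lookup F m) * real (ex m w)) = (\<Sum>m\<in>N. cmod (t m))"
    by (rule sum.mono_neutral_cong_right) (auto simp: N_def t_def norm_mult)
  also have "\<dots> = (\<Sum>m\<in>N. cmod (Poly_Mapping.lookup (partial_derivative w F) (\<phi> m)))" by (simp add: lk)
  also have "\<dots> = (\<Sum>m\<in>\<phi> ` N. cmod (Poly_Mapping.lookup (partial_derivative w F) m))"
    by (simp add: sum.reindex[OF inj])
  also have "\<dots> \<le> coeff_sum F cmod w" unfolding coeff_sum_def
  proof (rule sum_mono2)
    show "\<phi> ` N \<subseteq> Poly_Mapping.keys (partial_derivative w F)"
      using lk by (auto simp: in_keys_iff t_def N_def)
  qed auto
  finally show ?thesis .
qed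

lemma C_ge: assumes "w \<in> IP - E" shows "(\<Sum>m\<in>M. cmod (Poly_Mapping.lookup F m) * real (ex m w)) \<le> C"
proof -
  have "coeff_sum F cmod w \<le> C" unfolding C_const_def using assms finite_IP by (intro Max_ge) auto
  thus ?thesis using coeff_sum_ge[of w] by linarith
qed

lemma C_nonneg: "C \<ge> 0"
proof -
  have "(1, 1) \<in> IP - E" using r n[of 1] by (auto simp: index_pairs_def exceptional_pairs_def)
  from C_ge[OF this] show ?thesis by (rule order_trans[rotated]) (simp add: sum_nonneg)
qed

section \<open>Weights and normalised coordinates\<close>

definition max_abs :: "(complex \<Rightarrow> real) \<Rightarrow> (nat \<times> nat \<Rightarrow> complex) \<Rightarrow> nat \<Rightarrow> real" where
  "max_abs u x i = Max ((\<lambda>j. u (x (i, j))) ` {0..n i})"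

lemma max_abs_ge: "j \<le> n i \<Longrightarrow> u (x (i, j)) \<le> max_abs u x i"
  unfolding max_abs_def by (rule Max_ge) auto

lemma max_abs_attained: obtains j where "j \<le> n i" "max_abs u x i = u (x (i, j))"
proof -
  have "max_abs u x i \<in> (\<lambda>j. u (x (i, j))) ` {0..n i}" unfolding max_abs_def by (rule Max_in) auto
  thus ?thesis using that by auto
qed

definition Rj :: "nat \<Rightarrow> nat set" where "Rj i = (if i \<in> I then {1} else {0..n i})"

lemma regular_pairs: "IP - E = Sigma {1..r} Rj"
  using I_D by (auto simp: index_pairs_def exceptional_pairs_def Rj_def split: if_splits)

lemma sum_regular: "(\<Sum>w\<in>IP - E. h w) = (\<Sum>i=1..r. \<Sum>j\<in>Rj i. h (i, j))"
  for h :: "nat \<times> nat \<Rightarrow> real"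
proof -
  have "finite (Rj i)" for i by (simp add: Rj_def)
  thus ?thesis unfolding regular_pairs by (simp add: sum.Sigma)
qed

text \<open>Exponents of the coordinates in the product formula. Their sum over a group plus B times
  \<open>dt i\<close> is n i + 1, which makes the local inequalities invariant under scaling the
  group. In an exceptional group \<open>x (i, 0)\<close> is the normalised coordinate and
  \<open>x (i, 1)\<close> carries the whole loss.\<close>

definition weight :: "real \<Rightarrow> nat \<times> nat \<Rightarrow> real" where
  "weight B = (\<lambda>(i, j). if i \<in> I then (if j = 0 then 1 else 1 - B * real (dt i)) else 1 - B * real (dt i) / (real (n i) + 1))"

lemma sum_weight:
  assumes "i \<in> {1..r}" shows "(\<Sum>j=0..n i. weight B (i, j)) = real (n i) + 1 - B * real (dt i)"
proof (cases "i \<in> I")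
  case True thus ?thesis using I_D(2)[OF True] by (simp add: weight_def)
next
  case False
  have "real (n i) + 1 > 0" by simp
  thus ?thesis using False by (simp add: weight_def field_simps)
qed

text \<open>At a prime, nonnegative weights allow each coordinate to be replaced by the maximum of
  its group.\<close>

lemma weight_nonneg:
  assumes "w \<in> IP" "B \<ge> 0" "B * delta r n d I F \<le> 1" shows "weight B w \<ge> 0"
proof -
  obtain i j where w: "w = (i, j)" "i \<in> {1..r}" using assms(1) by (auto simp: index_pairs_def)
  have "B * real (dt i) \<le> 1" if "i \<in> I"
    using mult_left_mono[OF delta_I[OF that] assms(2)] assms(3) by linarith
  moreover have "B * real (dt i) / (real (n i) + 1) \<le> 1" if "i \<notin> I"
  proof -
    have "B * (real (dt i) / (real (n i) + 1)) \<le> B * delta r n d I F"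
      using that w(2) assms(2) by (intro mult_left_mono delta_not_I) auto
    hence "B * (real (dt i) / (real (n i) + 1)) \<le> 1" using assms(3) by linarith
    thus ?thesis by (simp only: times_divide_eq_right)
  qed
  ultimately show ?thesis by (simp add: weight_def w)
qed

text \<open>The contribution of one group to S: the absolute logarithms of its regular coordinates,
  after division by \<open>x (i, 0)\<close> in an exceptional group and by the largest absolute
  value in any other.\<close>

definition spread :: "(nat \<times> nat \<Rightarrow> complex) \<Rightarrow> nat \<Rightarrow> real" where
  "spread x i = (if i \<in> I then \<bar>ln (cmod (x (i, 1))) - ln (cmod (x (i, 0)))\<bar>
     else (\<Sum>j=0..n i. ln (max_abs cmod x i) - ln (cmod (x (i, j)))))"

lemma ln_max_abs_I:
  assumes i: "i \<in> I" and x: "\<And>w. w \<in> IP \<Longrightarrow> x w \<noteq> 0"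
  shows "ln (max_abs cmod x i) = ln (cmod (x (i, 0))) + max 0 (ln (cmod (x (i, 1))) - ln (cmod (x (i, 0))))"
proof -
  have "x (i, 0) \<noteq> 0" "x (i, 1) \<noteq> 0" using x I_D[OF i] by (auto simp: index_pairs_def)
  moreover have "{0..n i} = {0, 1}" using I_D(2)[OF i] by auto
  hence "max_abs cmod x i = max (cmod (x (i, 0))) (cmod (x (i, 1)))" by (simp add: max_abs_def)
  ultimately show ?thesis by (auto simp: max_def)
qed

text \<open>\<open>reciprocal_value_bound\<close> for normalised coordinates. Division by the
  maximum puts a group outside \<open>I\<close> into the closed unit disc, so only groups in
  \<open>I\<close> contribute positive logarithms. The coefficients \<open>a\<close> may differ from
  those of F at exceptional monomials, but these do not contain the variables that are
  compared.\<close>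

lemma archimedean_bound:
  assumes real: "\<And>m. m \<in> M \<Longrightarrow> cnj (a m) = a m"
    and reg: "\<And>m. m \<in> M \<Longrightarrow> regular_monomial E m \<Longrightarrow> cmod (a m) = cmod (Poly_Mapping.lookup F m)"
    and x: "\<And>w. w \<in> IP \<Longrightarrow> x w \<noteq> 0" and zero: "eval_with a x = 0" and G: "reciprocal a x \<noteq> 0"
  shows "C > 0" "(\<Sum>i=1..r. spread x i) > 0"
    "ln (cmod (reciprocal a x)) \<le> ln C + ln (1 - exp (- 2 * (\<Sum>i=1..r. spread x i))) +
       (\<Sum>i=1..r. real (dt i) * (ln (max_abs cmod x i) +
          (if i \<in> I then max 0 (ln (cmod (x (i, 1))) - ln (cmod (x (i, 0)))) else 0)))"
proof -
  have xij: "x (i, j) \<noteq> 0" if "i \<in> {1..r}" "j \<le> n i" for i j using x that by (simp add: index_pairs_def)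
  have mpos: "max_abs cmod x i > 0" if "i \<in> {1..r}" for i
    using max_abs_attained[of i cmod x] xij[OF that] by (metis zero_less_norm_iff)
  define c where "c = (\<lambda>i. if i \<in> I then x (i, 0) else of_real (max_abs cmod x i))"
  have cnz: "c i \<noteq> 0" if "i \<in> {1..r}" for i using xij[OF that, of 0] mpos[OF that] by (auto simp: c_def)
  define y where "y = rescale c x"
  have ynz: "y w \<noteq> 0" if "w \<in> IP" for w using that x cnz by (auto simp: y_def rescale_def index_pairs_def)
  \<comment> \<open>In an exceptional group the two exponents add up to d i and that of
    \<open>x (i, 0)\<close> is at most its degree, so every monomial contains
    \<open>x (i, 1)\<close> at least this often. Removing the common power leaves the exponent range
    \<open>dt i\<close>.\<close>
  define k :: "nat \<times> nat \<Rightarrow> nat" where "k = (\<lambda>(i, j). if i \<in> I \<and> j = 1 then d i - dg (i, 0) else 0 :: nat)"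
  have lny: "ln (cmod (y (i, j))) = ln (cmod (x (i, j))) - ln (cmod (c i))" if "i \<in> {1..r}" "j \<le> n i" for i j
    using xij[OF that] cnz[OF that(1)] by (simp add: y_def rescale_def norm_divide ln_div)
  define S where "S = (\<Sum>w\<in>IP - E. \<bar>ln (cmod (y w))\<bar>)"
  have S: "S = (\<Sum>i=1..r. spread x i)"
    unfolding S_def sum_regular
  proof (intro sum.cong refl)
    fix i assume i: "i \<in> {1..r}"
    show "(\<Sum>j\<in>Rj i. \<bar>ln (cmod (y (i, j)))\<bar>) = spread x i"
    proof (cases "i \<in> I")
      case True thus ?thesis using I_D(2)[OF True] lny[OF i, of 1] by (simp add: Rj_def spread_def c_def)
    next
      case False
      have "\<bar>ln (cmod (y (i, j)))\<bar> = ln (max_abs cmod x i) - ln (cmod (x (i, j)))" if "j \<in> {0..n i}" for j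
      proof -
        have "ln (cmod (x (i, j))) \<le> ln (max_abs cmod x i)"
          using max_abs_ge[of j i cmod x] xij[OF i, of j] mpos[OF i] that by (subst ln_le_cancel_iff) auto
        thus ?thesis using lny[OF i, of j] that False mpos[OF i] by (simp add: c_def)
      qed
      thus ?thesis using False by (simp add: Rj_def spread_def)
    qed
  qed
  define XX where "XX = (\<Sum>w\<in>IP - E. real (dg w - k w) * max 0 (ln (cmod (y w))))"
  have XX: "XX = (\<Sum>i=1..r. real (dt i) * (if i \<in> I then max 0 (ln (cmod (x (i, 1))) - ln (cmod (x (i, 0)))) else 0))"
    unfolding XX_def sum_regular
  proof (intro sum.cong refl)
    fix i assume i: "i \<in> {1..r}"
    show "(\<Sum>j\<in>Rj i. real (dg (i, j) - k (i, j)) * max 0 (ln (cmod (y (i, j))))) =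
        real (dt i) * (if i \<in> I then max 0 (ln (cmod (x (i, 1))) - ln (cmod (x (i, 0)))) else 0)"
    proof (cases "i \<in> I")
      case True
      have "ln (cmod (y (i, 1))) = ln (cmod (x (i, 1))) - ln (cmod (x (i, 0)))"
        using lny[OF i, of 1] I_D(2)[OF True] True by (simp add: c_def)
      moreover have "dg (i, 1) - k (i, 1) = dt i" using dt_I(1)[OF True] True by (simp add: k_def)
      ultimately show ?thesis using True by (simp add: Rj_def)
    next
      case False
      have "max 0 (ln (cmod (y (i, j)))) = 0" if "j \<in> {0..n i}" for j
      proof -
        have "ln (cmod (x (i, j))) \<le> ln (max_abs cmod x i)"
          using max_abs_ge[of j i cmod x] xij[OF i, of j] mpos[OF i] that by (subst ln_le_cancel_iff) auto
        thus ?thesis using lny[OF i, of j] that False mpos[OF i] by (simp add: c_def)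
      qed
      thus ?thesis using False by (simp add: Rj_def)
    qed
  qed
  have main: "cmod (\<Sum>m\<in>M. a m * (\<Prod>w\<in>IP. y w ^ (dg w - ex m w))) \<le> C * (1 - exp (- 2 * S)) * exp (2 * XX)"
    unfolding S_def XX_def
  proof (rule reciprocal_value_bound)
    show "y w = 1" if "w \<in> IP - (IP - E)" for w
    proof -
      from that obtain i where "w = (i, 0)" "i \<in> I" by (auto simp: exceptional_pairs_def)
      thus ?thesis using xij[of i 0] I_D[of i] by (simp add: y_def rescale_def c_def)
    qed
    show "cnj (a m) = a m" if "m \<in> M" for m by (rule real[OF that])
    show "k w \<le> ex m w \<and> ex m w \<le> dg w" if m: "m \<in> M" and w: "w \<in> IP" for m w
    proof
      show "ex m w \<le> dg w" by (rule ex_le_dg[OF m])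
      show "k w \<le> ex m w"
      proof (cases "\<exists>i\<in>I. w = (i, 1)")
        case True
        then obtain i where i: "i \<in> I" "w = (i, 1)" by blast
        have "ex m (i, 0) + ex m (i, 1) = d i" using ex_sum[OF m I_D(1)[OF i(1)]] I_D(2)[OF i(1)] by simp
        moreover have "ex m (i, 0) \<le> dg (i, 0)" by (rule ex_le_dg[OF m])
        ultimately show ?thesis using i by (simp add: k_def)
      next
        case False thus ?thesis by (cases w) (auto simp: k_def)
      qed
    qed
    show "(\<Sum>m\<in>M. a m * (\<Prod>w\<in>IP. y w ^ ex m w)) = 0"
      using eval_rescale[of a c x] zero by (simp add: y_def eval_with_def)
    show "(\<Sum>m\<in>M. cmod (a m) * real (ex m w)) \<le> C" if w: "w \<in> IP - E" for w
    proof -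
      have "(\<Sum>m\<in>M. cmod (a m) * real (ex m w)) = (\<Sum>m\<in>M. cmod (Poly_Mapping.lookup F m) * real (ex m w))"
      proof (intro sum.cong refl)
        fix m assume m: "m \<in> M"
        show "cmod (a m) * real (ex m w) = cmod (Poly_Mapping.lookup F m) * real (ex m w)"
        proof (cases "ex m w = 0")
          case False
          hence "regular_monomial E m" using w by (auto simp: regular_monomial_def in_keys_iff)
          thus ?thesis using reg[OF m] by simp
        qed simp
      qed
      thus ?thesis using C_ge[OF w] by simp
    qed
  qed (use finite_IP ynz C_nonneg in auto)
  define L where "L = (\<Prod>i=1..r. cmod (c i) ^ dt i)"
  have L: "L > 0" unfolding L_def using cnz by (intro prod_pos) auto
  have "(\<Sum>m\<in>M. a m * (\<Prod>w\<in>IP. y w ^ (dg w - ex m w))) = reciprocal a x / (\<Prod>i=1..r. c i ^ dt i)"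
    using reciprocal_rescale[of a c x] by (simp add: y_def reciprocal_def)
  hence "cmod (reciprocal a x) / L \<le> C * (1 - exp (- 2 * S)) * exp (2 * XX)"
    using main by (simp add: norm_divide prod_norm[symmetric] norm_power L_def)
  hence le': "cmod (reciprocal a x) / L \<le> C * (1 - exp (- 2 * S)) * exp (2 * XX)" .
  have Gp: "cmod (reciprocal a x) > 0" using G by simp
  hence "cmod (reciprocal a x) / L > 0" using L by simp
  \<comment> \<open>The value is nonzero, so this upper bound is positive; that is how C > 0 and a
    positive total spread are obtained.\<close>
  hence pos: "C * (1 - exp (- 2 * S)) * exp (2 * XX) > 0" using le' by (rule less_le_trans)
  have "cmod (reciprocal a x) = L * (cmod (reciprocal a x) / L)" using L by simp
  also have "\<dots> \<le> L * (C * (1 - exp (- 2 * S)) * exp (2 * XX))" using le' L by (intro mult_left_mono) auto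
  finally have le: "cmod (reciprocal a x) \<le> L * (C * (1 - exp (- 2 * S)) * exp (2 * XX))" .
  have "S \<ge> 0" unfolding S_def by (simp add: sum_nonneg)
  have "C * (1 - exp (- 2 * S)) > 0" using pos by (simp add: zero_less_mult_iff)
  hence CS: "C > 0" "1 - exp (- 2 * S) > 0" using C_nonneg by (auto simp: zero_less_mult_iff)
  show "C > 0" by fact
  have "S > 0" using CS(2) \<open>S \<ge> 0\<close> by (cases "S = 0") auto
  thus "(\<Sum>i=1..r. spread x i) > 0" using S by simp
  have lnL: "ln L = (\<Sum>i=1..r. real (dt i) * ln (cmod (c i)))"
    unfolding L_def using cnz by (subst ln_prod) (auto simp: ln_realpow)
  have "ln (cmod (reciprocal a x)) \<le> ln (L * (C * (1 - exp (- 2 * S)) * exp (2 * XX)))"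
    using Gp le order.strict_trans2[OF Gp le] by (subst ln_le_cancel_iff)
  also have "\<dots> = ln L + (ln C + ln (1 - exp (- 2 * S)) + 2 * XX)"
    using L CS by (simp add: ln_mult)
  finally have fin: "ln (cmod (reciprocal a x)) \<le> ln L + (ln C + ln (1 - exp (- 2 * S)) + 2 * XX)" .
  have "ln L + 2 * XX = (\<Sum>i=1..r. real (dt i) * (ln (max_abs cmod x i) +
          (if i \<in> I then max 0 (ln (cmod (x (i, 1))) - ln (cmod (x (i, 0)))) else 0)))"
    unfolding lnL XX sum_distrib_left sum.distrib[symmetric]
  proof (intro sum.cong refl)
    fix i assume i: "i \<in> {1..r}"
    show "real (dt i) * ln (cmod (c i)) +
          2 * (real (dt i) * (if i \<in> I then max 0 (ln (cmod (x (i, 1))) - ln (cmod (x (i, 0)))) else 0)) =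
          real (dt i) * (ln (max_abs cmod x i) +
          (if i \<in> I then max 0 (ln (cmod (x (i, 1))) - ln (cmod (x (i, 0)))) else 0))"
    proof (cases "i \<in> I")
      case True
      have "ln (max_abs cmod x i) = ln (cmod (x (i, 0))) + max 0 (ln (cmod (x (i, 1))) - ln (cmod (x (i, 0))))"
        by (rule ln_max_abs_I[OF True x])
      thus ?thesis using True by (simp add: c_def algebra_simps)
    next
      case False thus ?thesis using mpos[OF i] by (simp add: c_def)
    qed
  qed
  thus "ln (cmod (reciprocal a x)) \<le> ln C + ln (1 - exp (- 2 * (\<Sum>i=1..r. spread x i))) +
       (\<Sum>i=1..r. real (dt i) * (ln (max_abs cmod x i) +
          (if i \<in> I then max 0 (ln (cmod (x (i, 1))) - ln (cmod (x (i, 0)))) else 0)))"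
    using fin unfolding S by linarith
qed

text \<open>The groups are treated separately. With B \<delta> replaced by B times
  \<open>dt i\<close>, or by this divided by n i + 1 for i outside \<open>I\<close>, each group
  gives an identity. B \<delta> is at least as large and the spread is nonnegative, so the
  inequality follows.\<close>

lemma archimedean_inequality:
  assumes real: "\<And>m. m \<in> M \<Longrightarrow> cnj (a m) = a m"
    and reg: "\<And>m. m \<in> M \<Longrightarrow> regular_monomial E m \<Longrightarrow> cmod (a m) = cmod (Poly_Mapping.lookup F m)"
    and x: "\<And>w. w \<in> IP \<Longrightarrow> x w \<noteq> 0" and zero: "eval_with a x = 0" and G: "reciprocal a x \<noteq> 0"
    and B: "B > 0" "B * delta r n d I F \<le> 1"
    and opt: "\<And>S. S > 0 \<Longrightarrow> ln \<rho> \<le> (1 - B * delta r n d I F) * S - B * ln C - B * ln (1 - exp (- 2 * S))"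
  shows "ln \<rho> + (\<Sum>w\<in>IP. weight B w * ln (cmod (x w))) + B * ln (cmod (reciprocal a x)) \<le>
    (\<Sum>i=1..r. (real (n i) + 1) * ln (max_abs cmod x i))"
proof -
  note b = archimedean_bound[OF real reg x zero G]
  define S where "S = (\<Sum>i=1..r. spread x i)"
  define \<delta> where "\<delta> = delta r n d I F"
  define h where "h = (\<lambda>i. if i \<in> I then max 0 (ln (cmod (x (i, 1))) - ln (cmod (x (i, 0)))) else 0)"
  have per: "(1 - B * \<delta>) * spread x i + (\<Sum>j=0..n i. weight B (i, j) * ln (cmod (x (i, j)))) +
      B * (real (dt i) * (ln (max_abs cmod x i) + h i)) \<le> (real (n i) + 1) * ln (max_abs cmod x i)"
    if i: "i \<in> {1..r}" for i
  proof (cases "i \<in> I")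
    case True
    have n1: "n i = 1" by (rule I_D(2)[OF True])
    define p q where "p = ln (cmod (x (i, 0)))" and "q = ln (cmod (x (i, 1)))"
    have max: "ln (max_abs cmod x i) = p + max 0 (q - p)" unfolding p_def q_def by (rule ln_max_abs_I[OF True x])
    have sp: "spread x i = \<bar>q - p\<bar>" using True by (simp add: spread_def p_def q_def)
    have "B * real (dt i) \<le> B * \<delta>" unfolding \<delta>_def using delta_I[OF True] B by (intro mult_left_mono) auto
    hence "(1 - B * \<delta>) * \<bar>q - p\<bar> \<le> (1 - B * real (dt i)) * \<bar>q - p\<bar>" by (intro mult_right_mono) auto
    moreover have "(\<Sum>j=0..n i. weight B (i, j) * ln (cmod (x (i, j)))) = p + (1 - B * real (dt i)) * q"
      using True by (simp add: n1 weight_def p_def q_def)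
    moreover have "h i = max 0 (q - p)" using True by (simp add: h_def p_def q_def)
    moreover have "(1 - B * real (dt i)) * \<bar>q - p\<bar> + (p + (1 - B * real (dt i)) * q) +
        B * (real (dt i) * (p + max 0 (q - p) + max 0 (q - p))) = 2 * (p + max 0 (q - p))"
      by (cases "p \<le> q") (simp_all add: algebra_simps)
    ultimately show ?thesis unfolding max sp n1 by simp
  next
    case False
    define m where "m = ln (max_abs cmod x i)"
    define A where "A = 1 - B * real (dt i) / (real (n i) + 1)"
    have xi: "x (i, j) \<noteq> 0" if "j \<le> n i" for j using x i that by (simp add: index_pairs_def)
    have "spread x i \<ge> 0"
    proof -
      have "ln (cmod (x (i, j))) \<le> ln (max_abs cmod x i)" if j: "j \<le> n i" for j
        using max_abs_ge[OF j, of cmod x] xi[OF j] order.strict_trans2[of 0 "cmod (x (i, j))" "max_abs cmod x i"]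
        by (subst ln_le_cancel_iff) auto
      thus ?thesis using False by (auto simp: spread_def intro!: sum_nonneg)
    qed
    have "B * (real (dt i) / (real (n i) + 1)) \<le> B * \<delta>"
      unfolding \<delta>_def using B i False by (intro mult_left_mono delta_not_I) auto
    hence "1 - B * \<delta> \<le> A" by (simp add: A_def)
    hence "(1 - B * \<delta>) * spread x i \<le> A * spread x i" using \<open>spread x i \<ge> 0\<close> by (rule mult_right_mono)
    also have "A * spread x i = A * ((real (n i) + 1) * m) - (\<Sum>j=0..n i. A * ln (cmod (x (i, j))))"
      using False by (simp add: spread_def m_def sum_subtractf sum_distrib_left right_diff_distrib add.commute)
    finally have "(1 - B * \<delta>) * spread x i \<le> A * ((real (n i) + 1) * m) - (\<Sum>j=0..n i. A * ln (cmod (x (i, j))))" .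
    moreover have "(\<Sum>j=0..n i. weight B (i, j) * ln (cmod (x (i, j)))) = (\<Sum>j=0..n i. A * ln (cmod (x (i, j))))"
      using False by (simp add: weight_def A_def)
    moreover have "A * ((real (n i) + 1) * m) + B * (real (dt i) * m) = (real (n i) + 1) * m"
    proof -
      have "A * (real (n i) + 1) = real (n i) + 1 - B * real (dt i)"
        unfolding A_def left_diff_distrib by (simp add: add_nonneg_pos)
      hence "A * (real (n i) + 1) * m = (real (n i) + 1 - B * real (dt i)) * m" by simp
      thus ?thesis by (simp add: algebra_simps)
    qed
    ultimately show ?thesis using False by (simp add: h_def m_def[symmetric])
  qed
  have "(\<Sum>i=1..r. (1 - B * \<delta>) * spread x i + (\<Sum>j=0..n i. weight B (i, j) * ln (cmod (x (i, j)))) +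
      B * (real (dt i) * (ln (max_abs cmod x i) + h i))) \<le> (\<Sum>i=1..r. (real (n i) + 1) * ln (max_abs cmod x i))"
    by (rule sum_mono[OF per])
  hence 1: "(1 - B * \<delta>) * S + (\<Sum>w\<in>IP. weight B w * ln (cmod (x w))) +
      B * (\<Sum>i=1..r. real (dt i) * (ln (max_abs cmod x i) + h i)) \<le> (\<Sum>i=1..r. (real (n i) + 1) * ln (max_abs cmod x i))"
    by (simp add: sum.distrib sum_index_pairs S_def sum_distrib_left)
  have "B * ln (cmod (reciprocal a x)) \<le> B * (ln C + ln (1 - exp (- 2 * S)) +
      (\<Sum>i=1..r. real (dt i) * (ln (max_abs cmod x i) + h i)))"
    using b(3) B unfolding S_def h_def by (intro mult_left_mono) auto
  moreover have "ln \<rho> \<le> (1 - B * \<delta>) * S - B * ln C - B * ln (1 - exp (- 2 * S))"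
    using opt[of S] b(2) by (simp add: S_def \<delta>_def)
  ultimately show ?thesis using 1 by (simp add: algebra_simps)
qed

text \<open>As the coefficients are integral, each term of \<open>reciprocal\<close> is at most the
  product of the group maxima to the powers \<open>dt i\<close>, and so is the sum. No gain arises
  at a prime, hence there is no \<rho> here.\<close>

lemma nonarchimedean_inequality:
  assumes p: "Factorial_Ring.prime p"
    and a: "\<And>m. m \<in> M \<Longrightarrow> algebraic_int (a m)"
    and x: "\<And>w. w \<in> IP \<Longrightarrow> algebraic (x w) \<and> x w \<noteq> 0" and G: "reciprocal a x \<noteq> 0"
    and B: "B > 0" "B * delta r n d I F \<le> 1"
  defines "u \<equiv> ext_place p"
  shows "(\<Sum>w\<in>IP. weight B w * ln (u (x w))) + B * ln (u (reciprocal a x)) \<le>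
    (\<Sum>i=1..r. (real (n i) + 1) * ln (max_abs u x i))"
proof -
  interpret u: absolute_value algebraic_numbers u unfolding u_def by (rule absolute_value_ext_place_prime[OF p])
  have xi: "x (i, j) \<in> algebraic_numbers" "x (i, j) \<noteq> 0" if "i \<in> {1..r}" "j \<le> n i" for i j
    using x that by (auto simp: index_pairs_def)
  have mpos: "max_abs u x i > 0" if "i \<in> {1..r}" for i
    using max_abs_attained[of i u x] u.pos xi[OF that] by metis
  have ualg: "a m * (\<Prod>w\<in>IP. x w ^ (dg w - ex m w)) \<in> algebraic_numbers" if "m \<in> M" for m
    using a[OF that] x by (intro csf_mult[OF complex_subfield_algebraic] csf_prod[OF complex_subfield_algebraic]
        csf_power[OF complex_subfield_algebraic]) (auto intro: algebraic_int_imp_algebraic)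
  define L where "L = (\<Prod>i=1..r. max_abs u x i ^ dt i)"
  have L: "L > 0" unfolding L_def using mpos by (intro prod_pos) auto
  have le: "u (reciprocal a x) \<le> L"
    unfolding reciprocal_def u_def
  proof (rule ext_place_sum_le[OF p])
    show "0 \<le> L" using L by simp
    fix m assume m: "m \<in> M"
    show "algebraic (a m * (\<Prod>w\<in>IP. x w ^ (dg w - ex m w)))" using ualg[OF m] by simp
    have "a m \<in> algebraic_numbers" using a[OF m] by (auto intro: algebraic_int_imp_algebraic)
    moreover have "x w ^ (dg w - ex m w) \<in> algebraic_numbers" if "w \<in> IP" for w
      using x[OF that] by (intro csf_power[OF complex_subfield_algebraic]) simp
    ultimately have "u (a m * (\<Prod>w\<in>IP. x w ^ (dg w - ex m w))) = u (a m) * (\<Prod>w\<in>IP. u (x w ^ (dg w - ex m w)))"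
      using u.mult csf_prod[OF complex_subfield_algebraic, of IP "\<lambda>w. x w ^ (dg w - ex m w)"]
        u.prod[of IP "\<lambda>w. x w ^ (dg w - ex m w)"] by simp
    also have "(\<Prod>w\<in>IP. u (x w ^ (dg w - ex m w))) = (\<Prod>i=1..r. \<Prod>j=0..n i. u (x (i, j)) ^ (dg (i, j) - ex m (i, j)))"
      unfolding prod_index_pairs by (intro prod.cong refl u.power) (use xi in auto)
    also have "u (a m) * \<dots> \<le> 1 * (\<Prod>i=1..r. \<Prod>j=0..n i. max_abs u x i ^ (dg (i, j) - ex m (i, j)))"
    proof (rule mult_mono)
      show "u (a m) \<le> 1" unfolding u_def by (rule ext_place_algebraic_int[OF p a[OF m]])
      have nn: "0 \<le> u (x (i, j))" if "i \<in> {1..r}" "j \<in> {0..n i}" for i j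
        using u.nonneg[OF xi(1)] that by simp
      thus "0 \<le> (\<Prod>i=1..r. \<Prod>j=0..n i. u (x (i, j)) ^ (dg (i, j) - ex m (i, j)))"
        by (intro prod_nonneg zero_le_power)
      show "(\<Prod>i=1..r. \<Prod>j=0..n i. u (x (i, j)) ^ (dg (i, j) - ex m (i, j))) \<le>
          (\<Prod>i=1..r. \<Prod>j=0..n i. max_abs u x i ^ (dg (i, j) - ex m (i, j)))"
        using nn by (intro prod_mono conjI power_mono prod_nonneg zero_le_power max_abs_ge) auto
    qed simp
    also have "\<dots> = L"
      unfolding L_def by (simp add: power_sum[symmetric] sum_dg_minus_ex[OF m])
    finally show "ext_place p (a m * (\<Prod>w\<in>IP. x w ^ (dg w - ex m w))) \<le> L" by (simp add: u_def)
  qed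
  have "reciprocal a x \<in> algebraic_numbers" unfolding reciprocal_def
    by (rule csf_sum[OF complex_subfield_algebraic ualg])
  hence upos: "u (reciprocal a x) > 0" using G by (rule u.pos)
  have "ln (u (reciprocal a x)) \<le> ln L" using le upos L by simp
  also have "\<dots> = (\<Sum>i=1..r. real (dt i) * ln (max_abs u x i))"
  proof -
    have "max_abs u x i \<noteq> 0" if "i \<in> {1..r}" for i using mpos[OF that] by simp
    thus ?thesis unfolding L_def by (subst ln_prod) (auto simp: ln_realpow)
  qed
  finally have 1: "B * ln (u (reciprocal a x)) \<le> B * (\<Sum>i=1..r. real (dt i) * ln (max_abs u x i))"
    using B by (intro mult_left_mono) auto
  have "(\<Sum>w\<in>IP. weight B w * ln (u (x w))) \<le> (\<Sum>i=1..r. \<Sum>j=0..n i. weight B (i, j) * ln (max_abs u x i))"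
    unfolding sum_index_pairs
  proof (intro sum_mono mult_left_mono)
    fix i j assume ij: "i \<in> {1..r}" "j \<in> {0..n i}"
    show "ln (u (x (i, j))) \<le> ln (max_abs u x i)"
      using max_abs_ge[of j i u x] u.pos[OF xi] mpos ij by simp
    show "weight B (i, j) \<ge> 0" using ij B by (intro weight_nonneg) (auto simp: index_pairs_def)
  qed
  also have "\<dots> = (\<Sum>i=1..r. (real (n i) + 1 - B * real (dt i)) * ln (max_abs u x i))"
    by (intro sum.cong refl) (simp add: sum_distrib_right[symmetric] sum_weight)
  finally show ?thesis using 1 by (simp add: algebra_simps sum.distrib sum_subtractf sum_distrib_left)
qed

end

section \<open>Conjugation preserves the hypotheses on the coefficients\<close>

context conjugate_places
begin

lemma conj_1: "z \<in> roots_of f \<Longrightarrow> conj_map \<theta> z 1 = 1"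
  using conj_of_rat[of z 1] by simp

lemma conj_0: "z \<in> roots_of f \<Longrightarrow> conj_map \<theta> z 0 = 0"
  using conj_of_rat[of z 0] by simp

lemma conj_power: "z \<in> roots_of f \<Longrightarrow> a \<in> \<F> \<Longrightarrow> conj_map \<theta> z (a ^ k) = conj_map \<theta> z a ^ k"
  by (induction k) (auto simp: conj_1 conj_mult csf_power[OF subfield_F])

lemma conj_prod: "z \<in> roots_of f \<Longrightarrow> (\<And>i. i \<in> A \<Longrightarrow> g i \<in> \<F>) \<Longrightarrow>
    conj_map \<theta> z (prod g A) = (\<Prod>i\<in>A. conj_map \<theta> z (g i))"
  by (induction A rule: infinite_finite_induct) (auto simp: conj_1 conj_mult csf_prod[OF subfield_F])

lemma conj_sum: "z \<in> roots_of f \<Longrightarrow> (\<And>i. i \<in> A \<Longrightarrow> g i \<in> \<F>) \<Longrightarrow>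
    conj_map \<theta> z (sum g A) = (\<Sum>i\<in>A. conj_map \<theta> z (g i))"
  by (induction A rule: infinite_finite_induct) (auto simp: conj_0 conj_add csf_sum[OF subfield_F])

lemma conj_rat_eval_of: "z \<in> roots_of f \<Longrightarrow> a \<in> \<F> \<Longrightarrow> conj_map \<theta> z (rat_eval q a) = rat_eval q (conj_map \<theta> z a)"
  unfolding F_iff by (metis conj_rat_eval rat_eval_pcompose)

lemma conj_algebraic_int:
  assumes z: "z \<in> roots_of f" and a: "a \<in> \<F>" "algebraic_int a" shows "algebraic_int (conj_map \<theta> z a)"
proof -
  obtain p :: "int poly" where p: "poly (map_poly of_int p) a = 0" "lead_coeff p = 1"
    using a(2) by (auto simp: algebraic_int_altdef_ipoly)
  have *: "rat_eval (map_poly of_int p) y = poly (map_poly of_int p) y" for y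
    unfolding rat_eval_def by (simp add: map_poly_map_poly o_def)
  have "rat_eval (map_poly of_int p) (conj_map \<theta> z a) = 0"
    using conj_rat_eval_of[OF z a(1), of "map_poly of_int p"] p(1) by (simp add: * conj_0[OF z])
  thus ?thesis using p(2) by (auto simp: * algebraic_int_altdef_ipoly)
qed

text \<open>The conjugate is a root of the same rational polynomial, all of whose roots are
  real.\<close>

lemma conj_totally_real:
  assumes z: "z \<in> roots_of f" and a: "a \<in> \<F>" "totally_real a" shows "cnj (conj_map \<theta> z a) = conj_map \<theta> z a"
proof -
  obtain p :: "rat poly" where p: "rat_eval p a = 0" "\<And>y. rat_eval p y = 0 \<Longrightarrow> y \<in> \<real>"
    using a(2) by (auto simp: totally_real_def rat_eval_def)
  have "rat_eval p (conj_map \<theta> z a) = 0" using conj_rat_eval_of[OF z a(1), of p] p(1) by (simp add: conj_0[OF z])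
  thus ?thesis using p(2) by (simp add: Reals_cnj_iff)
qed

lemma conj_Ints: "z \<in> roots_of f \<Longrightarrow> a \<in> \<int> \<Longrightarrow> conj_map \<theta> z a = a"
  using conj_of_rat by (metis Ints_cases of_rat_of_int_eq)

end

section \<open>Summation over embeddings and primes\<close>

theorem theorem2p1:
  fixes r :: nat and n d :: "nat \<Rightarrow> nat" and I :: "nat set"
    and F :: mpolynomial and x :: "nat \<times> nat \<Rightarrow> complex"
  assumes "r \<ge> 1"
    and "\<And>i. i \<in> {1..r} \<Longrightarrow> n i \<ge> 1"
    and "I \<subseteq> {i \<in> {1..r}. n i = 1}"
    and "multihomogeneous r n d F"
    and "\<And>m. m \<in> Poly_Mapping.keys F \<Longrightarrow>
           algebraic_int (Poly_Mapping.lookup F m) \<and> totally_real (Poly_Mapping.lookup F m)"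
    and "\<And>m. m \<in> Poly_Mapping.keys F \<Longrightarrow> regular_monomial (exceptional_pairs I) m \<Longrightarrow>
           Poly_Mapping.lookup F m \<in> \<int>"
    and "\<And>w. w \<in> index_pairs r n \<Longrightarrow> algebraic (x w)"
    and "mpoly_eval F x = 0"
    and "(\<Prod>w\<in>index_pairs r n. x w) \<noteq> 0"
    and "mpoly_eval F (\<lambda>w. inverse (x w)) \<noteq> 0"
  shows "\<exists>\<rho>>1.
      (\<forall>t>1. t powr (-2) + inverse (C_const r n (exceptional_pairs I) F) * t powr (- delta r n d I F) = 1
             \<longleftrightarrow> t = \<rho>) \<and>
      (\<Sum>i=1..r. (real (n i) + 1) * log_height (n i) (\<lambda>j. x (i, j))) \<ge> ln \<rho>"
proof -
  have "Poly_Mapping.keys F \<noteq> {}" using assms(10) by (auto simp: mpoly_eval_def)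
  then interpret multihomogeneous_polynomial r n d I F using assms by unfold_locales auto
  define a where "a = Poly_Mapping.lookup F"
  define g where "g = reciprocal a x"
  have xnz: "x w \<noteq> 0" if "w \<in> IP" for w using assms(9) that finite_IP by auto
  have gnz: "g \<noteq> 0"
    using reciprocal_eq[OF xnz, where a = a] assms(10) xnz finite_IP by (simp add: g_def a_def mpoly_eval_eq)
  have zero: "eval_with a x = 0" using assms(8) by (simp add: a_def mpoly_eval_eq)
  have aint: "algebraic_int (a m)" and areal: "totally_real (a m)" if "m \<in> M" for m
    using assms(5)[OF that] by (auto simp: a_def)
  \<comment> \<open>Contains coordinates and coefficients, so that the equation F(x) = 0 and g live
    in one number field.\<close>
  define gens where "gens = x ` IP \<union> a ` M"
  have "finite gens" using finite_IP by (simp add: gens_def)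
  moreover have "algebraic y" if "y \<in> gens" for y
    using that assms(7) aint by (auto simp: gens_def intro: algebraic_int_imp_algebraic)
  ultimately obtain \<theta> where \<theta>: "algebraic \<theta>" "generate_field complex_ring gens = rat_adjoin \<theta>"
    using primitive_element[of gens] by blast
  obtain f where f: "is_minpoly f \<theta>" using exists_minpoly[OF \<theta>(1)] .
  have ps: "conjugate_places f \<theta> (ext_place 0) (base_abs 0)" by (rule conjugate_places_ext_place[OF f \<theta>(1)]) simp
  interpret conjugate_places f \<theta> cmod "base_abs 0" using ps by simp
  have gens_F: "y \<in> number_field" if "y \<in> gens" for y
    using generate_field.incl[OF that, of complex_ring] \<theta>(2) by (simp add: number_field_def)
  have xF: "x w \<in> number_field" if "w \<in> IP" for w using gens_F that by (simp add: gens_def)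
  have aF: "a m \<in> number_field" if "m \<in> M" for m using gens_F that by (simp add: gens_def)
  have gF: "g \<in> number_field" unfolding g_def reciprocal_def
    by (intro csf_sum[OF subfield_F] csf_mult[OF subfield_F] csf_prod[OF subfield_F] csf_power[OF subfield_F] aF xF)
  define R where "R = roots_of f"
  have finR: "finite R" unfolding R_def using finite_roots_of is_minpoly_nonzero[OF f] by blast
  define \<sigma> where "\<sigma> = conj_map \<theta>"
  have \<sigma>g: "\<sigma> z g = reciprocal (\<lambda>m. \<sigma> z (a m)) (\<lambda>w. \<sigma> z (x w))" if z: "z \<in> R" for z
    using z xF aF unfolding g_def reciprocal_def \<sigma>_def R_def
    by (subst conj_sum) (auto simp: conj_mult conj_prod conj_power csf_mult[OF subfield_F] csf_prod[OF subfield_F] csf_power[OF subfield_F])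
  have \<sigma>zero: "eval_with (\<lambda>m. \<sigma> z (a m)) (\<lambda>w. \<sigma> z (x w)) = 0" if z: "z \<in> R" for z
  proof -
    have "\<sigma> z (eval_with a x) = eval_with (\<lambda>m. \<sigma> z (a m)) (\<lambda>w. \<sigma> z (x w))"
      using z xF aF unfolding eval_with_def \<sigma>_def R_def
      by (subst conj_sum) (auto simp: conj_mult conj_prod conj_power csf_mult[OF subfield_F] csf_prod[OF subfield_F] csf_power[OF subfield_F])
    thus ?thesis using zero conj_0 z by (simp add: \<sigma>_def R_def)
  qed
  have \<sigma>nz: "\<sigma> z y \<noteq> 0" if "z \<in> R" "y \<in> number_field" "y \<noteq> 0" for z y using conj_eq_0_iff that by (simp add: \<sigma>_def R_def)
  have \<sigma>alg: "algebraic (\<sigma> z y)" if "z \<in> R" "y \<in> number_field" for z y using conj_algebraic that by (simp add: \<sigma>_def R_def)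
  \<comment> \<open>The Archimedean bound is taken at x itself, that is for the identity
    embedding.\<close>
  have Cpos: "C > 0"
  proof (rule archimedean_bound(1)[OF _ _ xnz zero])
    show "cnj (a m) = a m" if "m \<in> M" for m
      using areal[OF that] by (auto simp: totally_real_def Reals_cnj_iff)
  qed (use gnz in \<open>auto simp: a_def g_def\<close>)
  have \<delta>pos: "delta r n d I F > 0" by (rule delta_pos[OF xnz assms(8)])
  obtain \<rho> where \<rho>: "\<rho> > 1" "\<And>t. t > 1 \<Longrightarrow> t powr (-2) + inverse C * t powr (- delta r n d I F) = 1 \<longleftrightarrow> t = \<rho>"
    using exists_unique_rho[OF Cpos \<delta>pos] by blast
  have "\<rho> powr (-2) + inverse C * \<rho> powr (- delta r n d I F) = 1" using \<rho> by blast
  then obtain B where B: "B > 0" "B * delta r n d I F \<le> 1"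
    "\<And>S. S > 0 \<Longrightarrow> ln \<rho> \<le> (1 - B * delta r n d I F) * S - B * ln C - B * ln (1 - exp (- 2 * S))"
    using rho_optimal[OF Cpos \<delta>pos \<rho>(1)] by metis
  \<comment> \<open>The primes at which some conjugate of g or of a coordinate is not a unit;
    outside this set every logarithm below vanishes.\<close>
  define T where "T = (\<Union>y\<in>insert g (x ` IP). \<Union>z\<in>R. {p. Factorial_Ring.prime p \<and> ext_place p (\<sigma> z y) \<noteq> 1})"
  have T: "finite T" "\<And>p. p \<in> T \<Longrightarrow> Factorial_Ring.prime p"
  proof -
    show "finite T" unfolding T_def
    proof (intro finite_UN_I finR)
      fix y z assume yz: "y \<in> insert g (x ` IP)" "z \<in> R"
      hence "y \<in> number_field" "y \<noteq> 0" using gF gnz xF xnz by auto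
      thus "finite {p. Factorial_Ring.prime p \<and> ext_place p (\<sigma> z y) \<noteq> 1}"
        using yz by (intro finite_nonunit_places \<sigma>alg \<sigma>nz)
    qed (use finite_IP in auto)
  qed (auto simp: T_def)
  have T1: "ext_place p (\<sigma> z y) = 1" if "Factorial_Ring.prime p" "p \<notin> T" "z \<in> R" "y \<in> insert g (x ` IP)" for p z y
    using that unfolding T_def by blast
  define D where "D = real (degree f)"
  have D: "D > 0" using is_minpoly_degree_pos[OF f] by (simp add: D_def)
  have cardR: "real (card R) = D" using card_roots_of[OF f] by (simp add: R_def D_def)
  define x' where "x' = (\<lambda>z w. \<sigma> z (x w))"
  have height: "log_height (n i) (\<lambda>j. x (i, j)) = (\<Sum>z\<in>R. \<Sum>p\<in>insert 0 T. ln (max_abs (ext_place p) (x' z) i)) / D"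
    if i: "i \<in> {1..r}" for i
    unfolding max_abs_def x'_def \<sigma>_def R_def D_def
  proof (rule log_height_eq[OF f _ \<theta>(1) T])
    fix j assume "j \<le> n i"
    hence w: "(i, j) \<in> IP" using i by (simp add: index_pairs_def)
    show "x (i, j) \<in> rat_adjoin \<theta> \<and> x (i, j) \<noteq> 0" using xF[OF w] xnz[OF w] by (simp add: number_field_def)
    fix p z assume "Factorial_Ring.prime p" "p \<notin> T" "z \<in> roots_of f"
    thus "ext_place p (conj_map \<theta> z (x (i, j))) = 1" using T1[of p z "x (i, j)"] w by (simp add: \<sigma>_def R_def)
  qed
  have pf: "(\<Sum>z\<in>R. \<Sum>p\<in>insert 0 T. ln (ext_place p (\<sigma> z y))) = 0" if y: "y \<in> insert g (x ` IP)" for y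
    unfolding \<sigma>_def R_def
  proof (rule global_product_formula[OF f \<theta>(1) _ _ T])
    show "y \<in> rat_adjoin \<theta>" "y \<noteq> 0" using y gF gnz xF xnz by (auto simp: number_field_def)
    show "ext_place p (conj_map \<theta> z y) = 1" if "Factorial_Ring.prime p" "p \<notin> T" "z \<in> roots_of f" for p z
      using T1[of p z y] that y by (simp add: \<sigma>_def R_def)
  qed
  have local: "(if p = 0 then ln \<rho> else 0) + (\<Sum>w\<in>IP. weight B w * ln (ext_place p (x' z w))) + B * ln (ext_place p (\<sigma> z g))
      \<le> (\<Sum>i=1..r. (real (n i) + 1) * ln (max_abs (ext_place p) (x' z) i))" if z: "z \<in> R" and p: "p \<in> insert 0 T" for z p
  proof (cases "p = 0")
    case True
    have "ln \<rho> + (\<Sum>w\<in>IP. weight B w * ln (cmod (x' z w))) + B * ln (cmod (reciprocal (\<lambda>m. \<sigma> z (a m)) (x' z)))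
      \<le> (\<Sum>i=1..r. (real (n i) + 1) * ln (max_abs cmod (x' z) i))"
    proof (rule archimedean_inequality[OF _ _ _ _ _ B])
      fix m assume m: "m \<in> M"
      show "cnj (\<sigma> z (a m)) = \<sigma> z (a m)"
        using conj_totally_real[OF _ aF[OF m] areal[OF m]] z by (simp add: \<sigma>_def R_def)
      assume "regular_monomial E m"
      hence "a m \<in> \<int>" using assms(6)[OF m] by (simp add: a_def)
      thus "cmod (\<sigma> z (a m)) = cmod (Poly_Mapping.lookup F m)"
        using conj_Ints z by (simp add: \<sigma>_def R_def a_def)
    next
      show "x' z w \<noteq> 0" if "w \<in> IP" for w using \<sigma>nz[OF z xF[OF that] xnz[OF that]] by (simp add: x'_def)
      show "eval_with (\<lambda>m. \<sigma> z (a m)) (x' z) = 0" using \<sigma>zero[OF z] by (simp add: x'_def)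
      show "reciprocal (\<lambda>m. \<sigma> z (a m)) (x' z) \<noteq> 0" using \<sigma>g[OF z] \<sigma>nz[OF z gF gnz] by (simp add: x'_def)
    qed
    thus ?thesis using True \<sigma>g[OF z] by (simp add: x'_def)
  next
    case False
    hence pr: "Factorial_Ring.prime p" using p T(2) by simp
    have "(\<Sum>w\<in>IP. weight B w * ln (ext_place p (x' z w))) + B * ln (ext_place p (reciprocal (\<lambda>m. \<sigma> z (a m)) (x' z)))
      \<le> (\<Sum>i=1..r. (real (n i) + 1) * ln (max_abs (ext_place p) (x' z) i))"
    proof (rule nonarchimedean_inequality[OF pr _ _ _ B(1,2)])
      show "algebraic_int (\<sigma> z (a m))" if "m \<in> M" for m
        using conj_algebraic_int[OF _ aF[OF that] aint[OF that]] z by (simp add: \<sigma>_def R_def)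
      show "algebraic (x' z w) \<and> x' z w \<noteq> 0" if "w \<in> IP" for w
        using \<sigma>nz[OF z xF[OF that] xnz[OF that]] \<sigma>alg[OF z xF[OF that]] by (simp add: x'_def)
      show "reciprocal (\<lambda>m. \<sigma> z (a m)) (x' z) \<noteq> 0" using \<sigma>g[OF z] \<sigma>nz[OF z gF gnz] by (simp add: x'_def)
    qed
    thus ?thesis using False \<sigma>g[OF z] by (simp add: x'_def)
  qed
  have "0 \<notin> T" using T(2) prime_gt_0_nat by blast
  define U where "U = insert 0 T"
  \<comment> \<open>ln \<rho> is gained at the Archimedean index only, once for each of the D
    embeddings. The sums added in the next step are zero by the product formula.\<close>
  have "D * ln \<rho> = (\<Sum>z\<in>R. \<Sum>p\<in>U. if p = 0 then ln \<rho> else 0)"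
    using T(1) cardR by (simp add: U_def)
  also have "\<dots> = (\<Sum>z\<in>R. \<Sum>p\<in>U. if p = 0 then ln \<rho> else 0) +
      (\<Sum>w\<in>IP. weight B w * (\<Sum>z\<in>R. \<Sum>p\<in>U. ln (ext_place p (\<sigma> z (x w))))) +
      B * (\<Sum>z\<in>R. \<Sum>p\<in>U. ln (ext_place p (\<sigma> z g)))"
    using pf by (simp add: U_def)
  also have "(\<Sum>w\<in>IP. weight B w * (\<Sum>z\<in>R. \<Sum>p\<in>U. ln (ext_place p (\<sigma> z (x w))))) =
      (\<Sum>z\<in>R. \<Sum>p\<in>U. \<Sum>w\<in>IP. weight B w * ln (ext_place p (x' z w)))"
    unfolding sum_distrib_left x'_def by (simp only: sum.swap[of _ IP])
  also have "B * (\<Sum>z\<in>R. \<Sum>p\<in>U. ln (ext_place p (\<sigma> z g))) = (\<Sum>z\<in>R. \<Sum>p\<in>U. B * ln (ext_place p (\<sigma> z g)))"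
    by (simp add: sum_distrib_left)
  also have "(\<Sum>z\<in>R. \<Sum>p\<in>U. if p = 0 then ln \<rho> else 0) +
      (\<Sum>z\<in>R. \<Sum>p\<in>U. \<Sum>w\<in>IP. weight B w * ln (ext_place p (x' z w))) +
      (\<Sum>z\<in>R. \<Sum>p\<in>U. B * ln (ext_place p (\<sigma> z g))) =
      (\<Sum>z\<in>R. \<Sum>p\<in>U. (if p = 0 then ln \<rho> else 0) + (\<Sum>w\<in>IP. weight B w * ln (ext_place p (x' z w))) +
         B * ln (ext_place p (\<sigma> z g)))" by (simp add: sum.distrib)
  also have "\<dots> \<le> (\<Sum>z\<in>R. \<Sum>p\<in>U. \<Sum>i=1..r. (real (n i) + 1) * ln (max_abs (ext_place p) (x' z) i))"
    unfolding U_def by (intro sum_mono local)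
  also have "\<dots> = (\<Sum>i=1..r. (real (n i) + 1) * (\<Sum>z\<in>R. \<Sum>p\<in>U. ln (max_abs (ext_place p) (x' z) i)))"
    unfolding sum_distrib_left by (simp only: sum.swap[of _ _ "{1..r}"])
  also have "\<dots> = D * (\<Sum>i=1..r. (real (n i) + 1) * log_height (n i) (\<lambda>j. x (i, j)))"
  proof (subst sum_distrib_left[of D], rule sum.cong[OF refl])
    fix i assume "i \<in> {1..r}"
    thus "(real (n i) + 1) * (\<Sum>z\<in>R. \<Sum>p\<in>U. ln (max_abs (ext_place p) (x' z) i)) =
        D * ((real (n i) + 1) * log_height (n i) (\<lambda>j. x (i, j)))"
      using D by (simp add: height U_def)
  qed
  finally have "ln \<rho> \<le> (\<Sum>i=1..r. (real (n i) + 1) * log_height (n i) (\<lambda>j. x (i, j)))" using D by simp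
  thus ?thesis using \<rho> by blast
qed

end
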